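(* Let $V$ be a finite-dimensional real vector space with $\dim\mathbb{P}(V)\geq 2$. Let $\Gamma_0$ be a nontrivial discrete subgroup of $\mathrm{PGL}(V)$ preserving a properly convex open subset $\Omega_0$ of $\mathbb{P}(V)$. Let $t\in\mathrm{PGL}(V)$, let $\Delta:=\Gamma_0\cap t\Gamma_0t^{-1}$, and let $\Gamma:=(\Gamma_0)*_t$ be the HNN extension of $\Gamma_0$ determined by the conjugation $c_t:t^{-1}\Delta t\to\Delta$. Suppose that (1) for every $\gamma\in\Gamma_0$, the triple of properly convex open sets $(t\cdot\Omega_0,\ \Omega_0,\ \gamma t^{-1}\cdot\Omega_0)$ is in occultation position, and (2) for every $\varepsilon\in\{1,-1\}$ and every $\gamma'\in\Gamma_0\smallsetminus t^{\varepsilon}\Gamma_0t^{-\varepsilon}$, the triple of properly convex open sets $(t^{\varepsilon}\cdot\Omega_0,\ \Omega_0,\ \gamma't^{\varepsilon}\cdot\Omega_0)$ is in occultation position. Then the representation $\rho:\Gamma\to\mathrm{PGL}(V)$ induced by the inclusions $\Gamma_0,\langle t\rangle\hookrightarrow\mathrm{PGL}(V)$ is discrete and faithful, and the $\rho(\Gamma)$-invariant open set $$\Omega:=\bigcup_{\gamma\in\Gamma}\rho(\gamma)\cdot\langle\!\langle\Omega_0\cup t\cdot\Omega_0\rangle\!\rangle$$ is well defined and properly convex.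
   Context: The HNN extension $(\Gamma_0)*_t$ is the abstract group generated by $\Gamma_0$ and a stable letter (again denoted $t$) subject to the relations $t\delta t^{-1}=c_t(\delta)$ for $\delta\in t^{-1}\Delta t\subset\Gamma_0$, where $c_t$ is conjugation by the element $t$ of $\mathrm{PGL}(V)$; $\rho$ restricts to the inclusion on $\Gamma_0$ and sends the stable letter to $t\in\mathrm{PGL}(V)$. An open subset of $\mathbb{P}(V)$ is properly convex if it is contained, convex and bounded in some affine chart. For a connected subset $X$ of $\mathbb{P}(V)$ contained in an affine chart, $\langle\!\langle X\rangle\!\rangle$ is its convex hull in that chart (independent of the choice of affine chart containing $X$). For a properly convex open set $\Omega$, its dual is $\Omega^*:=\{H\in\mathbb{P}(V^* ): H\cap\overline{\Omega}=\varnothing\}$, where elements of $\mathbb{P}(V^* )$ are viewed as projective hyperplanes of $\mathbb{P}(V)$. A triple $(A,B,C)$ of properly convex open sets is in occultation position if: $A\not\subset B$ and $C\not\subset B$; $A\cap B\neq\varnothing$, $B\cap C\neq\varnothing$, but $A\cap C=\varnothing$; and $\overline{B^*}\subset A^*\cup C^*$. A representation is discrete and faithful if it is injective with discrete image. *)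

theory Defs
  imports "HOL-Analysis.Analysis" "HOL-Algebra.Group"
begin

section \<open>Projective spaces\<close>

(* Makes the projective space of a dual space a type; the class only guarantees nontriviality. *)
instance blinfun :: (euclidean_space, euclidean_space) perfect_space
proof
  fix f :: "'a \<Rightarrow>\<^sub>L 'b"
  obtain b :: 'a where b: "b \<in> Basis" using nonempty_Basis by blast
  obtain c :: 'b where c: "c \<in> Basis" using nonempty_Basis by blast
  define h :: "'a \<Rightarrow>\<^sub>L 'b" where "h = blinfun_scaleR_left c o\<^sub>L blinfun_inner_right b"
  have "h b = c" using b by (simp add: h_def inner_Basis)
  then have h: "h \<noteq> 0" using c nonzero_Basis by fastforce
  show "\<not> open {f}"
  proof
    assume "open {f}"
    then obtain e where e: "e > 0" "\<And>y. dist y f < e \<Longrightarrow> y = f"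
      unfolding open_dist by auto
    define y where "y = f + (e / (2 * norm h)) *\<^sub>R h"
    have "dist y f < e" using e(1) h by (simp add: y_def dist_norm)
    with e(2) have "y = f" by blast
    then show False using e(1) h by (simp add: y_def)
  qed
qed

quotient_type (overloaded) 'v proj =
    "'v :: {real_normed_vector, perfect_space}" / partial:
    "\<lambda>x y. x \<noteq> 0 \<and> y \<noteq> 0 \<and> (\<exists>c::real. c \<noteq> 0 \<and> y = c *\<^sub>R x)"
  morphisms rep_proj proj_pt
proof (rule part_equivpI)
  have "\<exists>x::'v. x \<noteq> 0"
    by (metis not_open_singleton open_UNIV UNIV_eq_I singletonI)
  then obtain x :: 'v where "x \<noteq> 0" by blast
  then show "\<exists>x::'v. x \<noteq> 0 \<and> x \<noteq> 0 \<and> (\<exists>c::real. c \<noteq> 0 \<and> x = c *\<^sub>R x)"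
    by (intro exI[of _ x] conjI exI[of _ "1::real"]) auto
  show "symp (\<lambda>x y::'v. x \<noteq> 0 \<and> y \<noteq> 0 \<and> (\<exists>c::real. c \<noteq> 0 \<and> y = c *\<^sub>R x))"
  proof (rule sympI)
    fix x y :: 'v
    assume "x \<noteq> 0 \<and> y \<noteq> 0 \<and> (\<exists>c::real. c \<noteq> 0 \<and> y = c *\<^sub>R x)"
    then obtain c :: real where "x \<noteq> 0" "y \<noteq> 0" "c \<noteq> 0" "y = c *\<^sub>R x" by blast
    then show "y \<noteq> 0 \<and> x \<noteq> 0 \<and> (\<exists>c::real. c \<noteq> 0 \<and> x = c *\<^sub>R y)"
      by (intro conjI exI[of _ "inverse c"]) auto
  qed
  show "transp (\<lambda>x y::'v. x \<noteq> 0 \<and> y \<noteq> 0 \<and> (\<exists>c::real. c \<noteq> 0 \<and> y = c *\<^sub>R x))"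
    by (rule transpI) (metis mult_eq_0_iff scaleR_scaleR)
qed

(* The quotient topology; the value of proj_pt at 0 is irrelevant. *)
instantiation proj :: ("{real_normed_vector, perfect_space}") topological_space
begin

definition open_proj :: "'a proj set \<Rightarrow> bool"
  where "open_proj U \<longleftrightarrow> open {v. v \<noteq> 0 \<and> proj_pt v \<in> U}"

instance
proof
  have "{v::'a. v \<noteq> 0 \<and> proj_pt v \<in> UNIV} = - {0}" by auto
  then show "open (UNIV :: 'a proj set)" by (simp add: open_proj_def open_Compl)
next
  fix S T :: "'a proj set"
  assume "open S" "open T"
  then have "open ({v. v \<noteq> 0 \<and> proj_pt v \<in> S} \<inter> {v. v \<noteq> 0 \<and> proj_pt v \<in> T})"
    unfolding open_proj_def by (rule open_Int)
  moreover have "{v. v \<noteq> 0 \<and> proj_pt v \<in> S} \<inter> {v. v \<noteq> 0 \<and> proj_pt v \<in> T}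
      = {v. v \<noteq> 0 \<and> proj_pt v \<in> S \<inter> T}" by auto
  ultimately show "open (S \<inter> T)" by (simp add: open_proj_def)
next
  fix K :: "'a proj set set"
  assume "\<forall>S\<in>K. open S"
  then have "open (\<Union>S\<in>K. {v. v \<noteq> 0 \<and> proj_pt v \<in> S})"
    unfolding open_proj_def by (intro open_UN) auto
  moreover have "(\<Union>S\<in>K. {v. v \<noteq> 0 \<and> proj_pt v \<in> S}) = {v. v \<noteq> 0 \<and> proj_pt v \<in> \<Union>K}"
    by auto
  ultimately show "open (\<Union>K)" by (simp add: open_proj_def)
qed

end

section \<open>The projective linear group\<close>

quotient_type (overloaded) 'a pgl = "'a::euclidean_space \<Rightarrow>\<^sub>L 'a" / partial:
    "\<lambda>f g. bij (blinfun_apply f) \<and> bij (blinfun_apply g) \<and> (\<exists>c::real. c \<noteq> 0 \<and> g = c *\<^sub>R f)"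
  morphisms rep_pgl pgl_class
proof (rule part_equivpI)
  show "\<exists>f::'a \<Rightarrow>\<^sub>L 'a. bij (blinfun_apply f) \<and> bij (blinfun_apply f) \<and>
      (\<exists>c::real. c \<noteq> 0 \<and> f = c *\<^sub>R f)"
    by (intro exI[of _ id_blinfun] conjI exI[of _ "1::real"]) (auto simp: bij_def inj_on_def)
  show "symp (\<lambda>f g::'a \<Rightarrow>\<^sub>L 'a. bij (blinfun_apply f) \<and> bij (blinfun_apply g) \<and>
      (\<exists>c::real. c \<noteq> 0 \<and> g = c *\<^sub>R f))"
  proof (rule sympI)
    fix f g :: "'a \<Rightarrow>\<^sub>L 'a"
    assume "bij (blinfun_apply f) \<and> bij (blinfun_apply g) \<and> (\<exists>c::real. c \<noteq> 0 \<and> g = c *\<^sub>R f)"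
    then obtain c :: real where "bij (blinfun_apply f)" "bij (blinfun_apply g)" "c \<noteq> 0" "g = c *\<^sub>R f"
      by blast
    then show "bij (blinfun_apply g) \<and> bij (blinfun_apply f) \<and> (\<exists>c::real. c \<noteq> 0 \<and> f = c *\<^sub>R g)"
      by (intro conjI exI[of _ "inverse c"]) auto
  qed
  show "transp (\<lambda>f g::'a \<Rightarrow>\<^sub>L 'a. bij (blinfun_apply f) \<and> bij (blinfun_apply g) \<and>
      (\<exists>c::real. c \<noteq> 0 \<and> g = c *\<^sub>R f))"
    by (rule transpI) (metis mult_eq_0_iff scaleR_scaleR)
qed

(* The quotient topology from GL(V), as a subspace of End(V). *)
instantiation pgl :: (euclidean_space) topological_space
begin

definition open_pgl :: "'a pgl set \<Rightarrow> bool"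
  where "open_pgl U \<longleftrightarrow>
    openin (top_of_set {f. bij (blinfun_apply f)}) {f. bij (blinfun_apply f) \<and> pgl_class f \<in> U}"

instance
proof
  show "open (UNIV :: 'a pgl set)" by (simp add: open_pgl_def)
next
  fix S T :: "'a pgl set"
  let ?T = "top_of_set {f::'a \<Rightarrow>\<^sub>L 'a. bij (blinfun_apply f)}"
  assume "open S" "open T"
  then have "openin ?T ({f. bij (blinfun_apply f) \<and> pgl_class f \<in> S} \<inter>
      {f. bij (blinfun_apply f) \<and> pgl_class f \<in> T})"
    unfolding open_pgl_def by (rule openin_Int)
  moreover have "{f. bij (blinfun_apply f) \<and> pgl_class f \<in> S} \<inter>
      {f. bij (blinfun_apply f) \<and> pgl_class f \<in> T}
      = {f. bij (blinfun_apply f) \<and> pgl_class f \<in> S \<inter> T}" by auto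
  ultimately show "open (S \<inter> T)" by (simp add: open_pgl_def)
next
  fix K :: "'a pgl set set"
  let ?T = "top_of_set {f::'a \<Rightarrow>\<^sub>L 'a. bij (blinfun_apply f)}"
  assume "\<forall>S\<in>K. open S"
  then have "openin ?T (\<Union>((\<lambda>S. {f. bij (blinfun_apply f) \<and> pgl_class f \<in> S}) ` K))"
    unfolding open_pgl_def by (intro openin_Union) auto
  moreover have "\<Union>((\<lambda>S. {f. bij (blinfun_apply f) \<and> pgl_class f \<in> S}) ` K)
      = {f. bij (blinfun_apply f) \<and> pgl_class f \<in> \<Union>K}" by auto
  ultimately show "open (\<Union>K)" by (simp add: open_pgl_def)
qed

end

lift_definition pgl_mult :: "'a::euclidean_space pgl \<Rightarrow> 'a pgl \<Rightarrow> 'a pgl"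
  is "\<lambda>f g. f o\<^sub>L g"
proof -
  fix f f' g g' :: "'a \<Rightarrow>\<^sub>L 'a"
  assume "bij (blinfun_apply f) \<and> bij (blinfun_apply f') \<and> (\<exists>c::real. c \<noteq> 0 \<and> f' = c *\<^sub>R f)"
    "bij (blinfun_apply g) \<and> bij (blinfun_apply g') \<and> (\<exists>c::real. c \<noteq> 0 \<and> g' = c *\<^sub>R g)"
  then obtain c d :: real where *: "bij (blinfun_apply f)" "bij (blinfun_apply f')"
      "bij (blinfun_apply g)" "bij (blinfun_apply g')"
      "c \<noteq> 0" "d \<noteq> 0" "f' = c *\<^sub>R f" "g' = d *\<^sub>R g" by blast
  have "f' o\<^sub>L g' = (c * d) *\<^sub>R (f o\<^sub>L g)"
    using * by (intro blinfun_eqI) (simp add: blinfun.bilinear_simps scaleR_blinfun.rep_eq)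
  moreover have "blinfun_apply (h o\<^sub>L k) = blinfun_apply h \<circ> blinfun_apply k" for h k :: "'a \<Rightarrow>\<^sub>L 'a"
    by auto
  ultimately show "bij (blinfun_apply (f o\<^sub>L g)) \<and> bij (blinfun_apply (f' o\<^sub>L g')) \<and>
      (\<exists>c::real. c \<noteq> 0 \<and> f' o\<^sub>L g' = c *\<^sub>R (f o\<^sub>L g))"
    using * by (metis bij_comp mult_eq_0_iff)
qed

lift_definition pgl_one :: "'a::euclidean_space pgl" is id_blinfun
  by (intro conjI exI[of _ "1::real"]) (auto simp: bij_def inj_on_def)

definition PGL :: "'a::euclidean_space pgl monoid"
  where "PGL = \<lparr>carrier = UNIV, mult = pgl_mult, one = pgl_one\<rparr>"

lemma group_PGL: "group (PGL :: 'a::euclidean_space pgl monoid)"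
proof (rule groupI)
  fix x y z :: "'a pgl"
  show "x \<otimes>\<^bsub>PGL\<^esub> y \<in> carrier PGL" by (simp add: PGL_def)
  show "x \<otimes>\<^bsub>PGL\<^esub> y \<otimes>\<^bsub>PGL\<^esub> z = x \<otimes>\<^bsub>PGL\<^esub> (y \<otimes>\<^bsub>PGL\<^esub> z)"
    unfolding PGL_def monoid.simps
  proof (transfer, intro conjI exI[of _ "1::real"])
    fix x y z :: "'a \<Rightarrow>\<^sub>L 'a"
    assume a: "bij (blinfun_apply x) \<and> bij (blinfun_apply x) \<and> (\<exists>c::real. c \<noteq> 0 \<and> x = c *\<^sub>R x)"
      "bij (blinfun_apply y) \<and> bij (blinfun_apply y) \<and> (\<exists>c::real. c \<noteq> 0 \<and> y = c *\<^sub>R y)"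
      "bij (blinfun_apply z) \<and> bij (blinfun_apply z) \<and> (\<exists>c::real. c \<noteq> 0 \<and> z = c *\<^sub>R z)"
    have c: "blinfun_apply (h o\<^sub>L k) = blinfun_apply h \<circ> blinfun_apply k" for h k :: "'a \<Rightarrow>\<^sub>L 'a"
      by auto
    show "bij (blinfun_apply (x o\<^sub>L y o\<^sub>L z))" "bij (blinfun_apply (x o\<^sub>L (y o\<^sub>L z)))"
      unfolding c using a by (auto intro!: bij_comp)
    show "x o\<^sub>L (y o\<^sub>L z) = 1 *\<^sub>R (x o\<^sub>L y o\<^sub>L z)" by (intro blinfun_eqI) simp
  qed simp
  show "\<one>\<^bsub>PGL\<^esub> \<otimes>\<^bsub>PGL\<^esub> x = x"
    unfolding PGL_def monoid.simps
  proof (transfer, intro conjI exI[of _ "1::real"])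
    fix x :: "'a \<Rightarrow>\<^sub>L 'a"
    have e: "id_blinfun o\<^sub>L x = x" by (intro blinfun_eqI) simp
    assume a: "bij (blinfun_apply x) \<and> bij (blinfun_apply x) \<and> (\<exists>c::real. c \<noteq> 0 \<and> x = c *\<^sub>R x)"
    show "bij (blinfun_apply x)" "bij (blinfun_apply (id_blinfun o\<^sub>L x))"
      "x = 1 *\<^sub>R (id_blinfun o\<^sub>L x)" unfolding e using a by auto
  qed simp
  show "\<one>\<^bsub>PGL\<^esub> \<in> carrier (PGL :: 'a pgl monoid)" by (simp add: PGL_def)
  have "\<exists>y. pgl_mult y x = pgl_one"
  proof transfer
    fix x :: "'a \<Rightarrow>\<^sub>L 'a"
    assume "bij (blinfun_apply x) \<and> bij (blinfun_apply x) \<and> (\<exists>c::real. c \<noteq> 0 \<and> x = c *\<^sub>R x)"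
    then have b: "bij (blinfun_apply x)" by blast
    define h where "h = inv_into UNIV (blinfun_apply x)"
    have "linear h"
      unfolding h_def using b
      by (intro inj_linear_imp_inv_linear bij_is_inj bounded_linear.linear blinfun.bounded_linear_right)
    then have y: "blinfun_apply (Blinfun h) = h"
      by (intro bounded_linear_Blinfun_apply) (simp add: linear_conv_bounded_linear)
    define y where "y = Blinfun h"
    note y = y[folded y_def]
    have e: "y o\<^sub>L x = id_blinfun"
      using b by (intro blinfun_eqI) (simp add: y h_def bij_is_inj)
    have "bij (blinfun_apply y)" using b by (simp add: y h_def bij_imp_bij_inv)
    moreover have "bij (blinfun_apply (id_blinfun :: 'a \<Rightarrow>\<^sub>L 'a))"
      by (auto simp: bij_def inj_on_def)
    ultimately show "\<exists>y\<in>{f. bij (blinfun_apply f) \<and> bij (blinfun_apply f) \<and>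
          (\<exists>c::real. c \<noteq> 0 \<and> f = c *\<^sub>R f)}.
        bij (blinfun_apply (y o\<^sub>L x)) \<and> bij (blinfun_apply (id_blinfun :: 'a \<Rightarrow>\<^sub>L 'a)) \<and>
        (\<exists>c::real. c \<noteq> 0 \<and> id_blinfun = c *\<^sub>R (y o\<^sub>L x))"
      using e by (intro bexI[of _ y]) (auto intro: exI[of _ "1::real"])
  qed
  then show "\<exists>y\<in>carrier PGL. y \<otimes>\<^bsub>PGL\<^esub> x = \<one>\<^bsub>PGL\<^esub>"
    by (simp add: PGL_def)
qed

lift_definition pgl_act :: "'a::euclidean_space pgl \<Rightarrow> 'a proj \<Rightarrow> 'a proj"
  is "\<lambda>f v. blinfun_apply f v"
proof -
  fix f f' :: "'a \<Rightarrow>\<^sub>L 'a" and v v' :: 'a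
  assume "bij (blinfun_apply f) \<and> bij (blinfun_apply f') \<and> (\<exists>c::real. c \<noteq> 0 \<and> f' = c *\<^sub>R f)"
    "v \<noteq> 0 \<and> v' \<noteq> 0 \<and> (\<exists>c::real. c \<noteq> 0 \<and> v' = c *\<^sub>R v)"
  then obtain c d :: real where *: "bij (blinfun_apply f)" "bij (blinfun_apply f')"
      "v \<noteq> 0" "v' \<noteq> 0" "c \<noteq> 0" "d \<noteq> 0" "f' = c *\<^sub>R f" "v' = d *\<^sub>R v" by blast
  have nz: "blinfun_apply h w \<noteq> 0" if "bij (blinfun_apply h)" "w \<noteq> 0" for h :: "'a \<Rightarrow>\<^sub>L 'a" and w
    using that by (metis bij_pointE blinfun.zero_right)
  have "blinfun_apply f' v' = (c * d) *\<^sub>R blinfun_apply f v"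
    using * by (simp add: blinfun.bilinear_simps scaleR_blinfun.rep_eq)
  then show "blinfun_apply f v \<noteq> 0 \<and> blinfun_apply f' v' \<noteq> 0 \<and>
      (\<exists>c::real. c \<noteq> 0 \<and> blinfun_apply f' v' = c *\<^sub>R blinfun_apply f v)"
    using * nz by (metis mult_eq_0_iff)
qed

section \<open>Convexity, duality, occultation position\<close>

lift_definition proj_hyperplane ::
    "('a::euclidean_space \<Rightarrow>\<^sub>L real) proj \<Rightarrow> 'a proj set"
  is "\<lambda>\<phi>. {p. \<exists>v. v \<noteq> 0 \<and> blinfun_apply \<phi> v = 0 \<and> p = proj_pt v}"
  by (auto simp: scaleR_blinfun.rep_eq)

(* The affine chart defined by a functional phi \<noteq> 0 is the complement of its projective hyperplane,
   with the affine structure of the affine hyperplane phi = 1. *)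
definition affine_chart :: "('a::euclidean_space \<Rightarrow>\<^sub>L real) \<Rightarrow> 'a proj set"
  where "affine_chart \<phi> = - proj_hyperplane (proj_pt \<phi>)"

definition chart_lift :: "('a::euclidean_space \<Rightarrow>\<^sub>L real) \<Rightarrow> 'a proj set \<Rightarrow> 'a set"
  where "chart_lift \<phi> X = {v. blinfun_apply \<phi> v = 1 \<and> proj_pt v \<in> X}"

definition properly_convex :: "'a::euclidean_space proj set \<Rightarrow> bool"
  where "properly_convex \<Omega> \<longleftrightarrow> open \<Omega> \<and>
    (\<exists>\<phi>. \<phi> \<noteq> 0 \<and> \<Omega> \<subseteq> affine_chart \<phi> \<and> convex (chart_lift \<phi> \<Omega>) \<and> bounded (chart_lift \<phi> \<Omega>))"

definition chart_hull :: "('a::euclidean_space \<Rightarrow>\<^sub>L real) \<Rightarrow> 'a proj set \<Rightarrow> 'a proj set"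
  where "chart_hull \<phi> X = proj_pt ` (convex hull (chart_lift \<phi> X))"

definition proj_hull_well_defined :: "'a::euclidean_space proj set \<Rightarrow> bool"
  where "proj_hull_well_defined X \<longleftrightarrow> connected X \<and>
    (\<exists>\<phi>. \<phi> \<noteq> 0 \<and> X \<subseteq> affine_chart \<phi>) \<and>
    (\<forall>\<phi> \<psi>. \<phi> \<noteq> 0 \<and> \<psi> \<noteq> 0 \<and> X \<subseteq> affine_chart \<phi> \<and> X \<subseteq> affine_chart \<psi> \<longrightarrow>
      chart_hull \<phi> X = chart_hull \<psi> X)"

(* Meaningful only under proj_hull_well_defined. *)
definition proj_hull :: "'a::euclidean_space proj set \<Rightarrow> 'a proj set"
  where "proj_hull X = (THE C. \<exists>\<phi>. \<phi> \<noteq> 0 \<and> X \<subseteq> affine_chart \<phi> \<and> C = chart_hull \<phi> X)"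

definition dual_domain :: "'a::euclidean_space proj set \<Rightarrow> ('a \<Rightarrow>\<^sub>L real) proj set"
  where "dual_domain \<Omega> = {H. proj_hyperplane H \<inter> closure \<Omega> = {}}"

definition occultation_position ::
    "'a::euclidean_space proj set \<Rightarrow> 'a proj set \<Rightarrow> 'a proj set \<Rightarrow> bool"
  where "occultation_position A B C \<longleftrightarrow>
    \<not> A \<subseteq> B \<and> \<not> C \<subseteq> B \<and>
    A \<inter> B \<noteq> {} \<and> B \<inter> C \<noteq> {} \<and> A \<inter> C = {} \<and>
    closure (dual_domain B) \<subseteq> dual_domain A \<union> dual_domain C"

section \<open>HNN extensions\<close>

datatype 'g hnn_letter = Base 'g | Stable | Stable_inv

definition hnn_words :: "'g monoid \<Rightarrow> 'g hnn_letter list set"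
  where "hnn_words G = lists (Base ` carrier G \<union> {Stable, Stable_inv})"

inductive hnn_eq :: "'g monoid \<Rightarrow> 'g set \<Rightarrow> ('g \<Rightarrow> 'g) \<Rightarrow>
    'g hnn_letter list \<Rightarrow> 'g hnn_letter list \<Rightarrow> bool"
  for G :: "'g monoid" and A :: "'g set" and \<theta> :: "'g \<Rightarrow> 'g"
  where
    refl: "w \<in> hnn_words G \<Longrightarrow> hnn_eq G A \<theta> w w"
  | sym: "hnn_eq G A \<theta> v w \<Longrightarrow> hnn_eq G A \<theta> w v"
  | trans: "hnn_eq G A \<theta> u v \<Longrightarrow> hnn_eq G A \<theta> v w \<Longrightarrow> hnn_eq G A \<theta> u w"
  | append: "hnn_eq G A \<theta> u u' \<Longrightarrow> hnn_eq G A \<theta> v v' \<Longrightarrow> hnn_eq G A \<theta> (u @ v) (u' @ v')"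
  | one: "hnn_eq G A \<theta> [Base \<one>\<^bsub>G\<^esub>] []"
  | mult: "g \<in> carrier G \<Longrightarrow> h \<in> carrier G \<Longrightarrow>
      hnn_eq G A \<theta> [Base g, Base h] [Base (g \<otimes>\<^bsub>G\<^esub> h)]"
  | inv1: "hnn_eq G A \<theta> [Stable, Stable_inv] []"
  | inv2: "hnn_eq G A \<theta> [Stable_inv, Stable] []"
  | conj: "a \<in> A \<Longrightarrow> hnn_eq G A \<theta> [Stable, Base a, Stable_inv] [Base (\<theta> a)]"

abbreviation hnn_class :: "'g monoid \<Rightarrow> 'g set \<Rightarrow> ('g \<Rightarrow> 'g) \<Rightarrow>
    'g hnn_letter list \<Rightarrow> 'g hnn_letter list set"
  where "hnn_class G A \<theta> w \<equiv> {v. hnn_eq G A \<theta> w v}"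

(* The group generated by G and a stable letter s subject to s a s^-1 = theta a for a in A;
   it is a group if A and theta ` A lie in carrier G (see group_hnn_extension). *)
definition hnn_extension :: "'g monoid \<Rightarrow> 'g set \<Rightarrow> ('g \<Rightarrow> 'g) \<Rightarrow> 'g hnn_letter list set monoid"
  where "hnn_extension G A \<theta> = \<lparr>
    carrier = hnn_class G A \<theta> ` hnn_words G,
    mult = (\<lambda>X Y. \<Union>v\<in>X. \<Union>w\<in>Y. hnn_class G A \<theta> (v @ w)),
    one = hnn_class G A \<theta> []\<rparr>"

fun hnn_letter_eval :: "'k monoid \<Rightarrow> ('g \<Rightarrow> 'k) \<Rightarrow> 'k \<Rightarrow> 'g hnn_letter \<Rightarrow> 'k"
  where
    "hnn_letter_eval K f s (Base g) = f g"
  | "hnn_letter_eval K f s Stable = s"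
  | "hnn_letter_eval K f s Stable_inv = inv\<^bsub>K\<^esub> s"

definition hnn_eval :: "'k monoid \<Rightarrow> ('g \<Rightarrow> 'k) \<Rightarrow> 'k \<Rightarrow> 'g hnn_letter list \<Rightarrow> 'k"
  where "hnn_eval K f s w = foldr (\<lambda>l x. hnn_letter_eval K f s l \<otimes>\<^bsub>K\<^esub> x) w \<one>\<^bsub>K\<^esub>"

(* The homomorphism to K induced by f on the base group and sending the stable letter to s;
   evaluation is constant on each class when f and s respect the relations (see hnn_lift_class). *)
definition hnn_lift :: "'k monoid \<Rightarrow> ('g \<Rightarrow> 'k) \<Rightarrow> 'k \<Rightarrow> 'g hnn_letter list set \<Rightarrow> 'k"
  where "hnn_lift K f s X = the_elem (hnn_eval K f s ` X)"

lemma hnn_eq_words: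
  assumes "group G" "A \<subseteq> carrier G" "\<theta> ` A \<subseteq> carrier G" "hnn_eq G A \<theta> v w"
  shows "v \<in> hnn_words G \<and> w \<in> hnn_words G"
  using assms(4)
proof induction
  case one
  then show ?case using group.is_monoid[OF assms(1)] by (auto simp: hnn_words_def monoid.one_closed)
next
  case (mult g h)
  then show ?case using group.is_monoid[OF assms(1)] by (auto simp: hnn_words_def monoid.m_closed)
next
  case (conj a)
  then show ?case using assms(2,3) by (auto simp: hnn_words_def)
qed (auto simp: hnn_words_def)

lemma hnn_class_eq_iff:
  assumes "w \<in> hnn_words G"
  shows "hnn_class G A \<theta> v = hnn_class G A \<theta> w \<longleftrightarrow> hnn_eq G A \<theta> v w"
proof
  assume "hnn_class G A \<theta> v = hnn_class G A \<theta> w"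
  with hnn_eq.refl[OF assms, of A \<theta>] show "hnn_eq G A \<theta> v w" by auto
next
  assume vw: "hnn_eq G A \<theta> v w"
  show "hnn_class G A \<theta> v = hnn_class G A \<theta> w"
    by (intro Collect_cong iffI)
      (erule hnn_eq.trans[OF hnn_eq.sym[OF vw]], erule hnn_eq.trans[OF vw])
qed

lemma hnn_mult_class:
  assumes "v \<in> hnn_words G" "w \<in> hnn_words G"
  shows "hnn_class G A \<theta> v \<otimes>\<^bsub>hnn_extension G A \<theta>\<^esub> hnn_class G A \<theta> w = hnn_class G A \<theta> (v @ w)"
proof -
  have "hnn_class G A \<theta> (v' @ w') = hnn_class G A \<theta> (v @ w)"
    if "hnn_eq G A \<theta> v v'" "hnn_eq G A \<theta> w w'" for v' w'
    using assms that
    by (subst hnn_class_eq_iff) (simp_all add: hnn_words_def hnn_eq.append hnn_eq.sym)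
  then have "(\<Union>v'\<in>hnn_class G A \<theta> v. \<Union>w'\<in>hnn_class G A \<theta> w. hnn_class G A \<theta> (v' @ w'))
      = (\<Union>v'\<in>hnn_class G A \<theta> v. \<Union>w'\<in>hnn_class G A \<theta> w. hnn_class G A \<theta> (v @ w))"
    by (intro SUP_cong[OF HOL.refl]) simp
  also have "\<dots> = hnn_class G A \<theta> (v @ w)"
    using hnn_eq.refl[OF assms(1), of A \<theta>] hnn_eq.refl[OF assms(2), of A \<theta>] by auto
  finally show ?thesis by (simp add: hnn_extension_def)
qed

lemma group_hnn_extension:
  assumes G: "group G" and A: "A \<subseteq> carrier G" "\<theta> ` A \<subseteq> carrier G"
  shows "group (hnn_extension G A \<theta>)"
proof (rule groupI)
  let ?H = "hnn_extension G A \<theta>"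
  have car: "carrier ?H = hnn_class G A \<theta> ` hnn_words G"
    and one: "\<one>\<^bsub>?H\<^esub> = hnn_class G A \<theta> []"
    by (simp_all add: hnn_extension_def)
  have app: "v @ w \<in> hnn_words G" if "v \<in> hnn_words G" "w \<in> hnn_words G" for v w
    using that by (simp add: hnn_words_def)
  have nil: "[] \<in> hnn_words G" by (simp add: hnn_words_def)
  show "\<one>\<^bsub>?H\<^esub> \<in> carrier ?H" using nil by (simp add: car one)
  fix x assume "x \<in> carrier ?H"
  then obtain u where u: "u \<in> hnn_words G" "x = hnn_class G A \<theta> u" by (auto simp: car)
  show "\<one>\<^bsub>?H\<^esub> \<otimes>\<^bsub>?H\<^esub> x = x" using u nil by (simp add: one hnn_mult_class)
  have letter: "\<exists>l'. l' \<in> hnn_words G \<and> hnn_eq G A \<theta> (l' @ [l]) []" if "[l] \<in> hnn_words G" for l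
  proof (cases l)
    case (Base g)
    with that have g: "g \<in> carrier G" by (auto simp: hnn_words_def)
    then have i: "inv\<^bsub>G\<^esub> g \<in> carrier G" using G by (simp add: group.inv_closed)
    have "hnn_eq G A \<theta> [Base (inv\<^bsub>G\<^esub> g), Base g] [Base \<one>\<^bsub>G\<^esub>]"
      using hnn_eq.mult[OF i g] G g by (simp add: group.l_inv)
    then have "hnn_eq G A \<theta> ([Base (inv\<^bsub>G\<^esub> g)] @ [l]) []"
      using Base by (auto intro: hnn_eq.trans hnn_eq.one)
    then show ?thesis using i by (intro exI[of _ "[Base (inv\<^bsub>G\<^esub> g)]"]) (auto simp: hnn_words_def)
  next
    case Stable
    then show ?thesis using hnn_eq.inv2[of G A \<theta>]
      by (intro exI[of _ "[Stable_inv]"]) (auto simp: hnn_words_def)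
  next
    case Stable_inv
    then show ?thesis using hnn_eq.inv1[of G A \<theta>]
      by (intro exI[of _ "[Stable]"]) (auto simp: hnn_words_def)
  qed
  have "\<exists>v. v \<in> hnn_words G \<and> hnn_eq G A \<theta> (v @ u) []" using u(1)
  proof (induction u)
    case Nil
    then show ?case using hnn_eq.refl[OF nil] nil by (intro exI[of _ "[]"]) simp
  next
    case (Cons l u)
    then have w: "[l] \<in> hnn_words G" "u \<in> hnn_words G" by (auto simp: hnn_words_def)
    then obtain v where v: "v \<in> hnn_words G" "hnn_eq G A \<theta> (v @ u) []" using Cons by blast
    obtain l' where l': "l' \<in> hnn_words G" "hnn_eq G A \<theta> (l' @ [l]) []" using letter w by blast
    have "hnn_eq G A \<theta> (v @ ((l' @ [l]) @ u)) (v @ ([] @ u))"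
      using v l' w by (intro hnn_eq.append hnn_eq.refl)
    then have "hnn_eq G A \<theta> ((v @ l') @ (l # u)) []"
      using v(2) hnn_eq.trans by fastforce
    then show ?case using app v l' by blast
  qed
  then obtain v where "v \<in> hnn_words G" "hnn_eq G A \<theta> (v @ u) []" by blast
  then show "\<exists>y\<in>carrier ?H. y \<otimes>\<^bsub>?H\<^esub> x = \<one>\<^bsub>?H\<^esub>"
    using u nil by (intro bexI[of _ "hnn_class G A \<theta> v"])
      (simp_all add: car one hnn_mult_class hnn_class_eq_iff)
  fix y assume "y \<in> carrier ?H"
  then obtain v where v: "v \<in> hnn_words G" "y = hnn_class G A \<theta> v" by (auto simp: car)
  show "x \<otimes>\<^bsub>?H\<^esub> y \<in> carrier ?H" using u v app by (simp add: hnn_mult_class car)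
  fix z assume "z \<in> carrier ?H"
  then obtain w where "w \<in> hnn_words G" "z = hnn_class G A \<theta> w" by (auto simp: car)
  then show "x \<otimes>\<^bsub>?H\<^esub> y \<otimes>\<^bsub>?H\<^esub> z = x \<otimes>\<^bsub>?H\<^esub> (y \<otimes>\<^bsub>?H\<^esub> z)"
    using u v app by (simp add: hnn_mult_class)
qed

lemma hnn_eval_closed:
  assumes "group K" "f \<in> hom G K" "s \<in> carrier K" "w \<in> hnn_words G"
  shows "hnn_eval K f s w \<in> carrier K"
proof -
  interpret K: group K by fact
  show ?thesis using assms(4)
  proof (induction w)
    case (Cons l w)
    then have "hnn_letter_eval K f s l \<in> carrier K"
      using assms(2,3) by (auto simp: hnn_words_def hom_def)
    with Cons show ?case by (auto simp: hnn_eval_def hnn_words_def)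
  qed (simp add: hnn_eval_def)
qed

lemma hnn_eval_append:
  assumes "group K" "f \<in> hom G K" "s \<in> carrier K" "v \<in> hnn_words G" "w \<in> hnn_words G"
  shows "hnn_eval K f s (v @ w) = hnn_eval K f s v \<otimes>\<^bsub>K\<^esub> hnn_eval K f s w"
proof -
  interpret K: group K by fact
  note w = hnn_eval_closed[OF assms(1-3,5)]
  show ?thesis using assms(4)
  proof (induction v)
    case Nil
    then show ?case using w by (simp add: hnn_eval_def)
  next
    case (Cons l v)
    then have v: "v \<in> hnn_words G" and l: "hnn_letter_eval K f s l \<in> carrier K"
      using assms(2,3) by (auto simp: hnn_words_def hom_def)
    show ?case using Cons(1)[OF v] l w hnn_eval_closed[OF assms(1-3) v]
      by (simp add: hnn_eval_def K.m_assoc)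
  qed
qed

lemma hnn_lift_class:
  assumes G: "group G" "A \<subseteq> carrier G" "\<theta> ` A \<subseteq> carrier G"
    and K: "group K" "f \<in> hom G K" "s \<in> carrier K"
    and rel: "\<And>a. a \<in> A \<Longrightarrow> s \<otimes>\<^bsub>K\<^esub> f a \<otimes>\<^bsub>K\<^esub> inv\<^bsub>K\<^esub> s = f (\<theta> a)"
    and w: "w \<in> hnn_words G"
  shows "hnn_lift K f s (hnn_class G A \<theta> w) = hnn_eval K f s w"
proof -
  interpret K: group K by fact
  interpret G: group G by fact
  interpret f: group_hom G K f using K by unfold_locales
  have "hnn_eval K f s v = hnn_eval K f s w" if "hnn_eq G A \<theta> v w" for v w
    using that
  proof induction
    case (append u u' v v')
    then show ?case using hnn_eq_words[OF G] by (metis hnn_eval_append[OF K])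
  next
    case (conj a)
    then have "f a \<in> carrier K" "f (\<theta> a) \<in> carrier K" using G by auto
    then show ?case using rel[OF conj] K(3) by (simp add: hnn_eval_def K.m_assoc)
  qed (use K(3) in \<open>auto simp: hnn_eval_def\<close>)
  then have "hnn_eval K f s v = hnn_eval K f s w" if "v \<in> hnn_class G A \<theta> w" for v
    using that by simp
  then have "hnn_eval K f s ` hnn_class G A \<theta> w = (\<lambda>_. hnn_eval K f s w) ` hnn_class G A \<theta> w"
    by (rule image_cong[OF HOL.refl])
  moreover have "hnn_class G A \<theta> w \<noteq> {}"
    using hnn_eq.refl[OF w, of A \<theta>] by auto
  ultimately have "hnn_eval K f s ` hnn_class G A \<theta> w = {hnn_eval K f s w}"
    by (simp only: image_constant_conv if_False)
  then show ?thesis by (simp add: hnn_lift_def)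
qed

section \<open>The HNN extension determined by a subgroup of PGL(V) and an element t\<close>

definition conj_by :: "'a::euclidean_space pgl \<Rightarrow> 'a pgl \<Rightarrow> 'a pgl"
  where "conj_by t g = t \<otimes>\<^bsub>PGL\<^esub> g \<otimes>\<^bsub>PGL\<^esub> inv\<^bsub>PGL\<^esub> t"

definition pgl_Delta :: "'a::euclidean_space pgl set \<Rightarrow> 'a pgl \<Rightarrow> 'a pgl set"
  where "pgl_Delta \<Gamma>\<^sub>0 t = \<Gamma>\<^sub>0 \<inter> conj_by t ` \<Gamma>\<^sub>0"

definition pgl_hnn ::
    "'a::euclidean_space pgl set \<Rightarrow> 'a pgl \<Rightarrow> 'a pgl hnn_letter list set monoid"
  where "pgl_hnn \<Gamma>\<^sub>0 t =
    hnn_extension (PGL\<lparr>carrier := \<Gamma>\<^sub>0\<rparr>) (conj_by (inv\<^bsub>PGL\<^esub> t) ` pgl_Delta \<Gamma>\<^sub>0 t) (conj_by t)"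

definition pgl_hnn_rep ::
    "'a::euclidean_space pgl \<Rightarrow> 'a pgl hnn_letter list set \<Rightarrow> 'a pgl"
  where "pgl_hnn_rep t = hnn_lift PGL (\<lambda>\<gamma>. \<gamma>) t"

lemma pgl_hnn_relations:
  fixes t :: "'a::euclidean_space pgl"
  assumes "subgroup \<Gamma>\<^sub>0 PGL"
  defines "A \<equiv> conj_by (inv\<^bsub>PGL\<^esub> t) ` pgl_Delta \<Gamma>\<^sub>0 t"
  shows "A \<subseteq> \<Gamma>\<^sub>0" "conj_by t ` A = pgl_Delta \<Gamma>\<^sub>0 t" "conj_by t ` A \<subseteq> \<Gamma>\<^sub>0"
proof -
  interpret P: group "PGL :: 'a pgl monoid" by (rule group_PGL)
  have mem: "x \<in> carrier PGL" for x :: "'a pgl" by (simp add: PGL_def)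
  have c: "s \<otimes>\<^bsub>PGL\<^esub> (inv\<^bsub>PGL\<^esub> s \<otimes>\<^bsub>PGL\<^esub> g) = g"
    "inv\<^bsub>PGL\<^esub> s \<otimes>\<^bsub>PGL\<^esub> (s \<otimes>\<^bsub>PGL\<^esub> g) = g" for s g :: "'a pgl"
    using mem by (simp_all add: P.m_assoc[symmetric])
  have 1: "conj_by (inv\<^bsub>PGL\<^esub> t) (conj_by t g) = g" for g
    using mem by (simp add: conj_by_def P.m_assoc c)
  have 2: "conj_by t (conj_by (inv\<^bsub>PGL\<^esub> t) g) = g" for g
    using mem by (simp add: conj_by_def P.m_assoc c)
  show "A \<subseteq> \<Gamma>\<^sub>0" by (auto simp: A_def pgl_Delta_def 1)
  show "conj_by t ` A = pgl_Delta \<Gamma>\<^sub>0 t" by (simp add: A_def image_image 2)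
  then show "conj_by t ` A \<subseteq> \<Gamma>\<^sub>0" by (auto simp: pgl_Delta_def)
qed

lemma group_pgl_hnn:
  assumes "subgroup \<Gamma>\<^sub>0 PGL"
  shows "group (pgl_hnn \<Gamma>\<^sub>0 t)"
  unfolding pgl_hnn_def
  using pgl_hnn_relations[OF assms, of t] group.subgroup_imp_group[OF group_PGL assms]
  by (intro group_hnn_extension) simp_all

lemma pgl_hnn_rep_class:
  assumes "subgroup \<Gamma>\<^sub>0 PGL" "w \<in> hnn_words (PGL\<lparr>carrier := \<Gamma>\<^sub>0\<rparr>)"
  shows "pgl_hnn_rep t (hnn_class (PGL\<lparr>carrier := \<Gamma>\<^sub>0\<rparr>)
      (conj_by (inv\<^bsub>PGL\<^esub> t) ` pgl_Delta \<Gamma>\<^sub>0 t) (conj_by t) w) = hnn_eval PGL (\<lambda>\<gamma>. \<gamma>) t w"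
  unfolding pgl_hnn_rep_def
proof (rule hnn_lift_class)
  show "group (PGL\<lparr>carrier := \<Gamma>\<^sub>0\<rparr>)" by (rule group.subgroup_imp_group[OF group_PGL assms(1)])
  show "(\<lambda>\<gamma>. \<gamma>) \<in> hom (PGL\<lparr>carrier := \<Gamma>\<^sub>0\<rparr>) PGL" by (auto simp: hom_def PGL_def)
qed (use pgl_hnn_relations[OF assms(1), of t] assms(2) group_PGL in
      \<open>simp_all add: conj_by_def[symmetric]\<close>, simp add: PGL_def)

lemma pgl_hnn_rep_generators:
  fixes t :: "'a::euclidean_space pgl"
  assumes "subgroup \<Gamma>\<^sub>0 PGL"
  shows "\<gamma> \<in> \<Gamma>\<^sub>0 \<Longrightarrow> pgl_hnn_rep t (hnn_class (PGL\<lparr>carrier := \<Gamma>\<^sub>0\<rparr>)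
      (conj_by (inv\<^bsub>PGL\<^esub> t) ` pgl_Delta \<Gamma>\<^sub>0 t) (conj_by t) [Base \<gamma>]) = \<gamma>"
    and "pgl_hnn_rep t (hnn_class (PGL\<lparr>carrier := \<Gamma>\<^sub>0\<rparr>)
      (conj_by (inv\<^bsub>PGL\<^esub> t) ` pgl_Delta \<Gamma>\<^sub>0 t) (conj_by t) [Stable]) = t"
proof -
  interpret P: group "PGL :: 'a pgl monoid" by (rule group_PGL)
  have mem: "x \<in> carrier PGL" for x :: "'a pgl" by (simp add: PGL_def)
  show "\<gamma> \<in> \<Gamma>\<^sub>0 \<Longrightarrow> pgl_hnn_rep t (hnn_class (PGL\<lparr>carrier := \<Gamma>\<^sub>0\<rparr>)
      (conj_by (inv\<^bsub>PGL\<^esub> t) ` pgl_Delta \<Gamma>\<^sub>0 t) (conj_by t) [Base \<gamma>]) = \<gamma>"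
    using mem by (subst pgl_hnn_rep_class[OF assms]) (simp_all add: hnn_words_def hnn_eval_def)
  show "pgl_hnn_rep t (hnn_class (PGL\<lparr>carrier := \<Gamma>\<^sub>0\<rparr>)
      (conj_by (inv\<^bsub>PGL\<^esub> t) ` pgl_Delta \<Gamma>\<^sub>0 t) (conj_by t) [Stable]) = t"
    using mem by (subst pgl_hnn_rep_class[OF assms]) (simp_all add: hnn_words_def hnn_eval_def)
qed

lemma pgl_hnn_rep_hom:
  fixes t :: "'a::euclidean_space pgl"
  assumes "subgroup \<Gamma>\<^sub>0 PGL"
  shows "pgl_hnn_rep t \<in> hom (pgl_hnn \<Gamma>\<^sub>0 t) PGL"
proof (rule homI)
  let ?G = "PGL\<lparr>carrier := \<Gamma>\<^sub>0\<rparr>"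
  have mem: "x \<in> carrier PGL" for x :: "'a pgl" by (simp add: PGL_def)
  have f: "(\<lambda>\<gamma>. \<gamma>) \<in> hom ?G PGL" by (auto simp: hom_def PGL_def)
  fix x y assume "x \<in> carrier (pgl_hnn \<Gamma>\<^sub>0 t)" "y \<in> carrier (pgl_hnn \<Gamma>\<^sub>0 t)"
  then obtain v w where v: "v \<in> hnn_words ?G" "x = hnn_class ?G
      (conj_by (inv\<^bsub>PGL\<^esub> t) ` pgl_Delta \<Gamma>\<^sub>0 t) (conj_by t) v"
    and w: "w \<in> hnn_words ?G" "y = hnn_class ?G
      (conj_by (inv\<^bsub>PGL\<^esub> t) ` pgl_Delta \<Gamma>\<^sub>0 t) (conj_by t) w"
    by (auto simp: pgl_hnn_def hnn_extension_def)
  have vw: "v @ w \<in> hnn_words ?G" using v w by (simp add: hnn_words_def)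
  have "x \<otimes>\<^bsub>pgl_hnn \<Gamma>\<^sub>0 t\<^esub> y =
      hnn_class ?G (conj_by (inv\<^bsub>PGL\<^esub> t) ` pgl_Delta \<Gamma>\<^sub>0 t) (conj_by t) (v @ w)"
    unfolding pgl_hnn_def v(2) w(2) by (rule hnn_mult_class[OF v(1) w(1)])
  then show "pgl_hnn_rep t (x \<otimes>\<^bsub>pgl_hnn \<Gamma>\<^sub>0 t\<^esub> y) =
      pgl_hnn_rep t x \<otimes>\<^bsub>PGL\<^esub> pgl_hnn_rep t y"
    using hnn_eval_append[OF group_PGL f mem v(1) w(1)]
    by (simp only: v(2) w(2) pgl_hnn_rep_class[OF assms] v(1) w(1) vw)
qed (simp add: PGL_def)

definition discrete_faithful :: "'g monoid \<Rightarrow> ('g \<Rightarrow> 'a::euclidean_space pgl) \<Rightarrow> bool"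
  where "discrete_faithful \<Gamma> \<rho> \<longleftrightarrow>
    \<rho> \<in> hom \<Gamma> PGL \<and> inj_on \<rho> (carrier \<Gamma>) \<and> discrete (\<rho> ` carrier \<Gamma>)"

definition hnn_domain ::
    "'a::euclidean_space pgl set \<Rightarrow> 'a pgl \<Rightarrow> 'a proj set \<Rightarrow> 'a proj set"
  where "hnn_domain \<Gamma>\<^sub>0 t \<Omega>\<^sub>0 =
    (\<Union>\<gamma>\<in>carrier (pgl_hnn \<Gamma>\<^sub>0 t). pgl_act (pgl_hnn_rep t \<gamma>) ` proj_hull (\<Omega>\<^sub>0 \<union> pgl_act t ` \<Omega>\<^sub>0))"

end

(* Lift properly convex sets to open sharp convex cones of V. By Hahn-Banach, the dual part of
   "(A, B, C) is in occultation position" says that every segment from the closure of A to the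
   closure of C crosses B. This property propagates along sequences of domains whose consecutive
   triples are in occultation position, and hypotheses (1) and (2) provide such a sequence along every
   geodesic of the Bass-Serre tree of the HNN extension. Hence translates of Omega_0 at distance
   at least 2 in the tree are disjoint, which yields faithfulness and discreteness (an element that moves
   a point of Omega_0 and t Omega_0 inside that intersection lies in Gamma_0). Moreover a sum of vectors
   in the cones along a geodesic can be rewritten, by merging two of them into the cone that
   separates them, as a sum of vectors in two adjacent cones, so the union of the hulls over all edges is convex.
   It is properly convex because the functionals that vanish nowhere on the domains span the dual
   space: on the boundary of the dual of one domain, a connected sphere since dim P(V) >= 2, the
   obstructions coming from the neighbours are closed, pairwise disjoint and each nonempty, so they
   cannot cover the part of the boundary outside a hyperplane. *)

theory Submission
  imports Defs "HOL-Algebra.Coset"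
begin

section \<open>Cones and occultation\<close>

text \<open>Every projective set lifts to two opposite cones, so the work lies as much in the
  coherence of signs as in convexity. Cone occultation therefore asks that \<open>a\<close> miss
  both \<open>c\<close> and \<open>-c\<close>, and implies that \<open>a\<close> misses
  \<open>-b\<close>: a cone that meets its neighbour determines the neighbour's sign, so a choice at
  one end of a path fixes the whole path. A choice for all translates at once is possible only after
  a functional is found that vanishes on none of them; hence faithfulness and discreteness are
  settled along paths first, and convexity after the functional.

  The dimension enters through one fact, a nonzero vector orthogonal to two given ones. It provides
  the tilt by which occultation propagates, and the functional at which the two halves of the
  boundary of a dual cone are seen to share their obstruction.

  The functional need only be controlled at one vertex of the tree and its neighbours. If it is
  nonnegative there and vanishes at a point of the closed cone of the vertex, then occultation at
  each neighbour forces it to be positive on all cones beyond.\<close>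

definition open_cone :: "'a::euclidean_space set \<Rightarrow> bool"
  where "open_cone a \<longleftrightarrow> open a \<and> a \<noteq> {} \<and> convex a \<and> (\<forall>r>0. \<forall>z\<in>a. r *\<^sub>R z \<in> a) \<and>
    (\<exists>f. \<forall>z\<in>closure a - {0}. 0 < f \<bullet> z)"

text \<open>The nonzero \<open>f\<close> that are nonnegative on an open cone \<open>b\<close>
  represent the closure of the dual of its projectivization, so this is the duality clause of
  occultation position with the signs of the functionals normalized. \<open>A\<close> and
  \<open>D\<close> stay arbitrary sets so that one of them can be a union over all later cones of a
  path, or empty at its end.\<close>

definition occults :: "'a::euclidean_space set \<Rightarrow> 'a set \<Rightarrow> 'a set \<Rightarrow> bool"
  where "occults A b D \<longleftrightarrow> (\<forall>f. f \<noteq> 0 \<longrightarrow> (\<forall>z\<in>b. 0 \<le> f \<bullet> z) \<longrightarrow>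
    (\<forall>z\<in>A. 0 < f \<bullet> z) \<or> (\<forall>z\<in>D. 0 < f \<bullet> z))"

lemma open_coneD:
  assumes "open_cone a"
  shows "open a" "a \<noteq> {}" "convex a" "0 < r \<Longrightarrow> z \<in> a \<Longrightarrow> r *\<^sub>R z \<in> a"
    "\<exists>f. \<forall>z\<in>closure a - {0}. 0 < f \<bullet> z"
  using assms by (auto simp: open_cone_def)

lemma convex_cone_add:
  fixes x y :: "'a::real_vector"
  assumes "convex a" "\<And>r z. 0 < r \<Longrightarrow> z \<in> a \<Longrightarrow> r *\<^sub>R z \<in> a" "x \<in> a" "y \<in> a"
  shows "x + y \<in> a"
proof -
  have "(1/2) *\<^sub>R x + (1/2) *\<^sub>R y \<in> a" using assms by (intro convexD) auto
  then have "2 *\<^sub>R ((1/2) *\<^sub>R x + (1/2) *\<^sub>R y) \<in> a" by (intro assms(2)) auto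
  then show ?thesis by (simp add: scaleR_add_right)
qed

lemma open_cone_add: "open_cone a \<Longrightarrow> x \<in> a \<Longrightarrow> y \<in> a \<Longrightarrow> x + y \<in> a"
  by (rule convex_cone_add) (auto dest: open_coneD)

lemma zero_notin_open_cone:
  assumes "open_cone (a :: 'a::euclidean_space set)"
  shows "0 \<notin> a"
proof
  assume "0 \<in> a"
  then obtain e where e: "e > 0" "ball 0 e \<subseteq> a"
    using open_coneD(1)[OF assms] open_contains_ball by metis
  obtain b :: 'a where b: "b \<in> Basis" using nonempty_Basis by blast
  have bn: "norm b = 1" "b \<noteq> 0" using b nonzero_Basis by auto
  have "(e/2) *\<^sub>R b \<in> a" "- ((e/2) *\<^sub>R b) \<in> a"
    using e bn by (auto intro!: subsetD[OF e(2)])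
  then have m: "(e/2) *\<^sub>R b \<in> closure a - {0}" "- ((e/2) *\<^sub>R b) \<in> closure a - {0}"
    using closure_subset[of a] e bn by auto
  obtain f where f: "\<forall>z\<in>closure a - {0}. 0 < f \<bullet> z" using open_coneD(5)[OF assms] by blast
  have "0 < f \<bullet> ((e/2) *\<^sub>R b)" "0 < f \<bullet> (- ((e/2) *\<^sub>R b))"
    using bspec[OF f m(1)] bspec[OF f m(2)] .
  then show False by simp
qed

lemma inner_pos_on_open:
  fixes f :: "'a::euclidean_space"
  assumes "open a" "f \<noteq> 0" "\<And>z. z \<in> a \<Longrightarrow> 0 \<le> f \<bullet> z" "z \<in> a"
  shows "0 < f \<bullet> z"
proof -
  obtain e where e: "e > 0" "ball z e \<subseteq> a" using assms open_contains_ball by metis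
  define d where "d = e / (2 * norm f)"
  have d: "d > 0" using e assms by (simp add: d_def)
  have "z - d *\<^sub>R f \<in> ball z e" using e assms by (simp add: dist_norm d_def)
  then have "0 \<le> f \<bullet> (z - d *\<^sub>R f)" using e assms by blast
  then have "d * (f \<bullet> f) \<le> f \<bullet> z" by (simp add: inner_diff_right)
  moreover have "0 < d * (f \<bullet> f)" using d assms by simp
  ultimately show ?thesis by linarith
qed

lemma nonvanishing_on_connected:
  fixes f :: "'a::real_inner"
  assumes "connected s" "\<And>z. z \<in> s \<Longrightarrow> f \<bullet> z \<noteq> 0"
  shows "(\<forall>z\<in>s. 0 < f \<bullet> z) \<or> (\<forall>z\<in>s. f \<bullet> z < 0)"
proof -
  have "{z. f \<bullet> z > 0} \<inter> s = {} \<or> {z. f \<bullet> z < 0} \<inter> s = {}"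
    by (rule connectedD[OF assms(1)])
      (use assms(2) open_halfspace_gt[of 0 f] open_halfspace_lt[of f 0] in \<open>auto simp: neq_iff\<close>)
  moreover have "0 < f \<bullet> z \<or> f \<bullet> z < 0" if "z \<in> s" for z
    using assms(2)[OF that] by linarith
  ultimately show ?thesis by blast
qed

lemma inner_nonneg_closure:
  fixes f :: "'a::real_inner"
  assumes "\<And>z. z \<in> a \<Longrightarrow> 0 \<le> f \<bullet> z" "z \<in> closure a"
  shows "0 \<le> f \<bullet> z"
proof -
  have "closure a \<subseteq> {z. f \<bullet> z \<ge> 0}"
    using assms by (intro closure_minimal closed_halfspace_ge) auto
  then show ?thesis using assms by blast
qed

lemma closure_cone:
  fixes a :: "'a::real_normed_vector set"
  assumes "\<And>r z. 0 < r \<Longrightarrow> z \<in> a \<Longrightarrow> r *\<^sub>R z \<in> a" "0 < r" "z \<in> closure a"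
  shows "r *\<^sub>R z \<in> closure a"
proof -
  have "(\<lambda>z. r *\<^sub>R z) ` closure a = closure ((\<lambda>z. r *\<^sub>R z) ` a)" by (rule closure_scaleR)
  also have "\<dots> \<subseteq> closure a" using assms by (intro closure_mono) auto
  finally show ?thesis using assms by blast
qed

text \<open>Compactness of the unit vectors in the closed cone. The margin is what makes strict
  positivity on a cone stable under small changes of \<open>f\<close>.\<close>

lemma inner_pos_margin:
  fixes a :: "'a::euclidean_space set"
  assumes "\<And>r z. 0 < r \<Longrightarrow> z \<in> a \<Longrightarrow> r *\<^sub>R z \<in> a" "\<And>z. z \<in> closure a - {0} \<Longrightarrow> 0 < f \<bullet> z"
  shows "\<exists>d>0. \<forall>z\<in>closure a. d * norm z \<le> f \<bullet> z"
proof (cases "closure a \<inter> sphere 0 1 = {}")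
  case True
  have "z = 0" if "z \<in> closure a" for z
  proof (rule ccontr)
    assume z: "z \<noteq> 0"
    then have "(1 / norm z) *\<^sub>R z \<in> closure a" by (intro closure_cone assms that) auto
    then show False using True z by auto
  qed
  then show ?thesis by (intro exI[of _ 1]) (auto, metis inner_zero_right norm_zero order_refl)
next
  case False
  have "compact (closure a \<inter> sphere 0 1)" by (intro closed_Int_compact) auto
  moreover have "continuous_on (closure a \<inter> sphere 0 1) (\<lambda>z. f \<bullet> z)" by (intro continuous_intros)
  ultimately obtain m where m: "m \<in> closure a \<inter> sphere 0 1"
    "\<And>z. z \<in> closure a \<inter> sphere 0 1 \<Longrightarrow> f \<bullet> m \<le> f \<bullet> z"
    using continuous_attains_inf[OF _ False] by metis
  have "(f \<bullet> m) * norm z \<le> f \<bullet> z" if "z \<in> closure a" for z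
  proof (cases "z = 0")
    case z: False
    then have "(1 / norm z) *\<^sub>R z \<in> closure a" by (intro closure_cone assms that) auto
    then have "f \<bullet> m \<le> f \<bullet> ((1 / norm z) *\<^sub>R z)" using z by (intro m) auto
    then show ?thesis using z by (simp add: field_simps)
  qed simp
  moreover have "0 < f \<bullet> m" using m(1) by (intro assms(2)) auto
  ultimately show ?thesis by blast
qed

text \<open>A linear functional that is bounded above on an open ray from the origin is at most 0
  there, so the separating constant can be replaced by 0.\<close>

lemma separate_cones:
  fixes b :: "'a::euclidean_space set"
  assumes b: "convex b" "b \<noteq> {}" "\<And>r z. 0 < r \<Longrightarrow> z \<in> b \<Longrightarrow> r *\<^sub>R z \<in> b"
    and K: "convex K" "K \<noteq> {}" "\<And>r z. 0 < r \<Longrightarrow> z \<in> K \<Longrightarrow> r *\<^sub>R z \<in> K"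
    and "b \<inter> K = {}"
  shows "\<exists>f. f \<noteq> 0 \<and> (\<forall>z\<in>b. 0 \<le> f \<bullet> z) \<and> (\<forall>z\<in>K. f \<bullet> z \<le> 0)"
proof -
  obtain f c where f: "f \<noteq> 0" "\<forall>z\<in>K. f \<bullet> z \<le> c" "\<forall>z\<in>b. c \<le> f \<bullet> z"
    using separating_hyperplane_sets[OF K(1) b(1) K(2) b(2)] assms(7) by auto
  have small: "x \<le> 0" if "\<And>r. 0 < r \<Longrightarrow> r * x \<le> c" for x c :: real
  proof (rule ccontr)
    assume "\<not> x \<le> 0"
    then have x: "x > 0" by simp
    have "((\<bar>c\<bar> + 1) / x) * x \<le> c" using x by (intro that) (auto simp: add_nonneg_pos)
    then show False using x by simp
  qed
  have "f \<bullet> z \<le> 0" if "z \<in> K" for z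
    using f(2) K(3)[OF _ that] by (intro small[of "f \<bullet> z" c]) (metis inner_scaleR_right)
  moreover have "- (f \<bullet> z) \<le> 0" if "z \<in> b" for z
    using f(3) b(3)[OF _ that]
    by (intro small[of "- (f \<bullet> z)" "-c"]) (metis inner_scaleR_right mult_minus_right neg_le_iff_le)
  ultimately show ?thesis using f by (intro exI[of _ f]) auto
qed

text \<open>Hahn-Banach: if the cone spanned by \<open>x\<close> and \<open>y\<close> missed
  \<open>b\<close>, a functional nonnegative on \<open>b\<close> and at most 0 at both points would
  contradict occultation. This is the form in which occultation is used to merge vectors.\<close>

lemma occults_segment:
  assumes "open_cone b" "occults A b D" "x \<in> A" "y \<in> D"
  shows "\<exists>s\<ge>0. \<exists>r\<ge>0. s *\<^sub>R x + r *\<^sub>R y \<in> b"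
proof (rule ccontr)
  assume neg: "\<not> ?thesis"
  define K where "K = {s *\<^sub>R x + r *\<^sub>R y | s r. 0 \<le> s \<and> 0 \<le> r}"
  have "convex K"
  proof (rule convexI)
    fix p q and u v :: real
    assume "p \<in> K" "q \<in> K" and uv: "0 \<le> u" "0 \<le> v"
    then obtain s r s' r' where *: "p = s *\<^sub>R x + r *\<^sub>R y" "q = s' *\<^sub>R x + r' *\<^sub>R y"
      "0 \<le> s" "0 \<le> r" "0 \<le> s'" "0 \<le> r'" unfolding K_def by blast
    have "u *\<^sub>R p + v *\<^sub>R q = (u * s + v * s') *\<^sub>R x + (u * r + v * r') *\<^sub>R y"
      unfolding * by (simp add: algebra_simps)
    then show "u *\<^sub>R p + v *\<^sub>R q \<in> K" unfolding K_def using uv * by force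
  qed
  moreover have "K \<noteq> {}" unfolding K_def by force
  moreover have "r *\<^sub>R z \<in> K" if r: "0 < r" and z: "z \<in> K" for r z
  proof -
    obtain s' r' where *: "z = s' *\<^sub>R x + r' *\<^sub>R y" "0 \<le> s'" "0 \<le> r'" using z unfolding K_def by blast
    have "r *\<^sub>R z = (r * s') *\<^sub>R x + (r * r') *\<^sub>R y" unfolding * by (simp add: algebra_simps)
    then show ?thesis unfolding K_def using r * by force
  qed
  moreover have "b \<inter> K = {}" using neg unfolding K_def by blast
  ultimately obtain f where f: "f \<noteq> 0" "\<forall>z\<in>b. 0 \<le> f \<bullet> z" "\<forall>z\<in>K. f \<bullet> z \<le> 0"
    using separate_cones[of b K] open_coneD[OF assms(1)] by auto
  have "x = 1 *\<^sub>R x + 0 *\<^sub>R y" "y = 0 *\<^sub>R x + 1 *\<^sub>R y" by auto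
  then have "x \<in> K" "y \<in> K" unfolding K_def by (metis (mono_tags, lifting) mem_Collect_eq order_refl zero_le_one)+
  then have "f \<bullet> x \<le> 0" "f \<bullet> y \<le> 0" using f by auto
  then show False using assms f unfolding occults_def by (metis not_le)
qed

text \<open>All uses of the dimension go through this fact.\<close>

lemma exists_orthogonal2:
  fixes x y :: "'a::euclidean_space"
  assumes "DIM('a) \<ge> 3"
  shows "\<exists>u. u \<noteq> 0 \<and> u \<bullet> x = 0 \<and> u \<bullet> y = 0"
proof -
  have "dim {x, y} \<le> card {x, y}" by (rule dim_le_card') simp
  also have "\<dots> \<le> 2" by (simp add: card_insert_if)
  finally have "dim {x, y} < DIM('a)" using assms by simp
  then obtain u where "u \<noteq> 0" "\<And>v. v \<in> span {x, y} \<Longrightarrow> orthogonal u v"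
    using orthogonal_to_subspace_exists by metis
  then show ?thesis by (intro exI[of _ u]) (auto simp: orthogonal_def span_base)
qed

text \<open>Moving from \<open>f\<close> to \<open>f - s g\<close> with \<open>s \<ge> 0\<close>
  keeps the values at \<open>x\<close> and \<open>y\<close> nonpositive, never reaches 0 because
  \<open>g\<close> is no multiple of \<open>f\<close>, and eventually becomes negative somewhere on
  \<open>B\<close> because \<open>g\<close> is positive at a point of it.\<close>

lemma exists_tilting_direction:
  fixes f x y :: "'a::euclidean_space"
  assumes dim: "DIM('a) \<ge> 3" and f: "f \<noteq> 0" "f \<bullet> x \<le> 0" "f \<bullet> y \<le> 0"
    and B: "open B" "B \<noteq> {}" "\<And>z. z \<in> B \<Longrightarrow> 0 < f \<bullet> z"
  shows "\<exists>g. 0 \<le> g \<bullet> x \<and> 0 \<le> g \<bullet> y \<and> (\<forall>c. g \<noteq> c *\<^sub>R f) \<and> (\<exists>z\<in>B. 0 < g \<bullet> z)"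
proof (cases "f \<bullet> x = 0 \<and> f \<bullet> y = 0")
  case False
  \<comment> \<open>Since \<open>f\<close> does not vanish at both points, a nonzero vector
    orthogonal to both is no multiple of it, and its sign is still free.\<close>
  obtain u where u: "u \<noteq> 0" "u \<bullet> x = 0" "u \<bullet> y = 0" using exists_orthogonal2[OF dim] by blast
  have "\<exists>z\<in>B. u \<bullet> z \<noteq> 0"
  proof (rule ccontr)
    assume neg: "\<not> ?thesis"
    obtain z where z: "z \<in> B" using B by blast
    have "0 < u \<bullet> z" using neg z by (intro inner_pos_on_open[OF B(1) u(1)]) auto
    then show False using neg z by auto
  qed
  then obtain z where z: "z \<in> B" "u \<bullet> z \<noteq> 0" by blast
  have nc: "v \<noteq> c *\<^sub>R f" if "v \<noteq> 0" "v \<bullet> x = 0" "v \<bullet> y = 0" for v c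
    using that False by (metis inner_scaleR_left mult_eq_0_iff scale_eq_0_iff)
  show ?thesis
  proof (cases "u \<bullet> z > 0")
    case True
    then show ?thesis using u z nc[of u] by (intro exI[of _ u]) auto
  next
    case False
    then show ?thesis using u z nc[of "- u"]
      by (intro exI[of _ "- u"] conjI bexI[of _ z]) auto
  qed
next
  case True
  obtain u where u: "u \<noteq> 0" "u \<bullet> f = 0" "u \<bullet> x = 0" using exists_orthogonal2[OF dim] by blast
  define v where "v = (if u \<bullet> y \<ge> 0 then u else - u)"
  have v: "v \<noteq> 0" "v \<bullet> f = 0" "v \<bullet> x = 0" "v \<bullet> y \<ge> 0" using u by (auto simp: v_def)
  obtain z where z: "z \<in> B" using B by blast
  \<comment> \<open>As \<open>f\<close> vanishes at \<open>x\<close> and \<open>y\<close>, adding a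
    multiple of it costs nothing there; this multiple makes the value at \<open>z\<close>
    positive.\<close>
  define c where "c = (1 + \<bar>v \<bullet> z\<bar>) / (f \<bullet> z)"
  have fz: "f \<bullet> z > 0" using B z by blast
  have "(v + c *\<^sub>R f) \<bullet> z = v \<bullet> z + 1 + \<bar>v \<bullet> z\<bar>" using fz by (simp add: inner_add_left c_def)
  then have 1: "(v + c *\<^sub>R f) \<bullet> z > 0" by linarith
  have 2: "v + c *\<^sub>R f \<noteq> d *\<^sub>R f" for d
  proof
    assume "v + c *\<^sub>R f = d *\<^sub>R f"
    then have "v = (d - c) *\<^sub>R f" by (simp add: algebra_simps)
    then show False using v by (metis inner_commute inner_eq_zero_iff inner_scaleR_right mult_zero_right)
  qed
  show ?thesis using 1 2 v z True
    by (intro exI[of _ "v + c *\<^sub>R f"]) (auto simp: inner_add_left)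
qed

text \<open>Given a functional that is nonnegative on \<open>b\<close> but nonpositive at a point of \<open>A\<close> and at one
  of \<open>D\<close>, tilt it until it first vanishes somewhere on the closures of \<open>b\<close> and \<open>c\<close>; it then violates one
  of the two hypotheses.\<close>

lemma occults_extend:
  fixes b c :: "'a::euclidean_space set"
  assumes dim: "DIM('a) \<ge> 3" and b: "open_cone b" and c: "open_cone c"
    and bc: "occults A b (closure c - {0})" and cd: "occults (closure b - {0}) c D"
  shows "occults A b D"
  unfolding occults_def
proof (intro allI impI, rule ccontr)
  fix f assume f: "f \<noteq> 0" "\<forall>z\<in>b. 0 \<le> f \<bullet> z"
  assume "\<not> ((\<forall>z\<in>A. 0 < f \<bullet> z) \<or> (\<forall>z\<in>D. 0 < f \<bullet> z))"
  then obtain x y where x: "x \<in> A" "f \<bullet> x \<le> 0" and y: "y \<in> D" "f \<bullet> y \<le> 0" by fastforce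
  \<comment> \<open>A bootstrap: \<open>g\<close> is not positive at \<open>x\<close>, so
    \<open>bc\<close> makes it positive on the closure of \<open>c\<close>; it is then nonnegative
    on \<open>c\<close> and not positive at \<open>y\<close>, so \<open>cd\<close> makes it positive
    on the closure of \<open>b\<close>.\<close>
  have key: "(\<forall>z\<in>closure c - {0}. 0 < g \<bullet> z) \<and> (\<forall>z\<in>closure b - {0}. 0 < g \<bullet> z)"
    if g: "g \<noteq> 0" "\<forall>z\<in>b. 0 \<le> g \<bullet> z" "g \<bullet> x \<le> 0" "g \<bullet> y \<le> 0" for g
  proof -
    have 1: "\<forall>z\<in>closure c - {0}. 0 < g \<bullet> z"
      using bc g x unfolding occults_def by (metis not_le)
    have "0 \<le> g \<bullet> z" if "z \<in> c" for z
      using 1 closure_subset[of c] that by (cases "z = 0") (auto simp: less_imp_le subset_iff)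
    then show ?thesis using 1 cd g y unfolding occults_def by (metis not_le)
  qed
  note bD = open_coneD[OF b] and cD = open_coneD[OF c]
  have fb: "0 < f \<bullet> z" if "z \<in> b" for z using inner_pos_on_open[OF bD(1) f(1)] f that by blast
  obtain g z0 where g: "0 \<le> g \<bullet> x" "0 \<le> g \<bullet> y" "\<And>c. g \<noteq> c *\<^sub>R f" and z0: "z0 \<in> b" "0 < g \<bullet> z0"
    using exists_tilting_direction[OF dim f(1) x(2) y(2) bD(1,2) fb] by metis
  \<comment> \<open>The admissible tilts. The point \<open>z0\<close> bounds them, so there is a
    largest one; but \<open>key\<close> applies to the tilted functional too and leaves room for
    more.\<close>
  define S where "S = {s. 0 \<le> s \<and> (\<forall>z\<in>b \<union> c. 0 \<le> (f - s *\<^sub>R g) \<bullet> z)}"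
  have S: "S = {0..} \<inter> (\<Inter>z\<in>b \<union> c. {s. s * (g \<bullet> z) \<le> f \<bullet> z})"
    unfolding S_def by (auto simp: inner_diff_left)
  have "closed S" unfolding S
    by (intro closed_Int closed_INT ballI closed_Collect_le continuous_intros closed_atLeast)
  moreover have "S \<subseteq> {0 .. f \<bullet> z0 / (g \<bullet> z0)}"
    using z0 unfolding S by (auto simp: field_simps)
  then have "bounded S" using bounded_closed_interval bounded_subset by blast
  ultimately have "compact S" by (simp add: compact_eq_bounded_closed)
  moreover have "0 \<le> f \<bullet> z" if "z \<in> c" for z
    using key[OF f x(2) y(2)] closure_subset[of c] that by (cases "z = 0") (auto simp: less_imp_le subset_iff)
  then have "0 \<in> S" using f unfolding S_def by auto
  ultimately obtain s where s: "s \<in> S" "\<And>r. r \<in> S \<Longrightarrow> r \<le> s"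
    using compact_attains_sup[of S] by blast
  define f' where "f' = f - s *\<^sub>R g"
  have s0: "0 \<le> s" and f'p: "\<forall>z\<in>b \<union> c. 0 \<le> f' \<bullet> z" using s(1) by (auto simp: S_def f'_def)
  have f'0: "f' \<noteq> 0"
  proof
    assume *: "f' = 0"
    then have "s \<noteq> 0" using f by (auto simp: f'_def)
    with * have "g = (1/s) *\<^sub>R f" by (simp add: f'_def)
    then show False using g by blast
  qed
  have "f' \<bullet> x \<le> 0" "f' \<bullet> y \<le> 0"
    using x y g s0 by (auto simp: f'_def inner_diff_left intro: order_trans[of _ 0])
  then have pos: "\<forall>z\<in>closure c - {0}. 0 < f' \<bullet> z" "\<forall>z\<in>closure b - {0}. 0 < f' \<bullet> z"
    using key[OF f'0] f'p by auto
  obtain d1 where d1: "d1 > 0" "\<forall>z\<in>closure b. d1 * norm z \<le> f' \<bullet> z"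
    using inner_pos_margin[of b f'] bD(4) pos by blast
  obtain d2 where d2: "d2 > 0" "\<forall>z\<in>closure c. d2 * norm z \<le> f' \<bullet> z"
    using inner_pos_margin[of c f'] cD(4) pos by blast
  define d where "d = min d1 d2"
  have d: "d > 0" using d1 d2 by (simp add: d_def)
  have dz: "d * norm z \<le> f' \<bullet> z" if "z \<in> b \<union> c" for z
  proof -
    have "d * norm z \<le> d1 * norm z" "d * norm z \<le> d2 * norm z"
      by (auto simp: d_def intro!: mult_right_mono)
    then show ?thesis using that d1 d2 closure_subset[of b] closure_subset[of c] by fastforce
  qed
  have g0: "g \<noteq> 0" using z0 by auto
  \<comment> \<open>A further tilt by \<open>e\<close> lowers the value at \<open>z\<close> by at
    most \<open>d * norm z\<close>, which the margin absorbs; so \<open>s\<close> was not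
    maximal.\<close>
  define e where "e = d / norm g"
  have e: "e > 0" using d g0 by (simp add: e_def)
  have "s + e \<in> S"
    unfolding S_def
  proof (intro CollectI conjI ballI)
    fix z assume z: "z \<in> b \<union> c"
    have "e * (g \<bullet> z) \<le> e * (norm g * norm z)"
      using e norm_cauchy_schwarz by (intro mult_left_mono) auto
    also have "\<dots> = d * norm z" using g0 by (simp add: e_def)
    also have "\<dots> \<le> f' \<bullet> z" by (rule dz[OF z])
    finally show "0 \<le> (f - (s + e) *\<^sub>R g) \<bullet> z" by (simp add: f'_def inner_diff_left algebra_simps)
  qed (use s0 e in auto)
  then show False using s(2) e by fastforce
qed

lemma occults_commute: "occults A b D \<longleftrightarrow> occults D b A"
  unfolding occults_def by blast

lemma occults_mono: "occults A b D \<Longrightarrow> A' \<subseteq> A \<Longrightarrow> D' \<subseteq> D \<Longrightarrow> occults A' b D'"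
  unfolding occults_def by (meson subsetD)

text \<open>A connected \<open>c\<close> that leaves \<open>b\<close> crosses its frontier at some
  \<open>p\<close>, and separating \<open>b\<close> from the open ray through \<open>p\<close> gives
  a supporting functional at \<open>p\<close>. It lies on the boundary of the dual of
  \<open>b\<close> and is not positive on all of \<open>c\<close>, so occultation makes it positive
  on any cone that \<open>b\<close> separates from \<open>c\<close>.\<close>

lemma functional_vanishing_at_exit:
  fixes b c :: "'a::euclidean_space set"
  assumes b: "open_cone b" and c: "convex c" and "c \<inter> b \<noteq> {}" "\<not> c \<subseteq> b" "0 \<notin> c"
  shows "\<exists>f p. f \<noteq> 0 \<and> (\<forall>z\<in>b. 0 \<le> f \<bullet> z) \<and> p \<in> c \<and> p \<in> closure b - {0} \<and> f \<bullet> p = 0"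
proof -
  note bD = open_coneD[OF b]
  have "c \<inter> frontier b \<noteq> {}"
    using assms convex_connected[OF c] by (intro connected_Int_frontier) auto
  then obtain p where p: "p \<in> c" "p \<in> closure b" "p \<notin> b"
    using bD(1) by (auto simp: frontier_def interior_open)
  define K where "K = {r *\<^sub>R p | r. 0 < r}"
  have "convex K"
  proof (rule convexI)
    fix x y and u v :: real
    assume "x \<in> K" "y \<in> K" and uv: "0 \<le> u" "0 \<le> v" "u + v = 1"
    then obtain r s where *: "x = r *\<^sub>R p" "y = s *\<^sub>R p" "0 < r" "0 < s" unfolding K_def by blast
    have "0 < u * r + v * s"
    proof (cases "u = 0")
      case False
      then have "0 < u * r" using uv * by simp
      moreover have "0 \<le> v * s" using uv * by simp
      ultimately show ?thesis by linarith
    qed (use uv * in simp)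
    moreover have "u *\<^sub>R x + v *\<^sub>R y = (u * r + v * s) *\<^sub>R p"
      unfolding * by (simp add: algebra_simps)
    ultimately show "u *\<^sub>R x + v *\<^sub>R y \<in> K" unfolding K_def by blast
  qed
  moreover have pK: "p \<in> K" unfolding K_def by (auto intro!: exI[of _ 1])
  moreover have "r *\<^sub>R z \<in> K" if "0 < r" "z \<in> K" for r z
  proof -
    obtain s where "z = s *\<^sub>R p" "0 < s" using \<open>z \<in> K\<close> unfolding K_def by blast
    then show ?thesis using \<open>0 < r\<close> unfolding K_def by (auto intro!: exI[of _ "r * s"])
  qed
  moreover have "b \<inter> K = {}"
  proof (rule ccontr)
    assume "b \<inter> K \<noteq> {}"
    then obtain r where r: "0 < r" "r *\<^sub>R p \<in> b" unfolding K_def by blast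
    then have "(1/r) *\<^sub>R (r *\<^sub>R p) \<in> b" using bD(4)[of "1/r" "r *\<^sub>R p"] by simp
    then show False using p r by simp
  qed
  ultimately obtain f where f: "f \<noteq> 0" "\<forall>z\<in>b. 0 \<le> f \<bullet> z" "\<forall>z\<in>K. f \<bullet> z \<le> 0"
    using separate_cones[of b K] bD by (metis empty_iff)
  have "f \<bullet> p = 0"
    using f pK inner_nonneg_closure[of b f p] p by force
  then show ?thesis using f p assms by (intro exI[of _ f] exI[of _ p]) auto
qed

lemma open_cone_closure:
  assumes "open_cone s" "x \<in> s"
  shows "x \<in> closure s - {0}"
proof -
  have "x \<in> closure s" using closure_subset[of s] assms(2) by (rule subsetD)
  moreover have "x \<noteq> 0" using assms zero_notin_open_cone[of s] by metis
  ultimately show ?thesis by simp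
qed

text \<open>The lifts are chosen so that \<open>a\<close> and \<open>c\<close> both meet
  \<open>b\<close>. Disjointness of the projective sets then means that \<open>a\<close> misses both
  lifts \<open>c\<close> and \<open>-c\<close>.\<close>

definition cone_occultation :: "'a::euclidean_space set \<Rightarrow> 'a set \<Rightarrow> 'a set \<Rightarrow> bool"
  where "cone_occultation a b c \<longleftrightarrow> open_cone a \<and> open_cone b \<and> open_cone c \<and>
    \<not> a \<subseteq> b \<and> \<not> c \<subseteq> b \<and> a \<inter> b \<noteq> {} \<and> b \<inter> c \<noteq> {} \<and> a \<inter> c = {} \<and> a \<inter> uminus ` c = {} \<and>
    occults (closure a - {0}) b (closure c - {0})"

lemma cone_occultationD:
  assumes "cone_occultation a b c"
  shows "open_cone a" "open_cone b" "open_cone c" "\<not> a \<subseteq> b" "\<not> c \<subseteq> b" "a \<inter> b \<noteq> {}" "b \<inter> c \<noteq> {}"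
    "a \<inter> c = {}" "a \<inter> uminus ` c = {}" "occults (closure a - {0}) b (closure c - {0})"
  using assms unfolding cone_occultation_def by blast+

lemma Int_uminus_empty_commute:
  fixes a c :: "'a::group_add set"
  shows "a \<inter> uminus ` c = {} \<longleftrightarrow> c \<inter> uminus ` a = {}"
proof -
  have "c \<inter> uminus ` a = {}" if "a \<inter> uminus ` c = {}" for a c :: "'a set"
    using that by (force simp: disjoint_iff)
  then show ?thesis by blast
qed

lemma cone_occultation_commute:
  assumes "cone_occultation a b c"
  shows "cone_occultation c b a"
proof -
  note D = cone_occultationD[OF assms]
  have "c \<inter> uminus ` a = {}" using D(9) Int_uminus_empty_commute[of a c] by simp
  moreover have "occults (closure c - {0}) b (closure a - {0})" using D(10) occults_commute by blast
  ultimately show ?thesis using D by (simp add: cone_occultation_def Int_commute)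
qed

text \<open>A functional supporting \<open>b\<close> at an exit point of \<open>c\<close> is not
  positive on \<open>c\<close>, hence positive on \<open>a\<close>, while nonnegative on
  \<open>b\<close>. This makes signs unambiguous: only one of the two lifts \<open>b\<close> and
  \<open>-b\<close> meets \<open>a\<close>.\<close>

lemma cone_occultation_not_opposite:
  assumes "cone_occultation a b c"
  shows "a \<inter> uminus ` b = {}"
proof -
  note D = cone_occultationD[OF assms]
  obtain f p where f: "f \<noteq> 0" "\<forall>z\<in>b. 0 \<le> f \<bullet> z" "p \<in> c" "f \<bullet> p = 0"
    using functional_vanishing_at_exit[OF D(2) open_coneD(3)[OF D(3)]] D(5,7)
      zero_notin_open_cone[OF D(3)] by (auto simp: Int_commute)
  have "p \<in> closure c - {0}" by (rule open_cone_closure[OF D(3) f(3)])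
  then have pos: "\<forall>z\<in>closure a - {0}. 0 < f \<bullet> z"
    using D(10) f unfolding occults_def by (metis less_irrefl)
  show ?thesis
  proof (rule ccontr)
    assume "a \<inter> uminus ` b \<noteq> {}"
    then obtain z where z: "- z \<in> a" "z \<in> b" by auto
    have "- z \<in> closure a - {0}" by (rule open_cone_closure[OF D(1) z(1)])
    then have "0 < f \<bullet> (- z)" using pos by blast
    moreover have "0 \<le> f \<bullet> z" using f(2) z(2) by blast
    ultimately show False by simp
  qed
qed

section \<open>Paths of cones in consecutive occultation\<close>

fun cone_path :: "'a::euclidean_space set list \<Rightarrow> bool"
  where
    "cone_path (a # b # c # p) \<longleftrightarrow> cone_occultation a b c \<and> cone_path (b # c # p)"
  | "cone_path [a, b] \<longleftrightarrow> open_cone a \<and> open_cone b \<and> a \<inter> b \<noteq> {} \<and> a \<inter> uminus ` b = {}"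
  | "cone_path _ \<longleftrightarrow> False"

lemma cone_path_open_cone: "cone_path p \<Longrightarrow> a \<in> set p \<Longrightarrow> open_cone a"
  by (induction p rule: cone_path.induct) (auto dest: cone_occultationD(1))

text \<open>Induction from the far end: \<open>c\<close> separates \<open>b\<close> from everything
  beyond it and \<open>b\<close> separates \<open>a\<close> from \<open>c\<close>, so
  \<open>occults_extend\<close> makes \<open>b\<close> separate \<open>a\<close> from all later
  cones.\<close>

lemma cone_path_occults:
  fixes a b :: "'a::euclidean_space set"
  assumes dim: "DIM('a) \<ge> 3" and "cone_path (a # b # p)"
  shows "occults (closure a - {0}) b (\<Union>c\<in>set p. closure c - {0})"
  using assms(2)
proof (induction p arbitrary: a b)
  case Nil
  then show ?case by (simp add: occults_def)
next
  case (Cons c q)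
  then have abc: "cone_occultation a b c" and IH: "occults (closure b - {0}) c (\<Union>c\<in>set q. closure c - {0})"
    by auto
  note D = cone_occultationD[OF abc]
  have "occults (closure a - {0}) b (\<Union>c\<in>set q. closure c - {0})"
    by (rule occults_extend[OF dim D(2,3,10) IH])
  with D(10) show ?case unfolding occults_def by (simp add: ball_Un) blast
qed

text \<open>The degenerate segment from \<open>x\<close> to itself must cross \<open>b\<close>, so a
  common point of the ends would lie in \<open>b\<close>, against the shorter path. If instead the
  ends contain \<open>x\<close> and \<open>-x\<close>, then \<open>x\<close> or \<open>-x\<close>
  lies in \<open>b\<close>; the first is excluded by the shorter path, the second by
  \<open>cone_occultation_not_opposite\<close>.\<close>

lemma cone_path_disjoint_ends:
  fixes a b :: "'a::euclidean_space set"
  assumes dim: "DIM('a) \<ge> 3" and "cone_path (a # b # c # p)"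
  shows "a \<inter> last (c # p) = {} \<and> a \<inter> uminus ` last (c # p) = {}"
  using assms(2)
proof (induction p arbitrary: a b c)
  case Nil
  then show ?case by (simp add: cone_occultation_def)
next
  case (Cons d q)
  define l where "l = last (d # q)"
  have abc: "cone_occultation a b c" and path: "cone_path (b # c # d # q)" using Cons.prems by auto
  note D = cone_occultationD[OF abc]
  have IH: "b \<inter> l = {}" "b \<inter> uminus ` l = {}" using Cons.IH[OF path] by (auto simp: l_def)
  have opp: "a \<inter> uminus ` b = {}" by (rule cone_occultation_not_opposite[OF abc])
  have lset: "l \<in> set (c # d # q)" unfolding l_def by (metis last_in_set list.discI list.set_intros(2))
  have lc: "open_cone l" using cone_path_open_cone[OF path] lset by auto
  have occ: "occults (closure a - {0}) b (closure l - {0})"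
    by (rule occults_mono[OF cone_path_occults[OF dim Cons.prems]]) (use lset in auto)
  have "x \<notin> l" if xa: "x \<in> a" for x
  proof
    assume xl: "x \<in> l"
    obtain s r where sr: "0 \<le> s" "0 \<le> r" "s *\<^sub>R x + r *\<^sub>R x \<in> b"
      using occults_segment[OF D(2) occ open_cone_closure[OF D(1) xa] open_cone_closure[OF lc xl]] by blast
    then have *: "(s + r) *\<^sub>R x \<in> b" by (simp add: scaleR_add_left)
    then have "s + r \<noteq> 0" using zero_notin_open_cone[OF D(2)] by auto
    then have "(1 / (s + r)) *\<^sub>R ((s + r) *\<^sub>R x) \<in> b" using sr by (intro open_coneD(4)[OF D(2)] *) auto
    then have "x \<in> b" using \<open>s + r \<noteq> 0\<close> by simp
    then show False using xl IH by blast
  qed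
  moreover have "- x \<notin> l" if xa: "x \<in> a" for x
  proof
    assume xl: "- x \<in> l"
    obtain s r where sr: "0 \<le> s" "0 \<le> r" "s *\<^sub>R x + r *\<^sub>R (- x) \<in> b"
      using occults_segment[OF D(2) occ open_cone_closure[OF D(1) xa] open_cone_closure[OF lc xl]] by blast
    then have *: "(s - r) *\<^sub>R x \<in> b" by (simp add: scaleR_diff_left)
    have "s \<noteq> r" using * zero_notin_open_cone[OF D(2)] by auto
    then consider "s > r" | "s < r" by linarith
    then show False
    proof cases
      case 1
      then have "(1 / (s - r)) *\<^sub>R ((s - r) *\<^sub>R x) \<in> b" by (intro open_coneD(4)[OF D(2)] *) auto
      then have "x \<in> b" using 1 by simp
      moreover have "x \<in> uminus ` l" using xl by (metis image_eqI minus_minus)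
      ultimately show False using IH by blast
    next
      case 2
      then have "(1 / (r - s)) *\<^sub>R ((s - r) *\<^sub>R x) \<in> b" by (intro open_coneD(4)[OF D(2)] *) auto
      moreover have "(1 / (r - s)) *\<^sub>R ((s - r) *\<^sub>R x) = - ((1 / (r - s)) *\<^sub>R ((r - s) *\<^sub>R x))"
        by (simp add: algebra_simps)
      ultimately have "- x \<in> b" using 2 by simp
      then have "x \<in> uminus ` b" by (metis image_eqI minus_minus)
      then show False using opp xa by blast
    qed
  qed
  ultimately have "a \<inter> l = {} \<and> a \<inter> uminus ` l = {}"
    unfolding disjoint_iff by (metis imageE minus_minus)
  then show ?case by (simp add: l_def)
qed

section \<open>Finite sums, a coefficient-free form of convex hulls of unions of cones\<close>

inductive_set gen :: "'a::real_vector set \<Rightarrow> 'a set" for S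
  where
    gen_base: "x \<in> S \<Longrightarrow> x \<in> gen S"
  | gen_add: "x \<in> S \<Longrightarrow> y \<in> gen S \<Longrightarrow> x + y \<in> gen S"

lemma gen_closed_add:
  assumes "x \<in> gen S" "y \<in> gen S"
  shows "x + y \<in> gen S"
  using assms(1) by induction (auto intro: gen.intros assms(2) simp: add.assoc)

lemma gen_mono:
  assumes "S \<subseteq> T"
  shows "gen S \<subseteq> gen T"
proof
  fix x assume "x \<in> gen S"
  then show "x \<in> gen T" by induction (use assms in \<open>auto intro: gen.intros\<close>)
qed

lemma gen_scale:
  assumes "\<And>z. z \<in> S \<Longrightarrow> r *\<^sub>R z \<in> T" "x \<in> gen S"
  shows "r *\<^sub>R x \<in> gen T"
  using assms(2) by induction (auto intro: gen.intros assms(1) simp: scaleR_add_right)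

text \<open>A point of \<open>A\<close> and a point of \<open>D\<close> can be merged: adding suitable multiples gives a point of the
  occulting cone \<open>b\<close>, and one of the two is used up.\<close>

lemma gen_occulted_add:
  fixes A b D :: "'a::real_vector set"
  assumes A: "\<And>r z. 0 < r \<Longrightarrow> z \<in> A \<Longrightarrow> r *\<^sub>R z \<in> A"
    and D: "\<And>r z. 0 < r \<Longrightarrow> z \<in> D \<Longrightarrow> r *\<^sub>R z \<in> D"
    and b: "\<And>r z. 0 < r \<Longrightarrow> z \<in> b \<Longrightarrow> r *\<^sub>R z \<in> b" "0 \<notin> b"
    and seg: "\<And>x y. x \<in> A \<Longrightarrow> y \<in> D \<Longrightarrow> \<exists>s\<ge>0. \<exists>r\<ge>0. s *\<^sub>R x + r *\<^sub>R y \<in> b"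
    and z: "z \<in> gen (b \<union> D)" "x \<in> A"
  shows "x + z \<in> gen (A \<union> b) \<union> gen (b \<union> D)"
proof -
  \<comment> \<open>Dividing by the larger of the two coefficients leaves a nonnegative multiple of
    only one of the points.\<close>
  have merge: "(\<exists>w\<in>b. \<exists>r. 0 \<le> r \<and> x + y = w + r *\<^sub>R y) \<or> (\<exists>w\<in>b. \<exists>s. 0 \<le> s \<and> x + y = w + s *\<^sub>R x)"
    if x: "x \<in> A" and y: "y \<in> D" for x y
  proof -
    obtain s r where sr: "0 \<le> s" "0 \<le> r" "s *\<^sub>R x + r *\<^sub>R y \<in> b" using seg[OF x y] by blast
    then have nz: "\<not> (s = 0 \<and> r = 0)" using b(2) by auto
    show ?thesis
    proof (cases "r \<le> s")
      case True
      then have s: "0 < s" using sr nz by linarith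
      have "(1/s) *\<^sub>R (s *\<^sub>R x + r *\<^sub>R y) \<in> b" using s sr by (intro b(1)) auto
      moreover have "x + y = (1/s) *\<^sub>R (s *\<^sub>R x + r *\<^sub>R y) + (1 - r/s) *\<^sub>R y"
        using s by (simp add: algebra_simps)
      moreover have "0 \<le> 1 - r/s" using True s by simp
      ultimately show ?thesis by blast
    next
      case False
      then have r: "0 < r" using sr by linarith
      have "(1/r) *\<^sub>R (s *\<^sub>R x + r *\<^sub>R y) \<in> b" using r sr by (intro b(1)) auto
      moreover have "x + y = (1/r) *\<^sub>R (s *\<^sub>R x + r *\<^sub>R y) + (1 - s/r) *\<^sub>R x"
        using r by (simp add: algebra_simps)
      moreover have "0 \<le> 1 - s/r" using False r by simp
      ultimately show ?thesis by blast
    qed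
  qed
  let ?X = "gen (A \<union> b) \<union> gen (b \<union> D)"
  have badd: "w + z \<in> ?X" if w: "w \<in> b" and z: "z \<in> ?X" for w z
    using z
  proof (elim UnE)
    assume "z \<in> gen (A \<union> b)"
    then have "w + z \<in> gen (A \<union> b)" using w by (intro gen_add) auto
    then show ?thesis by simp
  next
    assume "z \<in> gen (b \<union> D)"
    then have "w + z \<in> gen (b \<union> D)" using w by (intro gen_add) auto
    then show ?thesis by simp
  qed
  show ?thesis
    using z
  proof (induction arbitrary: x)
    case (gen_base y)
    then show ?case
    proof (elim UnE)
      assume "y \<in> b"
      then have "x + y \<in> gen (A \<union> b)" using gen_base(2) by (intro gen.intros) auto
      then show ?thesis by simp
    next
      assume y: "y \<in> D"
      from merge[OF gen_base(2) y] show ?thesis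
      proof (elim disjE bexE exE conjE)
        fix w r assume w: "w \<in> b" "0 \<le> r" "x + y = w + r *\<^sub>R y"
        show ?thesis
        proof (cases "r = 0")
          case False
          then have "r *\<^sub>R y \<in> D" using w y D by simp
          then have "w + r *\<^sub>R y \<in> gen (b \<union> D)" using w(1) by (intro gen.intros) auto
          then show ?thesis unfolding w(3) by simp
        qed (use w in \<open>auto intro!: gen.gen_base\<close>)
      next
        fix w s assume w: "w \<in> b" "0 \<le> s" "x + y = w + s *\<^sub>R x"
        show ?thesis
        proof (cases "s = 0")
          case False
          then have "s *\<^sub>R x \<in> A" using w gen_base A by simp
          then have "w + s *\<^sub>R x \<in> gen (A \<union> b)" using w(1) by (intro gen.intros) auto
          then show ?thesis unfolding w(3) by simp
        qed (use w in \<open>auto intro!: gen.gen_base\<close>)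
      qed
    qed
  next
    case (gen_add y z)
    from gen_add(1) show ?case
    proof (elim UnE)
      assume y: "y \<in> b"
      show ?thesis unfolding add.left_commute[of x] by (rule badd[OF y gen_add.IH[OF gen_add.prems]])
    next
      assume y: "y \<in> D"
      from merge[OF gen_add.prems y] show ?thesis
      proof (elim disjE bexE exE conjE)
        fix w r assume w: "w \<in> b" "0 \<le> r" "x + y = w + r *\<^sub>R y"
        have eq: "x + (y + z) = w + (r *\<^sub>R y + z)" using w(3) by (metis add.assoc)
        have "r *\<^sub>R y + z \<in> gen (b \<union> D)"
        proof (cases "r = 0")
          case False
          then show ?thesis using w y D gen_add(2) by (intro gen.gen_add) auto
        qed (use gen_add(2) in simp)
        then show ?thesis unfolding eq by (intro badd[OF w(1)]) simp
      next
        \<comment> \<open>Here \<open>y\<close> is used up and a multiple of \<open>x\<close>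
          survives, which the induction hypothesis, stated for arbitrary points of \<open>A\<close>,
          adds to the shorter sum.\<close>
        fix w s assume w: "w \<in> b" "0 \<le> s" "x + y = w + s *\<^sub>R x"
        have eq: "x + (y + z) = w + (s *\<^sub>R x + z)" using w(3) by (metis add.assoc)
        have "s *\<^sub>R x + z \<in> ?X"
        proof (cases "s = 0")
          case False
          then show ?thesis using w gen_add.prems A gen_add.IH by simp
        qed (use gen_add(2) in simp)
        then show ?thesis unfolding eq by (rule badd[OF w(1)])
      qed
    qed
  qed
qed

text \<open>Summands are added one at a time: the sum so far avoids \<open>A\<close> or avoids
  \<open>D\<close>, and only a new summand from the avoided set has to be merged.\<close>

lemma gen_occulted:
  fixes A b D :: "'a::real_vector set"
  assumes A: "\<And>r z. 0 < r \<Longrightarrow> z \<in> A \<Longrightarrow> r *\<^sub>R z \<in> A"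
    and D: "\<And>r z. 0 < r \<Longrightarrow> z \<in> D \<Longrightarrow> r *\<^sub>R z \<in> D"
    and b: "\<And>r z. 0 < r \<Longrightarrow> z \<in> b \<Longrightarrow> r *\<^sub>R z \<in> b" "0 \<notin> b"
    and seg: "\<And>x y. x \<in> A \<Longrightarrow> y \<in> D \<Longrightarrow> \<exists>s\<ge>0. \<exists>r\<ge>0. s *\<^sub>R x + r *\<^sub>R y \<in> b"
  shows "gen (A \<union> b \<union> D) \<subseteq> gen (A \<union> b) \<union> gen (b \<union> D)"
proof
  let ?X = "gen (A \<union> b) \<union> gen (b \<union> D)"
  have left: "x + z \<in> ?X" if "z \<in> gen (b \<union> D)" "x \<in> A" for x z
    by (rule gen_occulted_add) (use assms that in auto)
  have seg': "\<exists>s\<ge>0. \<exists>r\<ge>0. s *\<^sub>R y + r *\<^sub>R x \<in> b" if "y \<in> D" "x \<in> A" for x y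
    using seg[OF that(2,1)] by (metis add.commute)
  have "x + z \<in> gen (D \<union> b) \<union> gen (b \<union> A)" if "z \<in> gen (b \<union> A)" "x \<in> D" for x z
    by (rule gen_occulted_add) (use A D b seg' that in auto)
  then have right: "x + z \<in> ?X" if "z \<in> gen (A \<union> b)" "x \<in> D" for x z
    using that by (simp only: Un_commute)
  fix z assume "z \<in> gen (A \<union> b \<union> D)"
    then show "z \<in> ?X"
    proof induction
      case (gen_base x)
      then have "x \<in> A \<union> b \<or> x \<in> b \<union> D" by blast
      then show ?case by (auto intro: gen.gen_base)
    next
      case (gen_add x z)
      from gen_add(3) show ?case
      proof (elim UnE)
        assume z: "z \<in> gen (A \<union> b)"
        show ?thesis
        proof (cases "x \<in> D")
          case False
          then have "x + z \<in> gen (A \<union> b)" using gen_add(1) z by (intro gen.gen_add) auto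
          then show ?thesis by simp
        qed (rule right[OF z])
      next
        assume z: "z \<in> gen (b \<union> D)"
        show ?thesis
        proof (cases "x \<in> A")
          case False
          then have "x + z \<in> gen (b \<union> D)" using gen_add(1) z by (intro gen.gen_add) auto
          then show ?thesis by simp
        qed (rule left[OF z])
      qed
    qed
qed

text \<open>The second cone occults the first from all later ones, so a sum can drop either the
  first cone or everything after the second. Repeating this leaves two adjacent cones.\<close>

lemma cone_path_gen:
  fixes p :: "'a::euclidean_space set list"
  assumes dim: "DIM('a) \<ge> 3" and "cone_path p" "z \<in> gen (\<Union>(set p))"
  shows "\<exists>i. Suc i < length p \<and> z \<in> gen (p ! i \<union> p ! Suc i)"
  using assms(2,3)
proof (induction p rule: cone_path.induct)
  case (1 a b c p)
  let ?D = "\<Union>(set (c # p))"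
  have abc: "cone_occultation a b c" and path: "cone_path (b # c # p)" using 1(2) by auto
  note D = cone_occultationD[OF abc]
  have Dc: "open_cone d" if "d \<in> set (c # p)" for d
    using cone_path_open_cone[OF path] that by simp
  have "gen (a \<union> b \<union> ?D) \<subseteq> gen (a \<union> b) \<union> gen (b \<union> ?D)"
  proof (rule gen_occulted)
    fix x y assume x: "x \<in> a" and y: "y \<in> ?D"
    obtain d where d: "d \<in> set (c # p)" "y \<in> d" using y by blast
    have "y \<in> (\<Union>d\<in>set (c # p). closure d - {0})"
      using d(1) open_cone_closure[OF Dc[OF d(1)] d(2)] by (rule UN_I)
    then show "\<exists>s\<ge>0. \<exists>r\<ge>0. s *\<^sub>R x + r *\<^sub>R y \<in> b"
      by (rule occults_segment[OF D(2) cone_path_occults[OF dim 1(2)] open_cone_closure[OF D(1) x]])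
  next
    fix z and r :: real assume r: "0 < r" and "z \<in> ?D"
    then obtain d where d: "d \<in> set (c # p)" "z \<in> d" by blast
    then show "r *\<^sub>R z \<in> ?D" using open_coneD(4)[OF Dc[OF d(1)] r d(2)] by blast
  qed (use open_coneD(4)[OF D(1)] open_coneD(4)[OF D(2)] zero_notin_open_cone[OF D(2)] in auto)
  moreover have "\<Union>(set (a # b # c # p)) = a \<union> b \<union> ?D" "\<Union>(set (b # c # p)) = b \<union> ?D" by auto
  ultimately consider "z \<in> gen (a \<union> b)" | "z \<in> gen (\<Union>(set (b # c # p)))" using 1(3) by auto
  then show ?case
  proof cases
    case 1
    then show ?thesis by (intro exI[of _ 0]) simp
  next
    case 2
    then obtain i where "Suc i < length (b # c # p)" "z \<in> gen ((b # c # p) ! i \<union> (b # c # p) ! Suc i)"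
      using "1.IH"[OF path] by blast
    then show ?thesis by (intro exI[of _ "Suc i"]) simp
  qed
next
  case (2 a b)
  then show ?case by (intro exI[of _ 0]) simp
qed auto

text \<open>The boundary of the dual cone of \<open>b\<close> is a topological sphere of positive dimension. Each of its
  points outside the hyperplane \<open>f \<bullet> x = 0\<close> would be obstructed by exactly one cone of \<open>N\<close>, locally
  constantly; hence one cone would obstruct the whole boundary, leaving nothing for the others. The
  retraction \<open>R\<close> pushes a functional along \<open>h\<close> to that boundary without changing its value at \<open>x\<close>.\<close>

lemma exists_unobstructed_functional:
  fixes b :: "'a::euclidean_space set" and N :: "'a set set"
  assumes dim: "DIM('a) \<ge> 3" and b: "open_cone b"
    and N: "\<And>c. c \<in> N \<Longrightarrow> open_cone c \<and> c \<inter> b \<noteq> {} \<and> \<not> c \<subseteq> b"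
    and occ: "\<And>c c'. c \<in> N \<Longrightarrow> c' \<in> N \<Longrightarrow> c \<noteq> c' \<Longrightarrow> occults (closure c - {0}) b (closure c' - {0})"
    and two: "c1 \<in> N" "c2 \<in> N" "c1 \<noteq> c2"
    and h: "\<And>z. z \<in> closure b - {0} \<Longrightarrow> 0 < h \<bullet> z" and hx: "h \<bullet> x = 0" "x \<noteq> 0"
  shows "\<exists>f. f \<bullet> x \<noteq> 0 \<and> (\<forall>z\<in>b. 0 \<le> f \<bullet> z) \<and> (\<exists>p\<in>closure b - {0}. f \<bullet> p = 0) \<and>
    (\<forall>c\<in>N. \<forall>z\<in>c. 0 \<le> f \<bullet> z)"
proof (rule ccontr)
  assume contra: "\<not> ?thesis"
  note bD = open_coneD[OF b]
  have occ2: False if "c \<in> N" "c' \<in> N" "c \<noteq> c'" "f \<noteq> 0" "\<And>z. z \<in> b \<Longrightarrow> 0 \<le> f \<bullet> z"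
    "z \<in> closure c - {0}" "f \<bullet> z \<le> 0" "z' \<in> closure c' - {0}" "f \<bullet> z' \<le> 0" for c c' f z z'
    using occ[OF that(1-3)] that(4-) unfolding occults_def by (meson not_le)
  obtain d where d: "d > 0" "\<And>z. z \<in> closure b \<Longrightarrow> d * norm z \<le> h \<bullet> z"
    using inner_pos_margin[of b h] bD(4) h by blast
  \<comment> \<open>A compact base of the closed cone, on which nonnegativity over \<open>b\<close>
    can be tested. The minimum \<open>s g\<close> over it is the multiple of \<open>h\<close> to
    subtract from \<open>g\<close> in order to land on the boundary of the dual cone.\<close>
  define Z where "Z = closure b \<inter> {z. h \<bullet> z = 1}"
  have Znorm: "norm z \<le> 1 / d" if "z \<in> Z" for z
    using d(2)[of z] d(1) that by (simp add: Z_def field_simps)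
  have "bounded Z" using Znorm by (auto simp: bounded_iff)
  moreover have "closed Z" unfolding Z_def by (intro closed_Int closed_closure closed_hyperplane)
  ultimately have "compact Z" by (simp add: compact_eq_bounded_closed)
  have norm_in_Z: "(1 / (h \<bullet> z)) *\<^sub>R z \<in> Z" if "z \<in> closure b - {0}" for z
  proof -
    have "0 < h \<bullet> z" by (rule h[OF that])
    moreover from this have "(1 / (h \<bullet> z)) *\<^sub>R z \<in> closure b"
      using that by (intro closure_cone bD(4)) auto
    ultimately show ?thesis by (simp add: Z_def)
  qed
  obtain z0 where "z0 \<in> b" using bD(2) by blast
  then have "Z \<noteq> {}" using norm_in_Z[OF open_cone_closure[OF b]] by blast
  have "\<exists>z\<in>Z. \<forall>z'\<in>Z. g \<bullet> z \<le> g \<bullet> z'" for g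
    by (intro continuous_attains_inf \<open>compact Z\<close> \<open>Z \<noteq> {}\<close> continuous_intros)
  then obtain m where m: "\<And>g. m g \<in> Z" "\<And>g z. z \<in> Z \<Longrightarrow> g \<bullet> m g \<le> g \<bullet> z" by metis
  define s where "s g = g \<bullet> m g" for g
  define R where "R g = g - s g *\<^sub>R h" for g
  have s_le: "s g \<le> s g' + (1/d) * norm (g - g')" for g g'
  proof -
    have "s g \<le> g \<bullet> m g'" unfolding s_def by (intro m)
    also have "\<dots> = s g' + (g - g') \<bullet> m g'" by (simp add: s_def inner_diff_left)
    also have "(g - g') \<bullet> m g' \<le> norm (g - g') * norm (m g')" by (rule norm_cauchy_schwarz)
    also have "\<dots> \<le> norm (g - g') * (1/d)" by (intro mult_left_mono Znorm m) auto
    finally show ?thesis by (simp add: mult.commute)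
  qed
  have "(1/d)-lipschitz_on UNIV s"
  proof (rule lipschitz_onI)
    fix g g'
    show "dist (s g) (s g') \<le> (1/d) * dist g g'"
      using s_le[of g g'] s_le[of g' g] by (simp add: dist_norm norm_minus_commute abs_le_iff)
  qed (use d in auto)
  then have scont: "continuous_on UNIV s" by (rule lipschitz_on_continuous_on)
  then have Rcont: "continuous_on UNIV R" unfolding R_def by (intro continuous_intros)
  have R_nonneg: "0 \<le> R g \<bullet> z" if "z \<in> closure b" for g z
  proof (cases "z = 0")
    case False
    then have z: "z \<in> closure b - {0}" using that by simp
    have "s g \<le> g \<bullet> ((1 / (h \<bullet> z)) *\<^sub>R z)" unfolding s_def by (intro m norm_in_Z z)
    then show ?thesis using h[OF z] by (simp add: R_def inner_diff_left field_simps)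
  qed simp
  have R_nonneg_b: "0 \<le> R g \<bullet> z" if "z \<in> b" for g z
    using R_nonneg[of z g] closure_subset[of b] that by (meson subsetD)
  have Z_nz: "z \<in> closure b - {0}" if "z \<in> Z" for z
    using that by (auto simp: Z_def)
  have R_m: "R g \<bullet> m g = 0" for g
    using m(1)[of g] by (simp add: R_def inner_diff_left s_def Z_def)
  have R_x: "R g \<bullet> x = g \<bullet> x" for g using hx by (simp add: R_def inner_diff_left)
  have R_fix: "R f = f" if f: "\<And>z. z \<in> b \<Longrightarrow> 0 \<le> f \<bullet> z" and p: "p \<in> closure b - {0}" "f \<bullet> p = 0" for f p
  proof -
    have "s f \<le> f \<bullet> ((1 / (h \<bullet> p)) *\<^sub>R p)" unfolding s_def by (intro m norm_in_Z p)
    then have "s f \<le> 0" using p by simp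
    moreover have "0 \<le> s f" unfolding s_def
      by (rule inner_nonneg_closure[of b]) (use Z_nz[OF m(1)[of f]] f in auto)
    ultimately show ?thesis by (simp add: R_def)
  qed
  \<comment> \<open>If the claim fails, every \<open>g\<close> off the hyperplane has a cone that
    obstructs \<open>R g\<close> in this sense, and occultation allows only one.\<close>
  define neg where "neg c g \<longleftrightarrow> (\<exists>q\<in>c. R g \<bullet> q < 0)" for c g
  have ex_neg: "\<exists>c\<in>N. neg c g" if "g \<bullet> x \<noteq> 0" for g
  proof (rule ccontr)
    assume "\<not> ?thesis"
    then have "\<forall>c\<in>N. \<forall>z\<in>c. 0 \<le> R g \<bullet> z" unfolding neg_def by (meson not_le)
    moreover have "R g \<bullet> x \<noteq> 0" using that R_x by simp
    moreover have "\<forall>z\<in>b. 0 \<le> R g \<bullet> z" using R_nonneg_b by blast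
    moreover have "\<exists>p\<in>closure b - {0}. R g \<bullet> p = 0" using R_m Z_nz[OF m(1)] by blast
    ultimately show False using contra by blast
  qed
  have neg_unique: "c = c'" if cc: "c \<in> N" "c' \<in> N" and n: "neg c g" "neg c' g" for c c' g
  proof (rule ccontr)
    assume ne: "c \<noteq> c'"
    obtain q q' where q: "q \<in> c" "R g \<bullet> q < 0" "q' \<in> c'" "R g \<bullet> q' < 0" using n unfolding neg_def by blast
    have "R g \<noteq> 0" using q by auto
    then show False
      using occ2[OF cc ne _ R_nonneg_b, of g q q'] open_cone_closure[of c q] open_cone_closure[of c' q']
        q N[OF cc(1)] N[OF cc(2)] less_imp_le[OF q(2)] less_imp_le[OF q(4)] by blast
  qed
  have neg_open: "open {g. neg c g}" for c
  proof -
    have "{g. neg c g} = (\<Union>q\<in>c. {g. R g \<bullet> q < 0})" unfolding neg_def by auto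
    moreover have "open {g. R g \<bullet> q < 0}" for q
      by (intro open_Collect_less continuous_intros Rcont)
    ultimately show ?thesis by auto
  qed
  have neg_const: "\<exists>c\<in>N. \<forall>g\<in>H. neg c g" if H: "convex H" "H \<noteq> {}" "\<And>g. g \<in> H \<Longrightarrow> g \<bullet> x \<noteq> 0" for H
  proof -
    obtain g0 where g0: "g0 \<in> H" using H by blast
    then obtain c where c: "c \<in> N" "neg c g0" using ex_neg H by blast
    define B where "B = (\<Union>c'\<in>N - {c}. {g. neg c' g})"
    have "{g. neg c g} \<inter> H = {} \<or> B \<inter> H = {}"
    proof (rule connectedD[OF convex_connected[OF H(1)]])
      show "open B" unfolding B_def using neg_open by blast
      show "{g. neg c g} \<inter> B \<inter> H = {}" unfolding B_def using neg_unique[OF c(1)] by blast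
      show "H \<subseteq> {g. neg c g} \<union> B" unfolding B_def using ex_neg H(3) by blast
    qed (rule neg_open)
    then have "B \<inter> H = {}" using g0 c by blast
    then have "\<forall>g\<in>H. neg c g" unfolding B_def using ex_neg H(3) by blast
    then show ?thesis using c by blast
  qed
  \<comment> \<open>At a limit only weak obstruction survives: if \<open>R k\<close> were positive
    on the closure of \<open>c\<close>, its margin would keep nearby values of \<open>R\<close>
    positive on \<open>c\<close>.\<close>
  have bad_limit: "\<exists>z\<in>closure c - {0}. R k \<bullet> z \<le> 0"
    if c: "c \<in> N" and k: "\<And>e. 0 < e \<Longrightarrow> neg c (k + e *\<^sub>R u)" for c k u
  proof (rule ccontr)
    assume no: "\<not> ?thesis"
    have cc: "open_cone c" using N[OF c] by blast
    have "\<exists>d>0. \<forall>z\<in>closure c. d * norm z \<le> R k \<bullet> z"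
      by (rule inner_pos_margin) (use no open_coneD(4)[OF cc] in \<open>auto simp: not_le\<close>)
    then obtain r where r: "r > 0" "\<And>z. z \<in> closure c \<Longrightarrow> r * norm z \<le> R k \<bullet> z" by blast
    obtain e where e: "e > 0" "\<And>g. dist g k < e \<Longrightarrow> dist (R g) (R k) < r"
      using Rcont r(1) unfolding continuous_on_iff by (metis UNIV_I)
    define t where "t = e / (2 * (norm u + 1))"
    have t: "t > 0" using e by (simp add: t_def add_nonneg_pos)
    have "t * norm u \<le> e / 2"
      using e by (simp add: t_def divide_simps add_nonneg_pos)
    then have "dist (k + t *\<^sub>R u) k < e" using t e by (simp add: dist_norm)
    then have close: "norm (R (k + t *\<^sub>R u) - R k) < r" using e by (simp add: dist_norm)
    obtain q where q: "q \<in> c" "R (k + t *\<^sub>R u) \<bullet> q < 0" using k[OF t] unfolding neg_def by blast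
    have q0: "q \<in> closure c - {0}" by (rule open_cone_closure[OF cc q(1)])
    have "- ((R (k + t *\<^sub>R u) - R k) \<bullet> q) \<le> norm (R (k + t *\<^sub>R u) - R k) * norm q"
      using norm_cauchy_schwarz[of "- (R (k + t *\<^sub>R u) - R k)" q] by (simp add: norm_minus_commute inner_diff_left)
    also have "\<dots> < r * norm q" using close q0 by (intro mult_strict_right_mono) auto
    also have "\<dots> \<le> R k \<bullet> q" using r(2) q0 by blast
    finally show False using q(2) by (simp add: inner_diff_left)
  qed
  obtain cp where cp: "cp \<in> N" "\<And>g. g \<bullet> x > 0 \<Longrightarrow> neg cp g"
  proof -
    have "\<exists>c\<in>N. \<forall>g\<in>{g. x \<bullet> g > 0}. neg c g"
    proof (rule neg_const)
      have "x \<in> {g. x \<bullet> g > 0}" using hx by simp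
      then show "{g. x \<bullet> g > 0} \<noteq> {}" by blast
    qed (rule convex_halfspace_gt, simp add: inner_commute)
    then show ?thesis using that by (auto simp: inner_commute)
  qed
  obtain cm where cm: "cm \<in> N" "\<And>g. g \<bullet> x < 0 \<Longrightarrow> neg cm g"
  proof -
    have "\<exists>c\<in>N. \<forall>g\<in>{g. x \<bullet> g < 0}. neg c g"
    proof (rule neg_const)
      have "- x \<in> {g. x \<bullet> g < 0}" using hx by simp
      then show "{g. x \<bullet> g < 0} \<noteq> {}" by blast
    qed (rule convex_halfspace_lt, simp add: inner_commute)
    then show ?thesis using that by (auto simp: inner_commute)
  qed
  have xx: "x \<bullet> x > 0" using hx by simp
  have bad_p: "\<exists>z\<in>closure cp - {0}. R k \<bullet> z \<le> 0" if "k \<bullet> x \<ge> 0" for k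
    by (rule bad_limit[OF cp(1), of k x], rule cp(2))
      (use that xx in \<open>simp add: inner_add_left add_nonneg_pos\<close>)
  have bad_m: "\<exists>z\<in>closure cm - {0}. R k \<bullet> z \<le> 0" if "k \<bullet> x \<le> 0" for k
  proof (rule bad_limit[OF cm(1), of k "- x"], rule cm(2))
    fix e :: real assume "0 < e"
    then have "0 < e * (x \<bullet> x)" using xx by simp
    then show "(k + e *\<^sub>R (- x)) \<bullet> x < 0" using that by (simp add: inner_diff_left)
  qed
  have "cp = cm"
  proof (rule ccontr)
    assume ne: "cp \<noteq> cm"
    \<comment> \<open>A functional orthogonal to \<open>x\<close> is a limit from both half-spaces,
      hence weakly obstructed by both cones. Orthogonality to \<open>h\<close> keeps
      \<open>R u\<close> nonzero, so that occultation applies.\<close>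
    obtain u where u: "u \<noteq> 0" "u \<bullet> x = 0" "u \<bullet> h = 0" using exists_orthogonal2[OF dim] by blast
    have "R u \<noteq> 0"
    proof
      assume "R u = 0"
      then have "u = s u *\<^sub>R h" by (simp add: R_def)
      then have "u \<bullet> u = 0" using u(3) by (metis inner_commute inner_scaleR_left mult_zero_right)
      then show False using u by simp
    qed
    then show False
      using bad_p[of u] bad_m[of u] occ2[OF cp(1) cm(1) ne _ R_nonneg_b] u(2) by auto
  qed
  \<comment> \<open>A functional supporting \<open>b\<close> at a point of a second neighbour is
    fixed by \<open>R\<close>, so \<open>cp\<close> weakly obstructs it too, which occultation
    forbids.\<close>
  obtain c where c: "c \<in> N" "c \<noteq> cp" using two by metis
  obtain f p where f: "f \<noteq> 0" "\<And>z. z \<in> b \<Longrightarrow> 0 \<le> f \<bullet> z" "p \<in> c" "p \<in> closure b - {0}" "f \<bullet> p = 0"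
    using functional_vanishing_at_exit[OF b, of c] N[OF c(1)] open_coneD(3)[of c] zero_notin_open_cone[of c]
    by metis
  have "R f = f" by (rule R_fix[OF f(2,4,5)])
  then have "\<exists>z\<in>closure cp - {0}. f \<bullet> z \<le> 0"
    using bad_p[of f] bad_m[of f] \<open>cp = cm\<close> by (metis linear)
  moreover have "p \<in> closure c - {0}" using open_cone_closure[of c p] N[OF c(1)] f(3) by blast
  ultimately show False using occ2[OF cp(1) c(1) _ f(1,2)] c(2) f(5) by (metis order_refl)
qed

section \<open>Cones over subsets of projective space\<close>

lemma proj_pt_eq_iff:
  fixes v w :: "'a::{real_normed_vector, perfect_space}"
  assumes "v \<noteq> 0" "w \<noteq> 0"
  shows "proj_pt v = proj_pt w \<longleftrightarrow> (\<exists>c. c \<noteq> 0 \<and> w = c *\<^sub>R v)"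
proof -
  have r: "u \<noteq> 0 \<Longrightarrow> \<exists>c. c \<noteq> 0 \<and> u = c *\<^sub>R u" for u :: 'a
    by (intro exI[of _ 1]) simp
  show ?thesis
    using Quotient3_rel[OF Quotient3_proj, of v w] assms r[of v] r[of w] by simp
qed

lemma proj_pt_scale:
  fixes v :: "'a::{real_normed_vector, perfect_space}"
  assumes "v \<noteq> 0" "c \<noteq> 0"
  shows "proj_pt (c *\<^sub>R v) = proj_pt v"
  using assms by (metis proj_pt_eq_iff scaleR_eq_0_iff)

lemma proj_pt_uminus:
  fixes v :: "'a::{real_normed_vector, perfect_space}"
  assumes "v \<noteq> 0"
  shows "proj_pt (- v) = proj_pt v"
  using proj_pt_scale[OF assms, of "-1"] by simp

lemma proj_pt_cases:
  fixes p :: "'a::{real_normed_vector, perfect_space} proj"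
  obtains v where "v \<noteq> 0" "p = proj_pt v"
proof -
  have "\<exists>v. v \<noteq> 0 \<and> p = proj_pt v" by (rule proj.abs_induct[of _ p]) blast
  then show ?thesis using that by blast
qed

lemma pgl_class_cases:
  fixes g :: "'a::euclidean_space pgl"
  obtains F where "bij (blinfun_apply F)" "g = pgl_class F"
proof -
  have "\<exists>F. bij (blinfun_apply F) \<and> g = pgl_class F" by (rule pgl.abs_induct[of _ g]) blast
  then show ?thesis using that by blast
qed

lemma pgl_act_class:
  assumes "bij (blinfun_apply F)" "v \<noteq> 0"
  shows "pgl_act (pgl_class F) (proj_pt v) = proj_pt (blinfun_apply F v)"
  by (rule pgl_act.abs_eq) (use assms in \<open>auto intro!: exI[of _ 1]\<close>)

lemma pgl_mult_class:
  assumes "bij (blinfun_apply F)" "bij (blinfun_apply G)"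
  shows "pgl_mult (pgl_class F) (pgl_class G) = pgl_class (F o\<^sub>L G)"
  by (rule pgl_mult.abs_eq) (use assms in \<open>auto intro!: exI[of _ 1]\<close>)

lemma bij_blinfun_apply_nonzero:
  assumes "bij (blinfun_apply F)" "v \<noteq> 0"
  shows "blinfun_apply F v \<noteq> 0"
  using assms by (metis bij_pointE blinfun.zero_right)

lemma pgl_act_mult: "pgl_act (pgl_mult g h) p = pgl_act g (pgl_act h p)"
proof -
  obtain F where F: "bij (blinfun_apply F)" "g = pgl_class F" by (rule pgl_class_cases)
  obtain G where G: "bij (blinfun_apply G)" "h = pgl_class G" by (rule pgl_class_cases)
  obtain v where v: "v \<noteq> 0" "p = proj_pt v" by (rule proj_pt_cases)
  have "blinfun_apply (F o\<^sub>L G) = blinfun_apply F \<circ> blinfun_apply G" by auto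
  then have "bij (blinfun_apply (F o\<^sub>L G))" using F(1) G(1) by (metis bij_comp)
  then show ?thesis
    using F G v by (simp add: pgl_mult_class pgl_act_class bij_blinfun_apply_nonzero)
qed

lemma pgl_act_one: "pgl_act pgl_one p = p"
proof -
  obtain v where v: "v \<noteq> 0" "p = proj_pt v" by (rule proj_pt_cases)
  have "bij (blinfun_apply (id_blinfun :: 'a \<Rightarrow>\<^sub>L 'a))" by (auto simp: bij_def inj_on_def)
  then show ?thesis using v by (simp add: pgl_one_def pgl_act_class)
qed

lemma hyperplane_iff:
  fixes \<phi> :: "'a::euclidean_space \<Rightarrow>\<^sub>L real"
  assumes "\<phi> \<noteq> 0" "v \<noteq> 0"
  shows "proj_pt v \<in> proj_hyperplane (proj_pt \<phi>) \<longleftrightarrow> blinfun_apply \<phi> v = 0"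
proof -
  have "proj_hyperplane (proj_pt \<phi>) = {p. \<exists>v. v \<noteq> 0 \<and> blinfun_apply \<phi> v = 0 \<and> p = proj_pt v}"
    by (rule proj_hyperplane.abs_eq) (use assms in \<open>auto intro!: exI[of _ 1]\<close>)
  then show ?thesis
    using assms by (auto simp: proj_pt_eq_iff blinfun.scaleR_right intro!: exI[of _ v])
qed

lemma subset_affine_chart_iff:
  fixes \<phi> :: "'a::euclidean_space \<Rightarrow>\<^sub>L real"
  assumes "\<phi> \<noteq> 0"
  shows "X \<subseteq> affine_chart \<phi> \<longleftrightarrow> (\<forall>v. v \<noteq> 0 \<longrightarrow> proj_pt v \<in> X \<longrightarrow> blinfun_apply \<phi> v \<noteq> 0)"
proof
  assume "X \<subseteq> affine_chart \<phi>"
  then show "\<forall>v. v \<noteq> 0 \<longrightarrow> proj_pt v \<in> X \<longrightarrow> blinfun_apply \<phi> v \<noteq> 0"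
    using hyperplane_iff[OF assms] by (auto simp: affine_chart_def)
next
  assume r: "\<forall>v. v \<noteq> 0 \<longrightarrow> proj_pt v \<in> X \<longrightarrow> blinfun_apply \<phi> v \<noteq> 0"
  show "X \<subseteq> affine_chart \<phi>"
  proof
    fix p assume p: "p \<in> X"
    obtain v where v: "v \<noteq> 0" "p = proj_pt v" by (rule proj_pt_cases)
    then show "p \<in> affine_chart \<phi>" using r p hyperplane_iff[OF assms v(1)] by (auto simp: affine_chart_def)
  qed
qed

text \<open>A relation and not a function: there are two opposite lifts, and neither is preferred
  until a functional is fixed.\<close>

definition cone_over :: "'a::euclidean_space set \<Rightarrow> 'a proj set \<Rightarrow> bool"
  where "cone_over a \<Omega> \<longleftrightarrow> open_cone a \<and> proj_pt ` a = \<Omega>"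

lemma cone_over_open_cone: "cone_over a \<Omega> \<Longrightarrow> open_cone a"
  by (simp add: cone_over_def)

lemma image_cone_mem_iff:
  fixes a :: "'a::{real_normed_vector, perfect_space} set"
  assumes "\<And>r z. 0 < r \<Longrightarrow> z \<in> a \<Longrightarrow> r *\<^sub>R z \<in> a" "0 \<notin> a" "v \<noteq> 0"
  shows "proj_pt v \<in> proj_pt ` a \<longleftrightarrow> v \<in> a \<or> - v \<in> a"
proof
  assume "proj_pt v \<in> proj_pt ` a"
  then obtain w where w: "w \<in> a" "proj_pt w = proj_pt v" by auto
  then have "w \<noteq> 0" using assms by blast
  then obtain c where c: "c \<noteq> 0" "v = c *\<^sub>R w" using w assms by (metis proj_pt_eq_iff)
  show "v \<in> a \<or> - v \<in> a"
  proof (cases "c > 0")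
    case True
    then show ?thesis using assms c w by blast
  next
    case False
    then have "(- c) *\<^sub>R w \<in> a" using c by (intro assms w) auto
    then show ?thesis using c by simp
  qed
next
  assume "v \<in> a \<or> - v \<in> a"
  then show "proj_pt v \<in> proj_pt ` a" using proj_pt_uminus[OF assms(3)] by (metis image_eqI)
qed

lemma cone_over_mem_iff:
  assumes "cone_over a \<Omega>" "v \<noteq> 0"
  shows "proj_pt v \<in> \<Omega> \<longleftrightarrow> v \<in> a \<or> - v \<in> a"
  using image_cone_mem_iff[OF open_coneD(4) zero_notin_open_cone assms(2)] assms(1)
  by (auto simp: cone_over_def)

lemma cone_over_nonempty: "cone_over a \<Omega> \<Longrightarrow> \<Omega> \<noteq> {}"
  using open_coneD(2) by (auto simp: cone_over_def)

lemma open_cone_not_opposite: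
  assumes "open_cone a" "z \<in> a"
  shows "- z \<notin> a"
proof
  assume "- z \<in> a"
  then have "z + - z \<in> a" using assms by (intro open_cone_add) auto
  then show False using zero_notin_open_cone[OF assms(1)] by simp
qed

lemma bij_linear_closure:
  fixes F :: "'a::euclidean_space \<Rightarrow> 'a"
  assumes "linear F" "bij F"
  shows "closure (F ` s) - {0} = F ` (closure s - {0})"
proof -
  have "F 0 = 0" by (rule linear_0[OF assms(1)])
  then have "F ` (closure s - {0}) = F ` closure s - {0}"
    using image_set_diff[OF bij_is_inj[OF assms(2)], of "closure s" "{0}"] by simp
  then show ?thesis by (simp only: closure_injective_linear_image[OF assms(1) bij_is_inj[OF assms(2)]])
qed

text \<open>Functionals are pushed forward by the adjoint of the inverse; this carries the
  functional witnessing sharpness to a linear image of the cone.\<close>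

lemma inner_inverse_adjoint:
  fixes F :: "'a::euclidean_space \<Rightarrow> 'a"
  assumes "linear F" "bij F"
  shows "adjoint (inv_into UNIV F) f \<bullet> F z = f \<bullet> z"
proof -
  have "linear (inv_into UNIV F)" using assms by (intro inj_linear_imp_inv_linear bij_is_inj)
  then have "adjoint (inv_into UNIV F) f \<bullet> F z = f \<bullet> inv_into UNIV F (F z)" by (simp add: adjoint_clauses)
  then show ?thesis using assms by (simp add: bij_is_inj)
qed

lemma open_cone_linear_image:
  fixes F :: "'a::euclidean_space \<Rightarrow> 'a"
  assumes F: "linear F" "bij F" and a: "open_cone a"
  shows "open_cone (F ` a)"
  unfolding open_cone_def
proof (intro conjI)
  note aD = open_coneD[OF a]
  show "open (F ` a)" using aD(1) open_bijective_linear_image_eq[OF F] by simp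
  show "F ` a \<noteq> {}" using aD by simp
  show "convex (F ` a)" by (rule convex_linear_image[OF F(1) aD(3)])
  show "\<forall>r>0. \<forall>z\<in>F ` a. r *\<^sub>R z \<in> F ` a"
    using aD(4) F(1) by (auto simp: linear_scale[symmetric])
  obtain f where "\<forall>z\<in>closure a - {0}. 0 < f \<bullet> z" using aD(5) by blast
  then show "\<exists>f. \<forall>z\<in>closure (F ` a) - {0}. 0 < f \<bullet> z"
    unfolding bij_linear_closure[OF F]
    by (intro exI[of _ "adjoint (inv_into UNIV F) f"]) (auto simp: inner_inverse_adjoint[OF F])
qed

lemma linear_uminus: "linear (uminus :: 'a::real_vector \<Rightarrow> 'a)"
  by (rule linearI) auto

lemma occults_linear_image:
  fixes F :: "'a::euclidean_space \<Rightarrow> 'a"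
  assumes F: "linear F" "bij F" and occ: "occults A b D"
  shows "occults (F ` A) (F ` b) (F ` D)"
  unfolding occults_def
proof (intro allI impI)
  fix f assume f: "f \<noteq> 0" "\<forall>z\<in>F ` b. 0 \<le> f \<bullet> z"
  have adj: "adjoint F f \<bullet> z = f \<bullet> F z" for z using F(1) by (simp add: adjoint_clauses)
  have "adjoint F f \<noteq> 0"
  proof
    assume "adjoint F f = 0"
    then have "f \<bullet> F z = 0" for z using adj[of z] by simp
    moreover have "f = F (inv_into UNIV F f)" using F by (simp add: bij_is_surj surj_f_inv_f)
    ultimately have "f \<bullet> f = 0" by metis
    then show False using f by simp
  qed
  then show "(\<forall>z\<in>F ` A. 0 < f \<bullet> z) \<or> (\<forall>z\<in>F ` D. 0 < f \<bullet> z)"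
    using occ f(2) unfolding occults_def by (force simp: adj)
qed

lemma cone_occultation_linear_image:
  fixes F :: "'a::euclidean_space \<Rightarrow> 'a"
  assumes F: "linear F" "bij F" and occ: "cone_occultation a b c"
  shows "cone_occultation (F ` a) (F ` b) (F ` c)"
proof -
  note D = cone_occultationD[OF occ]
  have inj: "inj F" by (rule bij_is_inj[OF F(2)])
  have Int: "F ` s \<inter> F ` s' = F ` (s \<inter> s')" for s s' by (rule image_Int[OF inj, symmetric])
  have um: "uminus ` F ` s = F ` uminus ` s" for s
    using linear_neg[OF F(1)] by (simp add: image_image)
  show ?thesis
    unfolding cone_occultation_def um Int bij_linear_closure[OF F] inj_image_subset_iff[OF inj] image_is_empty
    using D open_cone_linear_image[OF F] occults_linear_image[OF F D(10)] by blast
qed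

lemma cone_over_uminus:
  assumes "cone_over a \<Omega>"
  shows "cone_over (uminus ` a) \<Omega>"
proof -
  have a: "open_cone a" "proj_pt ` a = \<Omega>" using assms by (auto simp: cone_over_def)
  have "proj_pt (- z) = proj_pt z" if "z \<in> a" for z
    using that zero_notin_open_cone[OF a(1)] by (intro proj_pt_uminus) auto
  then have "proj_pt ` uminus ` a = \<Omega>" using a(2) by (auto simp: image_image)
  then show ?thesis using a open_cone_linear_image[OF linear_uminus bij_uminus a(1)] by (simp add: cone_over_def)
qed

lemma cone_over_linear_image:
  assumes "cone_over a \<Omega>" "bij (blinfun_apply F)"
  shows "cone_over (blinfun_apply F ` a) (pgl_act (pgl_class F) ` \<Omega>)"
proof -
  have a: "open_cone a" "proj_pt ` a = \<Omega>" using assms by (auto simp: cone_over_def)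
  have "pgl_act (pgl_class F) (proj_pt z) = proj_pt (blinfun_apply F z)" if "z \<in> a" for z
    using that zero_notin_open_cone[OF a(1)] by (intro pgl_act_class assms) auto
  then have "proj_pt ` blinfun_apply F ` a = pgl_act (pgl_class F) ` \<Omega>"
    unfolding a(2)[symmetric] by (auto simp: image_image)
  moreover have "linear (blinfun_apply F)" by (intro bounded_linear.linear blinfun.bounded_linear_right)
  ultimately show ?thesis using open_cone_linear_image[OF _ assms(2) a(1)] by (simp add: cone_over_def)
qed

text \<open>A second lift is connected and covered by the disjoint open cones \<open>s\<close> and
  \<open>-s\<close>, so it lies in one of them. Applied in both directions this gives equality up to
  sign, as the mixed cases would put \<open>a\<close> inside \<open>-a\<close>.\<close>

lemma cone_over_unique:
  assumes "cone_over a \<Omega>" "cone_over a' \<Omega>"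
  shows "a' = a \<or> a' = uminus ` a"
proof -
  have sub: "s' \<subseteq> s \<or> s' \<subseteq> uminus ` s" if s: "cone_over s \<Omega>" and s': "cone_over s' \<Omega>" for s s' :: "'a set"
  proof -
    have cover: "s' \<subseteq> s \<union> uminus ` s"
    proof
      fix z assume z: "z \<in> s'"
      then have "z \<noteq> 0" using zero_notin_open_cone[OF cone_over_open_cone[OF s']] by auto
      moreover have "proj_pt z \<in> \<Omega>" using z s' by (auto simp: cone_over_def)
      ultimately have "z \<in> s \<or> - z \<in> s" using cone_over_mem_iff[OF s] by blast
      then show "z \<in> s \<union> uminus ` s" by (auto simp: image_iff) (metis minus_minus)
    qed
    have "s \<inter> s' = {} \<or> uminus ` s \<inter> s' = {}"
    proof (rule connectedD)
      show "connected s'" using open_coneD(3)[OF cone_over_open_cone[OF s']] by (rule convex_connected)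
      show "open s" using open_coneD(1)[OF cone_over_open_cone[OF s]] .
      show "open (uminus ` s)" using open_coneD(1)[OF cone_over_open_cone[OF cone_over_uminus[OF s]]] .
      show "s \<inter> uminus ` s \<inter> s' = {}" using open_cone_not_opposite[OF cone_over_open_cone[OF s]] by auto
    qed (rule cover)
    then show ?thesis using cover by blast
  qed
  have ne: "a \<noteq> {}" "a' \<noteq> {}" using assms open_coneD(2) by (auto simp: cone_over_def)
  have umum: "uminus ` uminus ` s = s" for s :: "'a set" by (simp add: image_image)
  have no: "\<not> s \<subseteq> uminus ` s" if "cone_over s \<Omega>" "s \<noteq> {}" for s :: "'a set"
    using open_cone_not_opposite[OF cone_over_open_cone[OF that(1)]] that(2) by auto
  have up: "uminus ` s \<subseteq> s'" if "s \<subseteq> uminus ` s'" for s s' :: "'a set"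
    using image_mono[OF that, of uminus] umum[of s'] by simp
  consider "a' \<subseteq> a" "a \<subseteq> a'" | "a' \<subseteq> a" "a \<subseteq> uminus ` a'" | "a' \<subseteq> uminus ` a" "a \<subseteq> a'"
    | "a' \<subseteq> uminus ` a" "a \<subseteq> uminus ` a'"
    using sub[OF assms] sub[OF assms(2,1)] by argo
  then show ?thesis
  proof cases
    case 2
    then have "a \<subseteq> uminus ` a" by (meson image_mono subset_trans)
    then show ?thesis using no[OF assms(1) ne(1)] by simp
  next
    case 3
    then have "a \<subseteq> uminus ` a" by (meson subset_trans)
    then show ?thesis using no[OF assms(1) ne(1)] by simp
  next
    case 4
    then show ?thesis using up[OF 4(2)] by simp
  qed simp
qed

text \<open>The device for matching lifts that come from different sources: meeting \<open>b\<close>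
  selects one of the two lifts of \<open>C\<close>.\<close>

lemma cone_over_unique_meet:
  assumes "cone_over c C" "cone_over c' C" "b \<inter> c' \<noteq> {}" "b \<inter> uminus ` c = {}"
  shows "c' = c"
  using cone_over_unique[OF assms(1,2)] assms(3,4) by auto

lemma open_proj_iff:
  fixes U :: "'a::{real_normed_vector, perfect_space} proj set"
  shows "open U \<longleftrightarrow> open {v. v \<noteq> 0 \<and> proj_pt v \<in> U}"
  by (rule open_proj_def)

lemma proj_pt_in_closure:
  fixes a :: "'a::{real_normed_vector, perfect_space} set"
  assumes "z \<in> closure a" "z \<noteq> 0" "0 \<notin> a"
  shows "proj_pt z \<in> closure (proj_pt ` a)"
  unfolding closure_iff_nhds_not_empty
proof (intro allI impI)
  fix A U :: "'a proj set" assume U: "U \<subseteq> A" "open U" "proj_pt z \<in> U"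
  have "open {v. v \<noteq> 0 \<and> proj_pt v \<in> U}" using U(2) by (simp add: open_proj_iff)
  moreover have "z \<in> {v. v \<noteq> 0 \<and> proj_pt v \<in> U}" using U assms by simp
  ultimately have "a \<inter> {v. v \<noteq> 0 \<and> proj_pt v \<in> U} \<noteq> {}"
    using assms(1) closure_iff_nhds_not_empty[of z a] by blast
  then show "proj_pt ` a \<inter> A \<noteq> {}" using U(1) by blast
qed

lemma in_uminus_image_iff:
  fixes v :: "'a::group_add"
  shows "v \<in> uminus ` s \<longleftrightarrow> - v \<in> s"
  by (metis image_iff minus_minus)

lemma open_image_cone:
  fixes a :: "'a::{real_normed_vector, perfect_space} set"
  assumes "\<And>r z. 0 < r \<Longrightarrow> z \<in> a \<Longrightarrow> r *\<^sub>R z \<in> a" "0 \<notin> a" "open a"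
  shows "open (proj_pt ` a)"
proof -
  have mem: "proj_pt v \<in> proj_pt ` a \<longleftrightarrow> v \<in> a \<or> - v \<in> a" if "v \<noteq> 0" for v
    by (rule image_cone_mem_iff) (use assms that in auto)
  have "{v. v \<noteq> 0 \<and> proj_pt v \<in> proj_pt ` a} = a \<union> uminus ` a"
  proof (rule Set.set_eqI)
    fix v show "v \<in> {v. v \<noteq> 0 \<and> proj_pt v \<in> proj_pt ` a} \<longleftrightarrow> v \<in> a \<union> uminus ` a"
      using assms(2) mem[of v] by (cases "v = 0") (auto simp: in_uminus_image_iff)
  qed
  moreover have "open (uminus ` a)" using open_negations[OF assms(3)] by simp
  ultimately show ?thesis unfolding open_proj_iff using assms(3) by (simp add: open_Un)
qed

text \<open>In the quotient topology a set is closed when the nonzero vectors over its complement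
  form an open set; here these are the nonzero vectors outside \<open>closure a\<close> and its
  negative.\<close>

lemma closure_image_cone:
  fixes a :: "'a::{real_normed_vector, perfect_space} set"
  assumes cone: "\<And>r z. 0 < r \<Longrightarrow> z \<in> a \<Longrightarrow> r *\<^sub>R z \<in> a" and "0 \<notin> a"
  shows "closure (proj_pt ` a) = proj_pt ` (closure a - {0})"
proof
  let ?c = "closure a - {0}"
  have mem: "proj_pt v \<in> proj_pt ` ?c \<longleftrightarrow> v \<in> ?c \<or> - v \<in> ?c" if "v \<noteq> 0" for v
    by (rule image_cone_mem_iff) (use closure_cone[OF cone] that in auto)
  have "{v. v \<noteq> 0 \<and> proj_pt v \<in> - (proj_pt ` ?c)} = - {0} \<inter> - closure a \<inter> - (uminus ` closure a)"
  proof (rule Set.set_eqI)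
    fix v show "v \<in> {v. v \<noteq> 0 \<and> proj_pt v \<in> - (proj_pt ` ?c)} \<longleftrightarrow>
        v \<in> - {0} \<inter> - closure a \<inter> - (uminus ` closure a)"
      using mem[of v] by (cases "v = 0") (auto simp only: mem_Collect_eq Int_iff Compl_iff Diff_iff
          in_uminus_image_iff singleton_iff neg_equal_0_iff_equal simp_thms)
  qed
  moreover have "closed (uminus ` closure a)" using closed_negations[OF closed_closure[of a]] by simp
  ultimately have "closed (proj_pt ` ?c)"
    unfolding closed_def open_proj_iff by (simp add: open_Int open_Compl)
  moreover have "proj_pt ` a \<subseteq> proj_pt ` ?c" using closure_subset[of a] assms(2) by blast
  ultimately show "closure (proj_pt ` a) \<subseteq> proj_pt ` ?c" by (rule closure_minimal[rotated])
  show "proj_pt ` ?c \<subseteq> closure (proj_pt ` a)" using proj_pt_in_closure assms(2) by blast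
qed

lemma closure_cone_over:
  assumes "cone_over a \<Omega>"
  shows "closure \<Omega> = proj_pt ` (closure a - {0})"
proof -
  have a: "open_cone a" "proj_pt ` a = \<Omega>" using assms by (auto simp: cone_over_def)
  have "closure (proj_pt ` a) = proj_pt ` (closure a - {0})"
    by (rule closure_image_cone) (use open_coneD(4)[OF a(1)] zero_notin_open_cone[OF a(1)] in auto)
  then show ?thesis using a(2) by simp
qed

lemma blinfun_eq_inner:
  fixes \<phi> :: "'a::euclidean_space \<Rightarrow>\<^sub>L real"
  shows "\<exists>f. \<forall>v. blinfun_apply \<phi> v = f \<bullet> v"
proof (intro exI allI)
  fix v
  have "linear (blinfun_apply \<phi>)" by (intro bounded_linear.linear blinfun.bounded_linear_right)
  then show "blinfun_apply \<phi> v = adjoint (blinfun_apply \<phi>) 1 \<bullet> v"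
    by (simp add: adjoint_clauses)
qed

lemma blinfun_inner_right_nonzero:
  fixes f :: "'a::euclidean_space"
  assumes "f \<noteq> 0"
  shows "blinfun_inner_right f \<noteq> 0"
proof
  assume "blinfun_inner_right f = 0"
  then have "f \<bullet> f = 0" by (metis blinfun.zero_left blinfun_inner_right.rep_eq)
  then show False using assms by simp
qed

text \<open>The cone over the affine slice \<open>K\<close>. Boundedness of \<open>K\<close> becomes
  the homogeneous bound \<open>norm v \<le> M' * (f \<bullet> v)\<close>, which passes to the
  closure and yields sharpness.\<close>

lemma properly_convex_imp_cone_over:
  assumes "properly_convex \<Omega>" "\<Omega> \<noteq> {}"
  shows "\<exists>a. cone_over a \<Omega>"
proof -
  obtain \<phi> where \<phi>: "\<phi> \<noteq> 0" "\<Omega> \<subseteq> affine_chart \<phi>" "convex (chart_lift \<phi> \<Omega>)" "bounded (chart_lift \<phi> \<Omega>)"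
    and op: "open \<Omega>" using assms(1) by (auto simp: properly_convex_def)
  obtain f where f: "\<And>v. blinfun_apply \<phi> v = f \<bullet> v" using blinfun_eq_inner[of \<phi>] by blast
  define K where "K = chart_lift \<phi> \<Omega>"
  have K: "v \<in> K \<longleftrightarrow> f \<bullet> v = 1 \<and> proj_pt v \<in> \<Omega>" for v by (simp add: K_def chart_lift_def f)
  define a where "a = {v. v \<noteq> 0 \<and> proj_pt v \<in> \<Omega>} \<inter> {v. f \<bullet> v > 0}"
  have scale: "r *\<^sub>R z \<in> a" if "0 < r" "z \<in> a" for r z
    using that by (auto simp: a_def proj_pt_scale)
  have norm_in_K: "(1 / (f \<bullet> v)) *\<^sub>R v \<in> K" if "v \<in> a" for v
    using that unfolding K by (auto simp: a_def proj_pt_scale)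
  obtain M where M: "\<And>v. v \<in> K \<Longrightarrow> norm v \<le> M" using \<phi>(4) by (auto simp: K_def bounded_iff)
  define M' where "M' = max M 1"
  have M': "norm v \<le> M' * (f \<bullet> v)" if "v \<in> a" for v
  proof -
    have "norm ((1 / (f \<bullet> v)) *\<^sub>R v) \<le> M'" using M[OF norm_in_K[OF that]] by (simp add: M'_def)
    moreover have "f \<bullet> v > 0" using that by (simp add: a_def)
    ultimately show ?thesis by (simp add: field_simps)
  qed
  have "open a" unfolding a_def using op open_halfspace_gt[of 0 f] by (simp add: open_proj_iff open_Int)
  moreover have "a \<noteq> {}"
  proof -
    obtain p where p: "p \<in> \<Omega>" using assms by blast
    obtain v where v: "v \<noteq> 0" "p = proj_pt v" by (rule proj_pt_cases)
    then have "f \<bullet> v \<noteq> 0" using \<phi> p f by (auto simp: subset_affine_chart_iff)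
    then have "v \<in> a \<or> - v \<in> a" using v p by (auto simp: a_def proj_pt_uminus)
    then show ?thesis by blast
  qed
  moreover have "convex a"
  proof (rule convexI)
    fix x y and u v :: real
    assume x: "x \<in> a" and y: "y \<in> a" and uv: "0 \<le> u" "0 \<le> v" "u + v = 1"
    have fx: "f \<bullet> x > 0" "f \<bullet> y > 0" using x y by (auto simp: a_def)
    \<comment> \<open>The value of \<open>f\<close> at the combination; dividing by it turns
      \<open>u\<close> and \<open>v\<close> into weights of a convex combination inside the
      slice.\<close>
    define s where "s = u * (f \<bullet> x) + v * (f \<bullet> y)"
    have s: "s > 0"
    proof (cases "u = 0")
      case False
      then show ?thesis unfolding s_def using uv fx by (intro add_pos_nonneg mult_pos_pos) auto
    qed (use uv fx s_def in simp)
    let ?p = "(u * (f \<bullet> x) / s) *\<^sub>R ((1 / (f \<bullet> x)) *\<^sub>R x) + (v * (f \<bullet> y) / s) *\<^sub>R ((1 / (f \<bullet> y)) *\<^sub>R y)"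
    have "?p \<in> K"
      using \<phi>(3)[folded K_def] norm_in_K[OF x] norm_in_K[OF y]
    proof (rule convexD)
      show "u * (f \<bullet> x) / s + v * (f \<bullet> y) / s = 1" using s by (simp add: s_def add_divide_distrib[symmetric])
    qed (use uv fx s in auto)
    moreover have "s *\<^sub>R ?p = u *\<^sub>R x + v *\<^sub>R y" using fx s by (simp add: scaleR_add_right)
    moreover have "?p \<in> a" using \<open>?p \<in> K\<close> unfolding K a_def by auto
    ultimately show "u *\<^sub>R x + v *\<^sub>R y \<in> a" using scale[OF s, of ?p] by simp
  qed
  moreover have "0 < f \<bullet> z" if z: "z \<in> closure a - {0}" for z
  proof -
    have "closure a \<subseteq> {v. norm v \<le> M' * (f \<bullet> v)}"
      by (intro closure_minimal closed_Collect_le continuous_intros) (use M' in auto)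
    then have "norm z \<le> M' * (f \<bullet> z)" using z by blast
    moreover have "0 < norm z" using z by simp
    ultimately have "0 < M' * (f \<bullet> z)" by linarith
    moreover have "0 < M'" by (simp add: M'_def)
    ultimately show ?thesis by (simp add: zero_less_mult_iff)
  qed
  moreover have "proj_pt ` a = \<Omega>"
  proof
    show "proj_pt ` a \<subseteq> \<Omega>" by (auto simp: a_def)
    show "\<Omega> \<subseteq> proj_pt ` a"
    proof
      fix p assume p: "p \<in> \<Omega>"
      obtain v where v: "v \<noteq> 0" "p = proj_pt v" by (rule proj_pt_cases)
      then have "f \<bullet> v \<noteq> 0" using \<phi> p f by (auto simp: subset_affine_chart_iff)
      then have "v \<in> a \<or> - v \<in> a" using v p by (auto simp: a_def proj_pt_uminus)
      then show "p \<in> proj_pt ` a" using v proj_pt_uminus[OF v(1)] by (metis image_eqI)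
    qed
  qed
  ultimately show ?thesis using scale unfolding cone_over_def open_cone_def by blast
qed

lemma cone_over_imp_properly_convex:
  assumes "cone_over a \<Omega>"
  shows "properly_convex \<Omega>"
proof -
  have a: "open_cone a" "proj_pt ` a = \<Omega>" using assms by (auto simp: cone_over_def)
  note aD = open_coneD[OF a(1)] and a0 = zero_notin_open_cone[OF a(1)]
  obtain f where f: "\<And>z. z \<in> closure a - {0} \<Longrightarrow> 0 < f \<bullet> z" using aD(5) by blast
  have fa: "0 < f \<bullet> z" if "z \<in> a" for z by (rule f[OF open_cone_closure[OF a(1) that]])
  have mem: "proj_pt v \<in> \<Omega> \<longleftrightarrow> v \<in> a \<or> - v \<in> a" if "v \<noteq> 0" for v
    by (rule cone_over_mem_iff[OF assms that])
  obtain z where z: "z \<in> a" using aD(2) by blast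
  let ?\<phi> = "blinfun_inner_right f"
  have ap: "blinfun_apply ?\<phi> v = f \<bullet> v" for v by (simp add: blinfun_inner_right.rep_eq)
  have \<phi>: "?\<phi> \<noteq> 0" using fa[OF z] by (intro blinfun_inner_right_nonzero) auto
  have lift: "chart_lift ?\<phi> \<Omega> = a \<inter> {v. f \<bullet> v = 1}"
  proof (intro Set.set_eqI iffI)
    fix v assume v: "v \<in> chart_lift ?\<phi> \<Omega>"
    then have v1: "f \<bullet> v = 1" "proj_pt v \<in> \<Omega>" by (auto simp: chart_lift_def ap)
    then have "v \<noteq> 0" by auto
    moreover have "- v \<notin> a" using fa[of "- v"] v1 by auto
    ultimately show "v \<in> a \<inter> {v. f \<bullet> v = 1}" using mem v1 by auto
  next
    fix v assume v: "v \<in> a \<inter> {v. f \<bullet> v = 1}"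
    then show "v \<in> chart_lift ?\<phi> \<Omega>" using a(2) by (auto simp: chart_lift_def ap)
  qed
  have "\<exists>d>0. \<forall>z\<in>closure a. d * norm z \<le> f \<bullet> z"
    by (rule inner_pos_margin[OF aD(4) f])
  then obtain d where d: "d > 0" "\<And>z. z \<in> closure a \<Longrightarrow> d * norm z \<le> f \<bullet> z" by blast
  have "norm v \<le> 1 / d" if "v \<in> a" "f \<bullet> v = 1" for v
    using d(2)[of v] d(1) that closure_subset[of a] by (auto simp: field_simps)
  then have "bounded (chart_lift ?\<phi> \<Omega>)" unfolding lift bounded_iff by blast
  moreover have "convex (chart_lift ?\<phi> \<Omega>)" unfolding lift
    by (intro convex_Int aD(3) convex_hyperplane)
  moreover have "\<Omega> \<subseteq> affine_chart ?\<phi>"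
    unfolding subset_affine_chart_iff[OF \<phi>] ap
    using mem fa by (metis inner_minus_right less_irrefl neg_equal_0_iff_equal)
  moreover have "open \<Omega>" using open_image_cone[OF aD(4) a0 aD(1)] a(2) by simp
  ultimately show ?thesis using \<phi> unfolding properly_convex_def by blast
qed

text \<open>A functional whose hyperplane misses the closure of \<open>A\<close> cannot change sign
  on \<open>a\<close>: a positive combination of two points with values of opposite sign would be a
  zero in \<open>a\<close>.\<close>

lemma dual_domain_pos:
  assumes "cone_over a A" "p \<in> a" "0 < f \<bullet> p" "proj_pt (blinfun_inner_right f) \<in> dual_domain A"
    "z \<in> closure a - {0}"
  shows "0 < f \<bullet> z"
proof -
  let ?\<phi> = "blinfun_inner_right f"
  have ap: "blinfun_apply ?\<phi> v = f \<bullet> v" for v by (simp add: blinfun_inner_right.rep_eq)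
  have \<phi>: "?\<phi> \<noteq> 0" using assms(3) by (intro blinfun_inner_right_nonzero) auto
  have oc: "open_cone a" by (rule cone_over_open_cone[OF assms(1)])
  have nz: "f \<bullet> v \<noteq> 0" if "v \<in> closure a - {0}" for v
  proof -
    have "proj_pt v \<in> closure A" using that closure_cone_over[OF assms(1)] by blast
    then have "proj_pt v \<notin> proj_hyperplane (proj_pt ?\<phi>)" using assms(4) by (auto simp: dual_domain_def)
    then show ?thesis using hyperplane_iff[OF \<phi>, of v] that ap by auto
  qed
  have pos: "0 < f \<bullet> q" if q: "q \<in> a" for q
  proof (rule ccontr)
    assume "\<not> 0 < f \<bullet> q"
    then have fq: "f \<bullet> q < 0" using nz[OF open_cone_closure[OF oc q]] by linarith
    have "(f \<bullet> p) *\<^sub>R q + (- (f \<bullet> q)) *\<^sub>R p \<in> a"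
      using fq assms(2,3) q by (intro open_cone_add oc open_coneD(4)[OF oc]) auto
    then have "f \<bullet> ((f \<bullet> p) *\<^sub>R q + (- (f \<bullet> q)) *\<^sub>R p) \<noteq> 0" by (intro nz open_cone_closure oc)
    then show False by (simp add: inner_add_right inner_diff_right)
  qed
  have "0 \<le> f \<bullet> z" by (rule inner_nonneg_closure[of a f]) (use pos assms(5) in \<open>auto simp: less_imp_le\<close>)
  then show ?thesis using nz[OF assms(5)] by linarith
qed

text \<open>A functional that is merely nonnegative on \<open>b\<close> is a limit of functionals
  \<open>f + t h\<close> with \<open>h\<close> positive on the closed cone, so it represents a point
  of \<open>closure (dual_domain B)\<close>. Points of \<open>a \<inter> b\<close> and
  \<open>b \<inter> c\<close> then fix its sign on \<open>a\<close> and on \<open>c\<close>.\<close>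

lemma occultation_imp_cone_occultation:
  assumes a: "cone_over a A" and b: "cone_over b B" and c: "cone_over c C"
    and occ: "occultation_position A B C" and ab: "a \<inter> b \<noteq> {}" and bc: "b \<inter> c \<noteq> {}"
  shows "cone_occultation a b c"
proof -
  have oc: "open_cone a" "open_cone b" "open_cone c" using a b c by (auto simp: cone_over_def)
  have im: "proj_pt ` a = A" "proj_pt ` b = B" "proj_pt ` c = C" using a b c by (auto simp: cone_over_def)
  have O: "\<not> A \<subseteq> B" "\<not> C \<subseteq> B" "A \<inter> C = {}" "closure (dual_domain B) \<subseteq> dual_domain A \<union> dual_domain C"
    using occ by (auto simp: occultation_position_def)
  have "occults (closure a - {0}) b (closure c - {0})"
    unfolding occults_def
  proof (intro allI impI)
    fix f assume f: "f \<noteq> 0" "\<forall>z\<in>b. 0 \<le> f \<bullet> z"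
    let ?\<phi> = "\<lambda>f :: 'a. blinfun_inner_right f"
    have ap: "blinfun_apply (?\<phi> f) v = f \<bullet> v" for v f by (simp add: blinfun_inner_right.rep_eq)
    have \<phi>0: "?\<phi> f \<noteq> 0" by (rule blinfun_inner_right_nonzero[OF f(1)])
    have "proj_pt (?\<phi> f) \<in> closure (dual_domain B)"
      unfolding closure_iff_nhds_not_empty
    proof (intro allI impI)
      fix A' U :: "('a \<Rightarrow>\<^sub>L real) proj set" assume U: "U \<subseteq> A'" "open U" "proj_pt (?\<phi> f) \<in> U"
      have "open {v. v \<noteq> 0 \<and> proj_pt v \<in> U}" using U(2) by (simp add: open_proj_iff)
      then obtain e where e: "e > 0" "ball (?\<phi> f) e \<subseteq> {v. v \<noteq> 0 \<and> proj_pt v \<in> U}"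
        using U(3) \<phi>0 open_contains_ball by (metis (mono_tags, lifting) mem_Collect_eq)
      obtain h where h: "\<forall>z\<in>closure b - {0}. 0 < h \<bullet> z" using open_coneD(5)[OF oc(2)] by blast
      define t where "t = e / (2 * (norm (?\<phi> h) + 1))"
      have t: "t > 0" using e by (simp add: t_def add_nonneg_pos)
      have eq: "?\<phi> (f + t *\<^sub>R h) = ?\<phi> f + t *\<^sub>R ?\<phi> h"
        by (intro blinfun_eqI) (simp add: ap blinfun.bilinear_simps inner_add_left)
      have "t * norm (?\<phi> h) \<le> e / 2" using e by (simp add: t_def divide_simps add_nonneg_pos)
      then have "?\<phi> (f + t *\<^sub>R h) \<in> ball (?\<phi> f) e" unfolding eq using t e by (simp add: dist_norm)
      then have in_U: "?\<phi> (f + t *\<^sub>R h) \<noteq> 0" "proj_pt (?\<phi> (f + t *\<^sub>R h)) \<in> U" using subsetD[OF e(2)] by blast+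
      have "proj_pt v \<notin> proj_hyperplane (proj_pt (?\<phi> (f + t *\<^sub>R h)))" if v: "v \<in> closure b - {0}" for v
      proof -
        have "0 \<le> f \<bullet> v" by (rule inner_nonneg_closure[of b f]) (use f v in auto)
        moreover have "0 < t * (h \<bullet> v)" using t h v by simp
        ultimately have "(f + t *\<^sub>R h) \<bullet> v \<noteq> 0" by (simp add: inner_add_left)
        then show ?thesis using hyperplane_iff[OF in_U(1), of v] v ap by auto
      qed
      then have "proj_pt (?\<phi> (f + t *\<^sub>R h)) \<in> dual_domain B"
        unfolding dual_domain_def closure_cone_over[OF b] by blast
      then show "dual_domain B \<inter> A' \<noteq> {}" using in_U U by blast
    qed
    then have or: "proj_pt (?\<phi> f) \<in> dual_domain A \<or> proj_pt (?\<phi> f) \<in> dual_domain C" using O(4) by blast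
    have fb: "0 < f \<bullet> z" if "z \<in> b" for z
      by (rule inner_pos_on_open[OF open_coneD(1)[OF oc(2)] f(1) _ that]) (use f in blast)
    obtain p q where p: "p \<in> a" "p \<in> b" and q: "q \<in> c" "q \<in> b" using ab bc by blast
    show "(\<forall>z\<in>closure a - {0}. 0 < f \<bullet> z) \<or> (\<forall>z\<in>closure c - {0}. 0 < f \<bullet> z)"
      using or dual_domain_pos[OF a p(1) fb[OF p(2)]] dual_domain_pos[OF c q(1) fb[OF q(2)]] by blast
  qed
  moreover have "a \<inter> c = {}" using O(3) im by blast
  moreover have "a \<inter> uminus ` c = {}"
  proof (rule ccontr)
    assume "a \<inter> uminus ` c \<noteq> {}"
    then obtain z where z: "z \<in> c" "- z \<in> a" by auto
    then have "z \<noteq> 0" using zero_notin_open_cone[OF oc(3)] by auto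
    then have "proj_pt z \<in> A" using z(2) im(1) proj_pt_uminus by (metis image_eqI)
    then show False using z(1) im(3) O(3) by blast
  qed
  moreover have "\<not> a \<subseteq> b" "\<not> c \<subseteq> b" using O(1,2) im by blast+
  ultimately show ?thesis using oc ab bc unfolding cone_occultation_def by blast
qed

text \<open>The existential quantifier hides the signs, which makes the relation symmetric and
  invariant under \<open>pgl_act\<close>; \<open>proj_occultation_cones\<close> recovers lifts with
  either prescribed sign of the first cone.\<close>

definition proj_occultation :: "'a::euclidean_space proj set \<Rightarrow> 'a proj set \<Rightarrow> 'a proj set \<Rightarrow> bool"
  where "proj_occultation A B C \<longleftrightarrow>
    (\<exists>a b c. cone_over a A \<and> cone_over b B \<and> cone_over c C \<and> cone_occultation a b c)"

lemma cone_over_meeting: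
  assumes "cone_over b B" "cone_over c C" "B \<inter> C \<noteq> {}"
  shows "\<exists>c'. cone_over c' C \<and> b \<inter> c' \<noteq> {}"
proof -
  obtain z where z: "z \<in> b" "proj_pt z \<in> C" using assms by (auto simp: cone_over_def)
  then have "z \<noteq> 0" using zero_notin_open_cone[OF cone_over_open_cone[OF assms(1)]] by auto
  then have "z \<in> c \<or> - z \<in> c" using cone_over_mem_iff[OF assms(2)] z(2) by blast
  then show ?thesis
  proof
    assume "z \<in> c"
    then show ?thesis using assms(2) z(1) by blast
  next
    assume "- z \<in> c"
    then have "z \<in> uminus ` c" by (simp add: in_uminus_image_iff)
    then show ?thesis using cone_over_uminus[OF assms(2)] z(1) by blast
  qed
qed

lemma occultation_imp_proj_occultation:
  assumes "cone_over a A" "cone_over b B" "cone_over c C" "occultation_position A B C"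
  shows "proj_occultation A B C"
proof -
  have i: "B \<inter> A \<noteq> {}" "B \<inter> C \<noteq> {}" using assms(4) by (auto simp: occultation_position_def)
  obtain a' where a': "cone_over a' A" "b \<inter> a' \<noteq> {}" using cone_over_meeting[OF assms(2,1) i(1)] by blast
  obtain c' where c': "cone_over c' C" "b \<inter> c' \<noteq> {}" using cone_over_meeting[OF assms(2,3) i(2)] by blast
  have "cone_occultation a' b c'"
    by (rule occultation_imp_cone_occultation[OF a'(1) assms(2) c'(1) assms(4)]) (use a' c' in auto)
  then show ?thesis using a' c' assms(2) unfolding proj_occultation_def by blast
qed

lemma proj_occultation_commute: "proj_occultation A B C \<Longrightarrow> proj_occultation C B A"
  unfolding proj_occultation_def using cone_occultation_commute by blast

lemma proj_occultation_act:
  assumes "proj_occultation A B C"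
  shows "proj_occultation (pgl_act g ` A) (pgl_act g ` B) (pgl_act g ` C)"
proof -
  obtain F where F: "bij (blinfun_apply F)" "g = pgl_class F" by (rule pgl_class_cases)
  have lin: "linear (blinfun_apply F)" by (intro bounded_linear.linear blinfun.bounded_linear_right)
  obtain a b c where "cone_over a A" "cone_over b B" "cone_over c C" "cone_occultation a b c"
    using assms unfolding proj_occultation_def by blast
  then show ?thesis
    unfolding proj_occultation_def F(2)
    using cone_over_linear_image[OF _ F(1)] cone_occultation_linear_image[OF lin F(1)] by blast
qed

lemma proj_occultation_cones:
  assumes occ: "proj_occultation A B C" and "cone_over a A"
  shows "\<exists>b c. cone_over b B \<and> cone_over c C \<and> cone_occultation a b c"
proof -
  obtain a' b c where *: "cone_over a' A" "cone_over b B" "cone_over c C" "cone_occultation a' b c"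
    using occ unfolding proj_occultation_def by blast
  from cone_over_unique[OF *(1) assms(2)] show ?thesis
  proof
    assume "a = a'"
    then show ?thesis using * by blast
  next
    assume "a = uminus ` a'"
    then show ?thesis
      using cone_occultation_linear_image[OF linear_uminus bij_uminus *(4)]
        cone_over_uminus[OF *(2)] cone_over_uminus[OF *(3)] by blast
  qed
qed

section \<open>Paths of projective domains and their lifts\<close>

fun proj_path :: "'a::euclidean_space proj set list \<Rightarrow> bool"
  where
    "proj_path (A # B # C # p) \<longleftrightarrow> proj_occultation A B C \<and> proj_path (B # C # p)"
  | "proj_path [A, B] \<longleftrightarrow> (\<exists>a b. cone_over a A \<and> cone_over b B \<and> a \<inter> b \<noteq> {} \<and> a \<inter> uminus ` b = {})"
  | "proj_path _ \<longleftrightarrow> False"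

text \<open>The first triple gives \<open>b\<close> and \<open>c\<close>, and the rest of the path
  is lifted from \<open>b\<close>. The second cone \<open>c'\<close> of that lift must be
  \<open>c\<close>, since both lie over the same set, \<open>c'\<close> meets \<open>b\<close>, and
  \<open>-c\<close> does not.\<close>

lemma proj_path_lift:
  assumes "proj_path (A # p)" "cone_over a A"
  shows "\<exists>q. cone_path (a # q) \<and> list_all2 cone_over q p"
  using assms
proof (induction "A # p" arbitrary: A a p rule: proj_path.induct)
  case (1 A B C p)
  obtain b c where bc: "cone_over b B" "cone_over c C" "cone_occultation a b c"
    using proj_occultation_cones 1(2,3) by (metis proj_path.simps(1))
  obtain q where q: "cone_path (b # q)" "list_all2 cone_over q (C # p)"
    using 1(1)[OF _ bc(1)] 1(2) by auto
  then obtain c' q' where q': "q = c' # q'" "cone_over c' C" "list_all2 cone_over q' p"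
    by (auto simp: list_all2_Cons2)
  have "b \<inter> c' \<noteq> {}" using q(1) unfolding q'(1) by (cases q') (auto dest: cone_occultationD(6))
  moreover have "b \<inter> uminus ` c = {}"
    using cone_occultation_not_opposite[OF cone_occultation_commute[OF bc(3)]] Int_uminus_empty_commute by metis
  ultimately have "c' = c" by (rule cone_over_unique_meet[OF bc(2) q'(2)])
  then have "cone_path (a # b # c # q')" using q(1) q'(1) bc(3) by simp
  then show ?case using bc q' by (intro exI[of _ "b # c # q'"]) simp
next
  case (2 A B)
  then obtain a' b where b: "cone_over a' A" "cone_over b B" "a' \<inter> b \<noteq> {}" "a' \<inter> uminus ` b = {}" by auto
  have oc: "open_cone a" "open_cone b" using 2(2) b(2) by (auto simp: cone_over_def)
  from cone_over_unique[OF b(1) 2(2)] show ?case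
  proof
    assume "a = a'"
    then show ?thesis using b oc by (intro exI[of _ "[b]"]) simp
  next
    assume a: "a = uminus ` a'"
    have i: "uminus ` s \<inter> uminus ` s' = uminus ` (s \<inter> s')" for s s' :: "'a set" by auto
    have "a \<inter> uminus ` b \<noteq> {}" using b(3) unfolding a i by simp
    moreover have "a \<inter> uminus ` uminus ` b = {}" using b(4) unfolding a i by simp
    moreover have "cone_over (uminus ` b) B" by (rule cone_over_uminus[OF b(2)])
    ultimately show ?thesis using oc by (intro exI[of _ "[uminus ` b]"]) (simp add: cone_over_open_cone)
  qed
qed auto

lemma proj_path_cone_over:
  assumes "proj_path p" "A \<in> set p"
  shows "\<exists>a. cone_over a A"
  using assms by (induction p rule: proj_path.induct) (auto simp: proj_occultation_def)

lemma proj_path_disjoint_ends: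
  fixes A :: "'a::euclidean_space proj set"
  assumes dim: "DIM('a) \<ge> 3" and p: "proj_path (A # B # C # p)"
  shows "A \<inter> last (C # p) = {}"
proof -
  obtain a where a: "cone_over a A" using proj_path_cone_over[OF p] by auto
  obtain q where q: "cone_path (a # q)" "list_all2 cone_over q (B # C # p)"
    using proj_path_lift[OF p a] by blast
  then obtain b c r where r: "q = b # c # r" by (auto simp: list_all2_Cons2)
  have disj: "a \<inter> last (c # r) = {}" "a \<inter> uminus ` last (c # r) = {}"
    using cone_path_disjoint_ends[OF dim] q(1) unfolding r by blast+
  have "list_all2 cone_over (c # r) (C # p)" using q(2) r by simp
  then have l: "cone_over (last (c # r)) (last (C # p))"
    by (metis last_conv_nth length_greater_0_conv list.discI list_all2_conv_all_nth diff_less zero_less_one)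
  show ?thesis
  proof (rule ccontr)
    assume "A \<inter> last (C # p) \<noteq> {}"
    then obtain z where z: "z \<in> a" "proj_pt z \<in> last (C # p)" using a unfolding cone_over_def by blast
    then have "z \<noteq> 0" using zero_notin_open_cone[OF cone_over_open_cone[OF a]] by auto
    then have "z \<in> last (c # r) \<or> z \<in> uminus ` last (c # r)"
      using cone_over_mem_iff[OF l] z(2) by (simp add: in_uminus_image_iff)
    then show False using disj z(1) by blast
  qed
qed

section \<open>Convex hulls of two overlapping domains\<close>

lemma open_gen:
  fixes S :: "'a::real_normed_vector set"
  assumes "open S"
  shows "open (gen S)"
  unfolding open_contains_ball
proof
  fix x assume "x \<in> gen S"
  then show "\<exists>e>0. ball x e \<subseteq> gen S"
  proof induction
    case (gen_base x)
    then obtain e where "e > 0" "ball x e \<subseteq> S" using assms open_contains_ball by blast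
    then show ?case by (meson gen.gen_base subset_iff)
  next
    case (gen_add x y)
    obtain e where e: "e > 0" "ball x e \<subseteq> S" using gen_add(1) assms open_contains_ball by blast
    have "w \<in> gen S" if "w \<in> ball (x + y) e" for w
    proof -
      have "dist x (w - y) = dist (x + y) w" by (simp add: dist_norm algebra_simps)
      then have "w - y \<in> S" using e that by auto
      from gen.gen_add[OF this gen_add(2)] show ?thesis by simp
    qed
    then show ?case using e by blast
  qed
qed

lemma inner_pos_gen:
  assumes "\<And>z. z \<in> S \<Longrightarrow> 0 < f \<bullet> z" "z \<in> gen S"
  shows "0 < f \<bullet> z"
  using assms(2) by induction (auto simp: inner_add_right assms(1) add_pos_pos)

lemma convex_gen:
  assumes "\<And>r z. 0 < r \<Longrightarrow> z \<in> S \<Longrightarrow> r *\<^sub>R z \<in> S"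
  shows "convex (gen S)"
proof (rule convexI)
  fix x y and u v :: real
  assume x: "x \<in> gen S" "y \<in> gen S" and uv: "0 \<le> u" "0 \<le> v" "u + v = 1"
  have sc: "r *\<^sub>R z \<in> gen S" if "0 < r" "z \<in> gen S" for r z
    using gen_scale[of S r S z] assms that by blast
  show "u *\<^sub>R x + v *\<^sub>R y \<in> gen S"
  proof (cases "u = 0 \<or> v = 0")
    case True
    then show ?thesis using x uv by auto
  next
    case False
    then show ?thesis using x uv sc by (intro gen_closed_add) auto
  qed
qed

lemma image_proj_pt_uminus:
  fixes S :: "'a::{real_normed_vector, perfect_space} set"
  assumes "0 \<notin> S"
  shows "proj_pt ` uminus ` S = proj_pt ` S"
proof -
  have "proj_pt (- z) = proj_pt z" if "z \<in> S" for z using that assms by (intro proj_pt_uminus) auto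
  then show ?thesis by (simp add: image_image)
qed

text \<open>Scaling \<open>z\<close> by \<open>1 / (f \<bullet> z)\<close> moves it into the slice
  of the chart and turns a sum into a convex combination whose weights are proportional to the
  values of \<open>f\<close>.\<close>

lemma chart_hull_pos:
  fixes a b :: "'a::euclidean_space set"
  assumes a: "cone_over a A" and b: "cone_over b B"
    and f: "\<And>v. blinfun_apply \<phi> v = f \<bullet> v" "\<And>z. z \<in> a \<union> b \<Longrightarrow> 0 < f \<bullet> z"
  shows "chart_hull \<phi> (A \<union> B) = proj_pt ` gen (a \<union> b)"
proof -
  have sc: "r *\<^sub>R z \<in> a \<union> b" if "0 < r" "z \<in> a \<union> b" for r z
    using that open_coneD(4)[OF cone_over_open_cone[OF a]] open_coneD(4)[OF cone_over_open_cone[OF b]] by blast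
  define S where "S = (a \<union> b) \<inter> {v. f \<bullet> v = 1}"
  have "chart_lift \<phi> (A \<union> B) = S"
  proof (rule Set.set_eqI)
    fix v
    have "proj_pt v \<in> A \<union> B \<longleftrightarrow> v \<in> a \<union> b" if v: "f \<bullet> v = 1"
    proof -
      have v0: "v \<noteq> 0" using v by auto
      have "- v \<notin> a \<union> b" using f(2)[of "- v"] v by auto
      then show ?thesis using cone_over_mem_iff[OF a v0] cone_over_mem_iff[OF b v0] by blast
    qed
    then show "v \<in> chart_lift \<phi> (A \<union> B) \<longleftrightarrow> v \<in> S" by (auto simp: chart_lift_def S_def f(1))
  qed
  moreover have "convex hull S \<subseteq> gen (a \<union> b)"
    using convex_gen[OF sc] by (intro hull_minimal) (auto simp: S_def intro: gen.gen_base)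
  moreover have "(1 / (f \<bullet> z)) *\<^sub>R z \<in> convex hull S" if "z \<in> gen (a \<union> b)" for z
    using that
  proof induction
    case (gen_base x)
    then have "0 < f \<bullet> x" by (rule f(2))
    then have "(1 / (f \<bullet> x)) *\<^sub>R x \<in> S" unfolding S_def using sc[OF _ gen_base] by simp
    then show ?case by (rule hull_inc)
  next
    case (gen_add x y)
    have fx: "0 < f \<bullet> x" using gen_add(1) by (rule f(2))
    have fy: "0 < f \<bullet> y" using inner_pos_gen[OF f(2) gen_add(2)] .
    have "(1 / (f \<bullet> x)) *\<^sub>R x \<in> S" unfolding S_def using fx sc[OF _ gen_add(1)] by simp
    then have x: "(1 / (f \<bullet> x)) *\<^sub>R x \<in> convex hull S" by (rule hull_inc)
    have "(f \<bullet> x / (f \<bullet> (x + y))) *\<^sub>R ((1 / (f \<bullet> x)) *\<^sub>R x) + (f \<bullet> y / (f \<bullet> (x + y))) *\<^sub>R ((1 / (f \<bullet> y)) *\<^sub>R y)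
        \<in> convex hull S"
      using fx fy by (intro convexD[OF convex_convex_hull x gen_add.IH])
        (auto simp: inner_add_right add_divide_distrib[symmetric])
    then show ?case using fx fy by (simp add: scaleR_add_right)
  qed
  then have "proj_pt ` gen (a \<union> b) \<subseteq> proj_pt ` (convex hull S)"
  proof -
    assume H: "\<And>z. z \<in> gen (a \<union> b) \<Longrightarrow> (1 / (f \<bullet> z)) *\<^sub>R z \<in> convex hull S"
    have "proj_pt z \<in> proj_pt ` (convex hull S)" if z: "z \<in> gen (a \<union> b)" for z
    proof -
      have "0 < f \<bullet> z" by (rule inner_pos_gen[OF f(2) z])
      then have "proj_pt ((1 / (f \<bullet> z)) *\<^sub>R z) = proj_pt z" by (intro proj_pt_scale) auto
      then show ?thesis using H[OF z] by (metis image_eqI)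
    qed
    then show ?thesis by blast
  qed
  ultimately show ?thesis unfolding chart_hull_def by auto
qed

text \<open>The right-hand side does not mention \<open>\<phi>\<close>, so the hull is independent
  of the chart. A functional vanishing nowhere on the connected set \<open>a \<union> b\<close> has
  constant sign there, and a negative sign is absorbed by passing to the opposite cones.\<close>

lemma chart_hull_eq:
  fixes a b :: "'a::euclidean_space set"
  assumes a: "cone_over a A" and b: "cone_over b B" and ab: "a \<inter> b \<noteq> {}"
    and \<phi>: "\<phi> \<noteq> 0" "A \<union> B \<subseteq> affine_chart \<phi>"
  shows "chart_hull \<phi> (A \<union> B) = proj_pt ` gen (a \<union> b)"
proof -
  obtain f where f: "\<And>v. blinfun_apply \<phi> v = f \<bullet> v" using blinfun_eq_inner by blast
  have oc: "open_cone a" "open_cone b" using a b by (auto simp: cone_over_def)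
  have z0: "0 \<notin> a \<union> b" using zero_notin_open_cone oc by blast
  have nz: "f \<bullet> v \<noteq> 0" if "v \<in> a \<union> b" for v
  proof -
    have "v \<noteq> 0" using z0 that by auto
    moreover have "proj_pt v \<in> A \<union> B" using that a b by (auto simp: cone_over_def)
    ultimately show ?thesis using \<phi> f subset_affine_chart_iff[OF \<phi>(1)] by auto
  qed
  have "connected (a \<union> b)" using open_coneD(3) oc by (intro connected_Un convex_connected ab)
  from nonvanishing_on_connected[OF this nz]
  consider "\<And>z. z \<in> a \<union> b \<Longrightarrow> 0 < f \<bullet> z" | "\<And>z. z \<in> a \<union> b \<Longrightarrow> f \<bullet> z < 0"
    by blast
  then show ?thesis
  proof cases
    case 1
    then show ?thesis using chart_hull_pos[OF a b f] by blast
  next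
    case 2
    have "chart_hull \<phi> (A \<union> B) = proj_pt ` gen (uminus ` a \<union> uminus ` b)"
      using 2 by (intro chart_hull_pos[OF cone_over_uminus[OF a] cone_over_uminus[OF b] f]) auto
    also have "gen (uminus ` a \<union> uminus ` b) = uminus ` gen (a \<union> b)"
    proof -
      have s: "- z \<in> gen (uminus ` S)" if "z \<in> gen S" for z :: 'a and S
        using gen_scale[of S "-1" "uminus ` S" z] that by simp
      have "uminus ` a \<union> uminus ` b = uminus ` (a \<union> b)" "uminus ` uminus ` (a \<union> b) = a \<union> b"
        by (auto simp: image_image image_Un)
      then show ?thesis
        using s[of _ "a \<union> b"] s[of _ "uminus ` (a \<union> b)"]
        by (intro equalityI subsetI) (simp_all add: in_uminus_image_iff, force)
    qed
    also have "proj_pt ` uminus ` gen (a \<union> b) = proj_pt ` gen (a \<union> b)"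
    proof (rule image_proj_pt_uminus)
      have "0 < - f \<bullet> z" if "z \<in> gen (a \<union> b)" for z
        by (rule inner_pos_gen[OF _ that]) (use 2 in simp)
      then show "0 \<notin> gen (a \<union> b)" by force
    qed
    finally show ?thesis .
  qed
qed

lemma connected_cone_image:
  fixes a :: "'a::euclidean_space set"
  assumes "cone_over a A"
  shows "connected A"
proof -
  have a: "open_cone a" "proj_pt ` a = A" using assms by (auto simp: cone_over_def)
  have "continuous_on a (proj_pt :: 'a \<Rightarrow> _)"
    unfolding continuous_on_open_vimage[OF open_coneD(1)[OF a(1)]]
  proof (intro allI impI)
    fix B :: "'a proj set" assume "open B"
    then have "open ({v. v \<noteq> 0 \<and> proj_pt v \<in> B} \<inter> a)"
      using open_coneD(1)[OF a(1)] by (intro open_Int) (simp_all add: open_proj_iff)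
    moreover have "{v. v \<noteq> 0 \<and> proj_pt v \<in> B} \<inter> a = proj_pt -` B \<inter> a"
      using zero_notin_open_cone[OF a(1)] by auto
    ultimately show "open (proj_pt -` B \<inter> a)" by simp
  qed
  then show ?thesis using connected_continuous_image convex_connected[OF open_coneD(3)[OF a(1)]] a(2) by metis
qed

lemma proj_hull_cones:
  fixes a b :: "'a::euclidean_space set"
  assumes a: "cone_over a A" and b: "cone_over b B" and ab: "a \<inter> b \<noteq> {}"
    and \<phi>: "\<phi> \<noteq> 0" "A \<union> B \<subseteq> affine_chart \<phi>"
  shows "proj_hull_well_defined (A \<union> B) \<and> proj_hull (A \<union> B) = proj_pt ` gen (a \<union> b)"
proof
  have "A \<inter> B \<noteq> {}" using a b ab by (auto simp: cone_over_def)
  then have "connected (A \<union> B)" using connected_cone_image a b by (intro connected_Un) auto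
  then show "proj_hull_well_defined (A \<union> B)"
    unfolding proj_hull_well_defined_def using chart_hull_eq[OF a b ab] \<phi> by metis
  show "proj_hull (A \<union> B) = proj_pt ` gen (a \<union> b)"
    unfolding proj_hull_def
    by (rule the_equality) (use chart_hull_eq[OF a b ab] \<phi> in metis)+
qed

section \<open>Normal forms in HNN extensions\<close>

abbreviation stable_letter :: "bool \<Rightarrow> 'g hnn_letter"
  where "stable_letter e \<equiv> (if e then Stable else Stable_inv)"

fun nf_word :: "('g \<times> bool) list \<Rightarrow> 'g \<Rightarrow> 'g hnn_letter list"
  where
    "nf_word [] g = [Base g]"
  | "nf_word ((h, e) # L) g = Base h # stable_letter e # nf_word L g"

text \<open>Britton's condition: no pinch \<open>t a t^-1\<close> with \<open>a\<close> in
  \<open>A\<close>, and no \<open>t^-1 b t\<close> with \<open>b\<close> in the image of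
  \<open>A\<close>. The first base element is unconstrained, as it does not stand between stable
  letters.\<close>

fun hnn_reduced :: "'g set \<Rightarrow> ('g \<Rightarrow> 'g) \<Rightarrow> ('g \<times> bool) list \<Rightarrow> bool"
  where
    "hnn_reduced A \<theta> ((h1, e1) # (h2, e2) # L) \<longleftrightarrow>
      (e1 \<and> \<not> e2 \<longrightarrow> h2 \<notin> A) \<and> (\<not> e1 \<and> e2 \<longrightarrow> h2 \<notin> \<theta> ` A) \<and> hnn_reduced A \<theta> ((h2, e2) # L)"
  | "hnn_reduced A \<theta> _ \<longleftrightarrow> True"

lemma hnn_reduced_tl: "hnn_reduced A \<theta> (x # L) \<Longrightarrow> hnn_reduced A \<theta> L"
  by (cases x; cases L) auto

lemma hnn_reduced_change_hd: "hnn_reduced A \<theta> ((h, e) # L) \<Longrightarrow> hnn_reduced A \<theta> ((h', e) # L)"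
  by (cases L) auto

lemma nf_word_in_words:
  assumes "fst ` set L \<subseteq> carrier G" "g \<in> carrier G"
  shows "nf_word L g \<in> hnn_words G"
  using assms by (induction L g rule: nf_word.induct) (auto simp: hnn_words_def)

text \<open>Prepend letters one at a time. A base letter is absorbed by the first base element; a
  stable letter either opens a new syllable with trivial base element or pinches with the first
  syllable, which a relation then removes. Telling group elements apart is left to their action on
  the domains.\<close>

lemma hnn_normal_form:
  assumes G: "group G" and A: "A \<subseteq> carrier G" "\<theta> ` A \<subseteq> carrier G" and w: "w \<in> hnn_words G"
  shows "\<exists>L g. fst ` set L \<subseteq> carrier G \<and> g \<in> carrier G \<and> hnn_reduced A \<theta> L \<and>
    hnn_eq G A \<theta> w (nf_word L g)"
  using w
proof (induction w)
  case Nil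
  interpret group G by fact
  have "hnn_eq G A \<theta> [] (nf_word [] \<one>\<^bsub>G\<^esub>)" by (simp add: hnn_eq.sym[OF hnn_eq.one])
  then show ?case by (intro exI[of _ "[]"] exI[of _ "\<one>\<^bsub>G\<^esub>"]) simp
next
  case (Cons l w)
  interpret group G by fact
  define good where "good L g \<longleftrightarrow> fst ` set L \<subseteq> carrier G \<and> g \<in> carrier G \<and> hnn_reduced A \<theta> L" for L g
  have l: "[l] \<in> hnn_words G" and "w \<in> hnn_words G" using Cons.prems by (auto simp: hnn_words_def)
  then obtain L g where L: "good L g" and wL: "hnn_eq G A \<theta> w (nf_word L g)"
    using Cons.IH unfolding good_def by blast
  have gw: "nf_word L g \<in> hnn_words G" if "good L g" for L g
    using that by (intro nf_word_in_words) (auto simp: good_def)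
  have left: "hnn_eq G A \<theta> (u @ v) (u' @ v)" if "hnn_eq G A \<theta> u u'" "v \<in> hnn_words G" for u u' v
    by (rule hnn_eq.append[OF that(1) hnn_eq.refl[OF that(2)]])
  have base: "\<exists>L' g'. good L' g' \<and> hnn_eq G A \<theta> (Base h # nf_word L g) (nf_word L' g')"
    if h: "h \<in> carrier G" and L: "good L g" for h L g
  proof (cases L)
    case Nil
    then show ?thesis using hnn_eq.mult[OF h, of g A \<theta>] h L
      by (intro exI[of _ "[]"] exI[of _ "h \<otimes>\<^bsub>G\<^esub> g"]) (auto simp: good_def)
  next
    case (Cons x L2)
    obtain k e where x: "x = (k, e)" by (cases x)
    have k: "k \<in> carrier G" using L Cons x by (auto simp: good_def)
    have "stable_letter e # nf_word L2 g \<in> hnn_words G"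
      using gw[OF L] unfolding Cons x by (auto simp: hnn_words_def)
    from left[OF hnn_eq.mult[OF h k] this]
    have "hnn_eq G A \<theta> (Base h # nf_word L g) (nf_word ((h \<otimes>\<^bsub>G\<^esub> k, e) # L2) g)"
      unfolding Cons x by simp
    moreover have "good ((h \<otimes>\<^bsub>G\<^esub> k, e) # L2) g"
      using L h k hnn_reduced_change_hd[of A \<theta> k e L2 "h \<otimes>\<^bsub>G\<^esub> k"] unfolding Cons x good_def by auto
    ultimately show ?thesis by blast
  qed
  have ext: "\<exists>L' g'. good L' g' \<and> hnn_eq G A \<theta> (stable_letter e # nf_word L g) (nf_word L' g')"
    if red: "hnn_reduced A \<theta> ((\<one>\<^bsub>G\<^esub>, e) # L)" for e
  proof -
    have "stable_letter e # nf_word L g \<in> hnn_words G" using gw[OF L] by (auto simp: hnn_words_def)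
    from left[OF hnn_eq.sym[OF hnn_eq.one] this]
    have "hnn_eq G A \<theta> (stable_letter e # nf_word L g) (nf_word ((\<one>\<^bsub>G\<^esub>, e) # L) g)" by simp
    moreover have "good ((\<one>\<^bsub>G\<^esub>, e) # L) g" using red L by (auto simp: good_def)
    ultimately show ?thesis by blast
  qed
  \<comment> \<open>The defining relation read backwards, for pinches that start with the inverse
    stable letter.\<close>
  have conj': "hnn_eq G A \<theta> [Stable_inv, Base (\<theta> a), Stable] [Base a]" if a: "a \<in> A" for a
  proof -
    have aG: "a \<in> carrier G" using a A by auto
    have s: "[Stable] \<in> hnn_words G" "[Stable_inv] \<in> hnn_words G" "[Base a, Stable_inv, Stable] \<in> hnn_words G"
      "[Base a] \<in> hnn_words G" using aG by (auto simp: hnn_words_def)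
    have "hnn_eq G A \<theta> ([Stable_inv] @ [Base (\<theta> a)] @ [Stable]) ([Stable_inv] @ [Stable, Base a, Stable_inv] @ [Stable])"
      by (intro hnn_eq.append hnn_eq.refl s hnn_eq.sym[OF hnn_eq.conj[OF a]])
    also have "[Stable_inv] @ [Stable, Base a, Stable_inv] @ [Stable] = [Stable_inv, Stable] @ [Base a, Stable_inv, Stable]"
      by simp
    finally have 1: "hnn_eq G A \<theta> [Stable_inv, Base (\<theta> a), Stable] ([Stable_inv, Stable] @ [Base a, Stable_inv, Stable])"
      by simp
    have 2: "hnn_eq G A \<theta> ([Stable_inv, Stable] @ [Base a, Stable_inv, Stable]) [Base a, Stable_inv, Stable]"
      using left[OF hnn_eq.inv2 s(3)] by simp
    have 3: "hnn_eq G A \<theta> ([Base a] @ [Stable_inv, Stable]) ([Base a] @ [])"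
      by (intro hnn_eq.append hnn_eq.refl s hnn_eq.inv2)
    show ?thesis using 1 2 3 by (auto intro: hnn_eq.trans)
  qed
  have cancel: "\<exists>L' g'. good L' g' \<and> hnn_eq G A \<theta> (stable_letter e # nf_word L g) (nf_word L' g')"
    if eq: "hnn_eq G A \<theta> [stable_letter e, Base k, stable_letter (\<not> e)] [Base h]" and h: "h \<in> carrier G"
      and Lk: "L = (k, \<not> e) # L2" for e k h L2
  proof -
    have L2: "good L2 g" using L hnn_reduced_tl[of A \<theta> "(k, \<not> e)" L2] unfolding Lk good_def by auto
    have "hnn_eq G A \<theta> (stable_letter e # nf_word L g) (Base h # nf_word L2 g)"
      using left[OF eq gw[OF L2]] unfolding Lk by simp
    then show ?thesis using base[OF h L2] by (blast intro: hnn_eq.trans)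
  qed
  have "\<exists>L' g'. good L' g' \<and> hnn_eq G A \<theta> (l # nf_word L g) (nf_word L' g')"
  proof (cases l)
    case (Base h)
    then show ?thesis using base[OF _ L, of h] l by (auto simp: hnn_words_def)
  next
    case Stable
    show ?thesis
    proof (cases "hnn_reduced A \<theta> ((\<one>\<^bsub>G\<^esub>, True) # L)")
      case True
      then show ?thesis using ext[of True] Stable by simp
    next
      case False
      then obtain k L2 where k: "L = (k, False) # L2" "k \<in> A"
        using L unfolding good_def by (cases L) auto
      have "\<theta> k \<in> carrier G" using k(2) A by auto
      then show ?thesis using cancel[of True k "\<theta> k" L2] hnn_eq.conj[OF k(2)] k(1) Stable by simp
    qed
  next
    case Stable_inv
    show ?thesis
    proof (cases "hnn_reduced A \<theta> ((\<one>\<^bsub>G\<^esub>, False) # L)")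
      case True
      then show ?thesis using ext[of False] Stable_inv by simp
    next
      case False
      then obtain k L2 where k: "L = (k, True) # L2" "k \<in> \<theta> ` A"
        using L unfolding good_def by (cases L) auto
      then obtain a where a: "a \<in> A" "k = \<theta> a" by blast
      then have "a \<in> carrier G" using A by auto
      then show ?thesis using cancel[of False k a L2] conj'[OF a(1)] k(1) a(2) Stable_inv by simp
    qed
  qed
  then obtain L' g' where L': "good L' g'" "hnn_eq G A \<theta> (l # nf_word L g) (nf_word L' g')" by blast
  have "hnn_eq G A \<theta> (l # w) (l # nf_word L g)"
    using hnn_eq.append[OF hnn_eq.refl[OF l] wL] by simp
  then have "hnn_eq G A \<theta> (l # w) (nf_word L' g')" using L'(2) by (rule hnn_eq.trans)
  then show ?case using L'(1) unfolding good_def by blast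
qed

section \<open>Discreteness and faithfulness\<close>

lemma carrier_PGL [simp]: "x \<in> carrier PGL"
  by (simp add: PGL_def)

interpretation PGL: group "PGL :: 'a::euclidean_space pgl monoid"
  by (rule group_PGL)

abbreviation (input) pgl_prod (infixl "\<cdot>" 70)
  where "g \<cdot> h \<equiv> g \<otimes>\<^bsub>PGL\<^esub> h"

lemma act_mult: "pgl_act (g \<cdot> h) ` X = pgl_act g ` pgl_act h ` X"
  by (simp add: PGL_def image_image pgl_act_mult)

lemma act_one: "pgl_act \<one>\<^bsub>PGL\<^esub> ` X = X"
  by (simp add: PGL_def pgl_act_one)

lemma act_inv: "pgl_act (inv\<^bsub>PGL\<^esub> g) ` pgl_act g ` X = X" "pgl_act g ` pgl_act (inv\<^bsub>PGL\<^esub> g) ` X = X"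
  by (simp_all add: act_mult[symmetric] act_one)

lemma pgl_act_inv: "pgl_act (inv\<^bsub>PGL\<^esub> g) (pgl_act g p) = p" "pgl_act g (pgl_act (inv\<^bsub>PGL\<^esub> g) p) = p"
  using act_inv[of g "{p}"] by simp_all

lemma PGL_cancel [simp]:
  "inv\<^bsub>PGL\<^esub> s \<cdot> (s \<cdot> g) = g" "s \<cdot> (inv\<^bsub>PGL\<^esub> s \<cdot> g) = g"
  by (simp_all add: PGL.m_assoc[symmetric])

lemma proj_occultation_neq:
  assumes "proj_occultation A B C"
  shows "A \<noteq> B"
proof
  assume "A = B"
  obtain a b c where *: "cone_over a A" "cone_over b B" "cone_occultation a b c"
    using assms unfolding proj_occultation_def by blast
  have "b \<noteq> uminus ` a"
  proof
    assume "b = uminus ` a"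
    then have "uminus ` b = a" by (simp add: image_image)
    then show False
      using cone_occultation_not_opposite[OF *(3)] open_coneD(2)[OF cone_over_open_cone[OF *(1)]] by simp
  qed
  then have "a = b" using cone_over_unique[OF *(1), of b] *(2) \<open>A = B\<close> by simp
  then show False using cone_occultationD(4)[OF *(3)] by blast
qed

lemma proj_occultation_pair:
  assumes "proj_occultation A B C"
  shows "proj_path [A, B]"
proof -
  obtain a b c where *: "cone_over a A" "cone_over b B" "cone_occultation a b c"
    using assms unfolding proj_occultation_def by blast
  then show ?thesis
    using cone_occultationD(6)[OF *(3)] cone_occultation_not_opposite[OF *(3)] by auto
qed

section \<open>Continuity of the projective action and of left translations\<close>

lemma open_act_into:
  assumes "open W"
  shows "open {k. pgl_act k p \<in> W}"
proof -
  obtain v where v: "v \<noteq> 0" "p = proj_pt v" by (rule proj_pt_cases)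
  let ?B = "{f :: 'a \<Rightarrow>\<^sub>L 'a. bij (blinfun_apply f)}"
  let ?T = "(\<lambda>f :: 'a \<Rightarrow>\<^sub>L 'a. blinfun_apply f v) -` {w. w \<noteq> 0 \<and> proj_pt w \<in> W}"
  have "open ?T"
    by (intro open_vimage continuous_intros) (use assms in \<open>simp add: open_proj_iff\<close>)
  moreover have "{f. bij (blinfun_apply f) \<and> pgl_class f \<in> {k. pgl_act k p \<in> W}} = ?B \<inter> ?T"
    using v by (auto simp: pgl_act_class bij_blinfun_apply_nonzero)
  ultimately show ?thesis unfolding open_pgl_def openin_open by blast
qed

lemma open_mult_into:
  assumes "open U"
  shows "open {k. g \<cdot> k \<in> U}"
proof -
  obtain F where F: "bij (blinfun_apply F)" "g = pgl_class F" by (rule pgl_class_cases)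
  let ?B = "{f :: 'a \<Rightarrow>\<^sub>L 'a. bij (blinfun_apply f)}"
  obtain T where T: "open T" "{f. bij (blinfun_apply f) \<and> pgl_class f \<in> U} = ?B \<inter> T"
    using assms unfolding open_pgl_def openin_open by blast
  let ?T = "(\<lambda>f. F o\<^sub>L f) -` T"
  have "open ?T"
    by (intro open_vimage T linear_continuous_on
        bounded_bilinear.bounded_linear_right[OF bounded_bilinear_blinfun_compose])
  moreover have "{f. bij (blinfun_apply f) \<and> pgl_class f \<in> {k. g \<cdot> k \<in> U}} = ?B \<inter> ?T"
  proof (rule Set.set_eqI)
    fix f :: "'a \<Rightarrow>\<^sub>L 'a"
    have "bij (blinfun_apply (F o\<^sub>L f))" if "bij (blinfun_apply f)"
    proof -
      have "blinfun_apply (F o\<^sub>L f) = blinfun_apply F \<circ> blinfun_apply f" by auto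
      then show ?thesis using F(1) that by (metis bij_comp)
    qed
    then have "bij (blinfun_apply f) \<Longrightarrow> pgl_class (F o\<^sub>L f) \<in> U \<longleftrightarrow> F o\<^sub>L f \<in> T"
      using T(2) by blast
    then show "f \<in> {f. bij (blinfun_apply f) \<and> pgl_class f \<in> {k. g \<cdot> k \<in> U}} \<longleftrightarrow> f \<in> ?B \<inter> ?T"
      using F by (auto simp: PGL_def pgl_mult_class)
  qed
  ultimately show ?thesis unfolding open_pgl_def openin_open using T(1) by blast
qed

definition stable_power :: "'a::euclidean_space pgl \<Rightarrow> bool \<Rightarrow> 'a pgl"
  where "stable_power t e = (if e then t else inv\<^bsub>PGL\<^esub> t)"

lemma inv_stable_power: "inv\<^bsub>PGL\<^esub> (stable_power t e) = stable_power t (\<not> e)"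
  by (simp add: stable_power_def)

fun syl_prod :: "'a::euclidean_space pgl \<Rightarrow> ('a pgl \<times> bool) list \<Rightarrow> 'a pgl"
  where
    "syl_prod t [] = \<one>\<^bsub>PGL\<^esub>"
  | "syl_prod t ((h, e) # L) = h \<cdot> stable_power t e \<cdot> syl_prod t L"

text \<open>The prefixes of a word trace a path in the Bass-Serre tree, with vertices represented by
  translates of the domain. A final base factor would not change the last vertex, since the base
  group preserves the domain.\<close>

fun domain_path :: "'a::euclidean_space pgl \<Rightarrow> 'a proj set \<Rightarrow> 'a pgl \<Rightarrow> ('a pgl \<times> bool) list \<Rightarrow> 'a proj set list"
  where
    "domain_path t \<Omega> g [] = [pgl_act g ` \<Omega>]"
  | "domain_path t \<Omega> g ((h, e) # L) =
      pgl_act g ` \<Omega> # domain_path t \<Omega> (g \<cdot> (h \<cdot> stable_power t e)) L"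

lemma domain_path_hd: "\<exists>p. domain_path t \<Omega> g L = pgl_act g ` \<Omega> # p"
  by (cases "(t, \<Omega>, g, L)" rule: domain_path.cases) auto

lemma last_domain_path: "last (domain_path t \<Omega> g L) = pgl_act (g \<cdot> syl_prod t L) ` \<Omega>"
proof (induction L arbitrary: g)
  case (Cons x L)
  obtain h e where x: "x = (h, e)" by (cases x)
  obtain p where "domain_path t \<Omega> (g \<cdot> (h \<cdot> stable_power t e)) L =
      pgl_act (g \<cdot> (h \<cdot> stable_power t e)) ` \<Omega> # p" using domain_path_hd by blast
  then show ?case using Cons.IH[of "g \<cdot> (h \<cdot> stable_power t e)"]
    by (simp add: x PGL.m_assoc)
qed simp

lemma hnn_eval_nf_word: "hnn_eval PGL (\<lambda>\<gamma>. \<gamma>) t (nf_word L g) = syl_prod t L \<cdot> g"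
  by (induction L g rule: nf_word.induct) (auto simp: hnn_eval_def PGL.m_assoc stable_power_def)

text \<open>\<open>occ\<close> unifies the two occultation hypotheses: distinct exponents give the
  first and equal exponents the second. In each case the side condition says that the two outer
  translates belong to distinct neighbours of the base vertex of the tree.\<close>

locale occulting_hnn =
  fixes \<Gamma> :: "'a::euclidean_space pgl set" and t :: "'a pgl" and \<Omega> :: "'a proj set"
  assumes dim: "DIM('a) \<ge> 3"
    and sub: "subgroup \<Gamma> PGL"
    and cone: "\<exists>a. cone_over a \<Omega>"
    and invariant: "\<gamma> \<in> \<Gamma> \<Longrightarrow> pgl_act \<gamma> ` \<Omega> = \<Omega>"
    and occ: "\<gamma> \<in> \<Gamma> \<Longrightarrow> e \<noteq> e' \<or> \<gamma> \<notin> conj_by (stable_power t e) ` \<Gamma> \<Longrightarrow>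
      proj_occultation (pgl_act (stable_power t e) ` \<Omega>) \<Omega> (pgl_act (\<gamma> \<cdot> stable_power t e') ` \<Omega>)"
begin

abbreviation "S \<equiv> stable_power t"
abbreviation "E \<equiv> pgl_hnn \<Gamma> t"
abbreviation "\<rho> \<equiv> pgl_hnn_rep t"
abbreviation "G\<^sub>0 \<equiv> PGL\<lparr>carrier := \<Gamma>\<rparr>"
abbreviation "dpath \<equiv> domain_path t \<Omega>"
abbreviation "A\<^sub>t \<equiv> conj_by (inv\<^bsub>PGL\<^esub> t) ` pgl_Delta \<Gamma> t"
abbreviation "is_reduced \<equiv> hnn_reduced A\<^sub>t (conj_by t)"
definition "P = \<rho> ` carrier E"

lemma one_in: "\<one>\<^bsub>PGL\<^esub> \<in> \<Gamma>" by (rule subgroup.one_closed[OF sub])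
lemma inv_in: "x \<in> \<Gamma> \<Longrightarrow> inv\<^bsub>PGL\<^esub> x \<in> \<Gamma>" using subgroup.m_inv_closed[OF sub] by simp

lemma conj_by_inverse:
  "conj_by (inv\<^bsub>PGL\<^esub> s) (conj_by s g) = g" "conj_by s (conj_by (inv\<^bsub>PGL\<^esub> s) g) = g"
  for s g :: "'a pgl"
  by (simp_all add: conj_by_def PGL.m_assoc)

lemma in_A_iff:
  assumes "\<gamma> \<in> \<Gamma>"
  shows "\<gamma> \<in> A\<^sub>t \<longleftrightarrow> \<gamma> \<in> conj_by (inv\<^bsub>PGL\<^esub> t) ` \<Gamma>"
proof
  assume "\<gamma> \<in> conj_by (inv\<^bsub>PGL\<^esub> t) ` \<Gamma>"
  then obtain \<delta> where \<delta>: "\<delta> \<in> \<Gamma>" "\<gamma> = conj_by (inv\<^bsub>PGL\<^esub> t) \<delta>" by blast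
  then have "\<delta> = conj_by t \<gamma>" by (simp add: conj_by_inverse)
  then have "\<delta> \<in> pgl_Delta \<Gamma> t" using \<delta> assms by (auto simp: pgl_Delta_def)
  then show "\<gamma> \<in> A\<^sub>t" using \<delta>(2) by blast
qed (auto simp: pgl_Delta_def)

lemma in_\<theta>A_iff: "\<gamma> \<in> \<Gamma> \<Longrightarrow> \<gamma> \<in> conj_by t ` A\<^sub>t \<longleftrightarrow> \<gamma> \<in> conj_by t ` \<Gamma>"
  using pgl_hnn_relations(2)[OF sub, of t] by (auto simp: pgl_Delta_def)

lemma group_hom_\<rho>: "group_hom E PGL \<rho>"
  using group_pgl_hnn[OF sub] group_PGL pgl_hnn_rep_hom[OF sub]
  by (intro group_hom.intro group_hom_axioms.intro)

lemma P_subgroup: "subgroup P PGL"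
  unfolding P_def by (rule group_hom.img_is_subgroup[OF group_hom_\<rho>])

lemma P_one: "\<one>\<^bsub>PGL\<^esub> \<in> P" by (rule subgroup.one_closed[OF P_subgroup])
lemma P_mult: "x \<in> P \<Longrightarrow> y \<in> P \<Longrightarrow> x \<cdot> y \<in> P" by (rule subgroup.m_closed[OF P_subgroup])
lemma P_inv: "x \<in> P \<Longrightarrow> inv\<^bsub>PGL\<^esub> x \<in> P" using subgroup.m_inv_closed[OF P_subgroup] by simp

lemma carrier_E: "carrier E = (\<lambda>w. hnn_class G\<^sub>0 A\<^sub>t (conj_by t) w) ` hnn_words G\<^sub>0"
  by (simp add: pgl_hnn_def hnn_extension_def)

lemma \<rho>_class:
  assumes "w \<in> hnn_words G\<^sub>0"
  shows "\<rho> (hnn_class G\<^sub>0 A\<^sub>t (conj_by t) w) = hnn_eval PGL (\<lambda>\<gamma>. \<gamma>) t w"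
  by (rule pgl_hnn_rep_class[OF sub assms])

lemma P_eq: "P = hnn_eval PGL (\<lambda>\<gamma>. \<gamma>) t ` hnn_words G\<^sub>0"
  unfolding P_def carrier_E image_image using \<rho>_class by (intro image_cong) auto

lemma normal_form:
  assumes "x \<in> carrier E"
  obtains L g where "fst ` set L \<subseteq> \<Gamma>" "g \<in> \<Gamma>" "is_reduced L"
    "x = hnn_class G\<^sub>0 A\<^sub>t (conj_by t) (nf_word L g)" "\<rho> x = syl_prod t L \<cdot> g"
proof -
  obtain w where w: "w \<in> hnn_words G\<^sub>0" "x = hnn_class G\<^sub>0 A\<^sub>t (conj_by t) w"
    using assms unfolding carrier_E by blast
  have G: "group G\<^sub>0" by (rule group.subgroup_imp_group[OF group_PGL sub])
  have AG: "A\<^sub>t \<subseteq> carrier G\<^sub>0" "conj_by t ` A\<^sub>t \<subseteq> carrier G\<^sub>0" using pgl_hnn_relations[OF sub, of t] by simp_all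
  obtain L g where L: "fst ` set L \<subseteq> carrier G\<^sub>0" "g \<in> carrier G\<^sub>0" "is_reduced L"
    "hnn_eq G\<^sub>0 A\<^sub>t (conj_by t) w (nf_word L g)"
    using hnn_normal_form[OF G AG w(1)] by blast
  have nf: "nf_word L g \<in> hnn_words G\<^sub>0" by (rule nf_word_in_words[OF L(1,2)])
  have x: "x = hnn_class G\<^sub>0 A\<^sub>t (conj_by t) (nf_word L g)"
    unfolding w(2) using L(4) by (subst hnn_class_eq_iff[OF nf])
  have "\<rho> x = syl_prod t L \<cdot> g"
    unfolding x \<rho>_class[OF nf] by (rule hnn_eval_nf_word)
  with x show ?thesis using that[of L g] L by simp
qed

lemma P_normal_form:
  assumes "x \<in> P"
  obtains L g where "fst ` set L \<subseteq> \<Gamma>" "g \<in> \<Gamma>" "is_reduced L" "x = syl_prod t L \<cdot> g"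
proof -
  obtain x' where x': "x' \<in> carrier E" "x = \<rho> x'" using assms unfolding P_def by blast
  show ?thesis using normal_form[OF x'(1)] that x'(2) by metis
qed

lemma in_P:
  assumes "fst ` set L \<subseteq> \<Gamma>" "g \<in> \<Gamma>"
  shows "syl_prod t L \<cdot> g \<in> P"
proof -
  have "nf_word L g \<in> hnn_words G\<^sub>0"
    by (rule nf_word_in_words) (use assms in simp_all)
  then have "hnn_eval PGL (\<lambda>\<gamma>. \<gamma>) t (nf_word L g) \<in> P" unfolding P_eq by (rule imageI)
  then show ?thesis unfolding hnn_eval_nf_word .
qed

lemma \<Gamma>_in_P: "\<gamma> \<in> \<Gamma> \<Longrightarrow> \<gamma> \<in> P"
  using in_P[of "[]" \<gamma>] by simp

lemma S_in_P: "S e \<in> P"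
  using in_P[of "[(\<one>\<^bsub>PGL\<^esub>, e)]" "\<one>\<^bsub>PGL\<^esub>"] one_in by simp

text \<open>Translating the middle domain back to \<open>\<Omega>\<close> turns the previous one
  into its image under \<open>S (\<not> e1)\<close>. With this reversed exponent the absence of a
  pinch is the side condition of \<open>occ\<close>.\<close>

lemma occ_reduced:
  assumes "h2 \<in> \<Gamma>" "h1 \<in> \<Gamma>" "is_reduced [(h1, e1), (h2, e2)]"
  shows "proj_occultation (pgl_act g ` \<Omega>) (pgl_act (g \<cdot> (h1 \<cdot> S e1)) ` \<Omega>)
    (pgl_act (g \<cdot> (h1 \<cdot> S e1) \<cdot> (h2 \<cdot> S e2)) ` \<Omega>)"
proof -
  let ?k = "g \<cdot> (h1 \<cdot> S e1)"
  have "(\<not> e1) \<noteq> e2 \<or> h2 \<notin> conj_by (S (\<not> e1)) ` \<Gamma>"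
    using assms(3) in_A_iff[OF assms(1)] in_\<theta>A_iff[OF assms(1)] by (cases e1; cases e2) (simp_all add: stable_power_def)
  from proj_occultation_act[OF occ[OF assms(1) this], of ?k]
  have "proj_occultation (pgl_act ?k ` pgl_act (S (\<not> e1)) ` \<Omega>) (pgl_act ?k ` \<Omega>)
      (pgl_act ?k ` pgl_act (h2 \<cdot> S e2) ` \<Omega>)" .
  moreover have "pgl_act ?k ` pgl_act (S (\<not> e1)) ` \<Omega> = pgl_act g ` \<Omega>"
    unfolding act_mult[symmetric] inv_stable_power[symmetric]
    by (simp add: PGL.m_assoc) (simp add: act_mult invariant[OF assms(2)])
  ultimately show ?thesis by (simp add: act_mult)
qed

text \<open>Two equal exponents never pinch, so each edge extends to a reduced path of length 2,
  whose occultation gives the claim.\<close>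

lemma adjacent_pair:
  assumes "h \<in> \<Gamma>"
  shows "proj_path [pgl_act g ` \<Omega>, pgl_act (g \<cdot> (h \<cdot> S e)) ` \<Omega>]"
proof (rule proj_occultation_pair, rule occ_reduced[OF one_in assms, of e e])
qed simp

lemma domain_path_proj_path:
  assumes "fst ` set L \<subseteq> \<Gamma>" "is_reduced L" "L \<noteq> []"
  shows "proj_path (dpath g L)"
  using assms
proof (induction L arbitrary: g)
  case (Cons x L)
  obtain h e where x: "x = (h, e)" by (cases x)
  let ?k = "g \<cdot> (h \<cdot> S e)"
  have h: "h \<in> \<Gamma>" using Cons.prems x by auto
  show ?case
  proof (cases L)
    case Nil
    then show ?thesis using adjacent_pair[OF h, of g e] by (simp add: x del: proj_path.simps)
  next
    case (Cons y L2)
    obtain h2 e2 where y: "y = (h2, e2)" by (cases y)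
    have h2: "h2 \<in> \<Gamma>" using Cons.prems Cons y by auto
    have red: "is_reduced [(h, e), (h2, e2)]" using Cons.prems(2) unfolding x y Cons by simp
    have IH: "proj_path (dpath ?k L)"
      using Cons.IH[of ?k] Cons.prems hnn_reduced_tl[of A\<^sub>t "conj_by t" x L] Cons by auto
    obtain p where p: "dpath (?k \<cdot> (h2 \<cdot> S e2)) L2 =
        pgl_act (?k \<cdot> (h2 \<cdot> S e2)) ` \<Omega> # p" using domain_path_hd by blast
    show ?thesis using IH occ_reduced[OF h2 h red, of g] unfolding x y Cons by (simp add: p)
  qed
qed simp

lemma far_disjoint:
  assumes "fst ` set L \<subseteq> \<Gamma>" "is_reduced L" "2 \<le> length L"
  shows "\<Omega> \<inter> pgl_act (syl_prod t L) ` \<Omega> = {}"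
proof -
  obtain x y L' where xy: "L = x # y # L'" using assms(3) by (cases L; cases "tl L") auto
  obtain h1 e1 h2 e2 where "x = (h1, e1)" "y = (h2, e2)" by (cases x; cases y)
  with xy have L: "L = (h1, e1) # (h2, e2) # L'" by simp
  have path: "proj_path (dpath \<one>\<^bsub>PGL\<^esub> L)"
    by (rule domain_path_proj_path[OF assms(1,2)]) (simp add: L)
  obtain p where p: "dpath (h1 \<cdot> S e1 \<cdot> (h2 \<cdot> S e2)) L' =
      pgl_act (h1 \<cdot> S e1 \<cdot> (h2 \<cdot> S e2)) ` \<Omega> # p" using domain_path_hd by blast
  have dp: "dpath \<one>\<^bsub>PGL\<^esub> L = \<Omega> # pgl_act (h1 \<cdot> S e1) ` \<Omega> #
      pgl_act (h1 \<cdot> S e1 \<cdot> (h2 \<cdot> S e2)) ` \<Omega> # p"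
    by (simp add: L act_one p)
  show ?thesis
    using proj_path_disjoint_ends[OF dim path[unfolded dp]] last_domain_path[of t \<Omega> "\<one>\<^bsub>PGL\<^esub>" L]
    unfolding dp by simp
qed

text \<open>Reduced words of length at least 2 move \<open>\<Omega>\<close> off itself, and a single
  stable letter moves it to a domain that occultation keeps different. Hence translates, taken as
  sets, can stand for cosets of \<open>\<Gamma>\<close>.\<close>

lemma stabilizer:
  assumes "x \<in> P" "pgl_act x ` \<Omega> = \<Omega>"
  shows "x \<in> \<Gamma>"
proof -
  obtain L g where L: "fst ` set L \<subseteq> \<Gamma>" "g \<in> \<Gamma>" "is_reduced L" "x = syl_prod t L \<cdot> g"
    using P_normal_form[OF assms(1)] .
  have xL: "pgl_act (syl_prod t L) ` \<Omega> = \<Omega>" using assms(2) unfolding L(4) by (simp add: act_mult invariant[OF L(2)])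
  have "\<Omega> \<noteq> {}" using cone cone_over_nonempty by blast
  then have "length L < 2" using far_disjoint[OF L(1,3)] xL by (metis Int_absorb not_le)
  then have "L = [] \<or> (\<exists>h e. L = [(h, e)])" by (cases L; cases "tl L") auto
  then consider "L = []" | h e where "L = [(h, e)]" by blast
  then show ?thesis
  proof cases
    case 1
    then show ?thesis using L by simp
  next
    case (2 h e)
    have h: "h \<in> \<Gamma>" using L 2 by simp
    have "pgl_act (inv\<^bsub>PGL\<^esub> h) ` pgl_act h ` pgl_act (S e) ` \<Omega> = \<Omega>"
      using xL 2 invariant[OF inv_in[OF h]] by (simp add: act_mult)
    then have "pgl_act (S e) ` \<Omega> = \<Omega>" by (simp add: act_inv)
    moreover have "pgl_act (S e) ` \<Omega> \<noteq> \<Omega>"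
      by (rule proj_occultation_neq[OF occ[OF one_in, of e "\<not> e"]]) simp
    ultimately show ?thesis by simp
  qed
qed

text \<open>The overlap belongs to the edge from \<open>\<Omega>\<close> to its image under
  \<open>t\<close>. An element with a stable letter moves this edge to another one, and some end of
  the old edge has distance at least 2 from some end of the new one. For a single syllable,
  \<open>t\<close> on the right or its inverse on the left exhibits such ends, depending on the
  exponent.\<close>

lemma moves_overlap:
  assumes L: "fst ` set L \<subseteq> \<Gamma>" "g \<in> \<Gamma>" "is_reduced L" "L \<noteq> []"
    and p: "p \<in> \<Omega>" "p \<in> pgl_act t ` \<Omega>"
    and x: "pgl_act (syl_prod t L \<cdot> g) p \<in> \<Omega>" "pgl_act (syl_prod t L \<cdot> g) p \<in> pgl_act t ` \<Omega>"
  shows False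
proof -
  let ?x = "syl_prod t L \<cdot> g"
  have xp: "pgl_act ?x p \<in> pgl_act (syl_prod t L) ` \<Omega>"
    using imageI[OF p(1), of "pgl_act ?x"] by (simp add: act_mult invariant[OF L(2)])
  have "length L < 2" using far_disjoint[OF L(1,3)] xp x(1) by (metis disjoint_iff not_le)
  then have "\<exists>h e. L = [(h, e)]" using L(4) by (cases L; cases "tl L") auto
  then obtain h e where he: "L = [(h, e)]" by blast
  have h: "h \<in> \<Gamma>" using L he by simp
  show False
  proof (cases e)
    case True
    have "\<Omega> \<inter> pgl_act (syl_prod t [(h, True), (g, True)]) ` \<Omega> = {}"
      by (rule far_disjoint) (use h L in auto)
    moreover have "syl_prod t [(h, True), (g, True)] = ?x \<cdot> t"
      using he True by (simp add: PGL.m_assoc stable_power_def)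
    ultimately have "\<Omega> \<inter> pgl_act ?x ` pgl_act t ` \<Omega> = {}" by (simp only: act_mult)
    then show False using x(1) p(2) by blast
  next
    case False
    have "\<Omega> \<inter> pgl_act (syl_prod t [(\<one>\<^bsub>PGL\<^esub>, False), (h, False)]) ` \<Omega> = {}"
      by (rule far_disjoint) (use h one_in in auto)
    moreover have "syl_prod t [(\<one>\<^bsub>PGL\<^esub>, False), (h, False)] = inv\<^bsub>PGL\<^esub> t \<cdot> syl_prod t L"
      using he False by (simp add: PGL.m_assoc stable_power_def)
    ultimately have "\<Omega> \<inter> pgl_act (inv\<^bsub>PGL\<^esub> t) ` pgl_act (syl_prod t L) ` \<Omega> = {}" by (simp only: act_mult)
    then have "pgl_act (inv\<^bsub>PGL\<^esub> t) (pgl_act ?x p) \<notin> \<Omega>" using xp by blast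
    then show False using x(2) by (auto simp: pgl_act_inv)
  qed
qed

lemma overlap_point: "\<exists>p. p \<in> \<Omega> \<and> p \<in> pgl_act t ` \<Omega>"
proof -
  have "proj_path [\<Omega>, pgl_act t ` \<Omega>]"
    using adjacent_pair[OF one_in, of "\<one>\<^bsub>PGL\<^esub>" True] by (simp add: act_one stable_power_def del: proj_path.simps)
  then obtain a b where "cone_over a \<Omega>" "cone_over b (pgl_act t ` \<Omega>)" "a \<inter> b \<noteq> {}" by auto
  then have "\<Omega> \<inter> pgl_act t ` \<Omega> \<noteq> {}" unfolding cone_over_def by blast
  then show ?thesis by blast
qed

lemma discrete_faithful_\<rho>:
  assumes disc: "discrete \<Gamma>"
  shows "discrete_faithful E \<rho>"
  unfolding discrete_faithful_def
proof (intro conjI)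
  obtain p where p: "p \<in> \<Omega>" "p \<in> pgl_act t ` \<Omega>" using overlap_point by blast
  have fixes_overlap: "L = []" if L: "fst ` set L \<subseteq> \<Gamma>" "g \<in> \<Gamma>" "is_reduced L"
    and "pgl_act (syl_prod t L \<cdot> g) p \<in> \<Omega> \<inter> pgl_act t ` \<Omega>" for L g
    using moves_overlap[OF L _ p] that(4) by blast
  show "\<rho> \<in> hom E PGL" by (rule pgl_hnn_rep_hom[OF sub])
  have "x = \<one>\<^bsub>E\<^esub>" if x: "x \<in> carrier E" "\<rho> x = \<one>\<^bsub>PGL\<^esub>" for x
  proof -
    obtain L g where L: "fst ` set L \<subseteq> \<Gamma>" "g \<in> \<Gamma>" "is_reduced L"
      "x = hnn_class G\<^sub>0 A\<^sub>t (conj_by t) (nf_word L g)" "\<rho> x = syl_prod t L \<cdot> g"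
      using normal_form[OF x(1)] .
    have "pgl_act (\<rho> x) p = p" using x(2) act_one[of "{p}"] by simp
    then have "L = []" using fixes_overlap[OF L(1,2,3)] p L(5) by auto
    then have g: "g = \<one>\<^bsub>PGL\<^esub>" using L(5) x(2) by simp
    have "hnn_eq G\<^sub>0 A\<^sub>t (conj_by t) [Base \<one>\<^bsub>PGL\<^esub>] []"
      using hnn_eq.one[of "G\<^sub>0" A\<^sub>t "conj_by t"] by simp
    then have "hnn_class G\<^sub>0 A\<^sub>t (conj_by t) [Base \<one>\<^bsub>PGL\<^esub>] =
        hnn_class G\<^sub>0 A\<^sub>t (conj_by t) []"
      by (subst hnn_class_eq_iff) (auto simp: hnn_words_def)
    then show ?thesis using L(4) \<open>L = []\<close> g by (simp add: pgl_hnn_def hnn_extension_def)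
  qed
  then show "inj_on \<rho> (carrier E)" using group_hom.inj_on_one_iff[OF group_hom_\<rho>] by blast
  obtain O1 where O1: "open O1" "O1 \<inter> \<Gamma> = {\<one>\<^bsub>PGL\<^esub>}"
    using discreteD[OF disc one_in] unfolding isolated_in_def by blast
  have op: "open (\<Omega> \<inter> pgl_act t ` \<Omega>)"
  proof -
    obtain a where a: "cone_over a \<Omega>" using cone by blast
    obtain F where F: "bij (blinfun_apply F)" "t = pgl_class F" by (rule pgl_class_cases)
    have "open \<Omega>" using cone_over_imp_properly_convex[OF a] by (simp add: properly_convex_def)
    moreover have "open (pgl_act t ` \<Omega>)"
      using cone_over_imp_properly_convex[OF cone_over_linear_image[OF a F(1)]] F(2) by (simp add: properly_convex_def)
    ultimately show ?thesis by (rule open_Int)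
  qed
  show "discrete (\<rho> ` carrier E)"
    unfolding P_def[symmetric]
  proof (rule discreteI)
    fix x assume x: "x \<in> P"
    let ?W = "\<Omega> \<inter> pgl_act t ` \<Omega>"
    \<comment> \<open>For \<open>k\<close> in this neighbourhood of \<open>x\<close>, the element
      \<open>x^-1 k\<close> keeps \<open>p\<close> in the overlap, hence lies in
      \<open>\<Gamma>\<close>, where \<open>O1\<close> isolates the identity.\<close>
    let ?T = "{k. inv\<^bsub>PGL\<^esub> x \<cdot> k \<in> {k. pgl_act k p \<in> ?W} \<inter> O1}"
    have "open ?T" by (intro open_mult_into open_Int open_act_into op O1)
    moreover have "?T \<inter> P = {x}"
    proof
      show "{x} \<subseteq> ?T \<inter> P" using x p O1 act_one[of "{p}"] by auto
      show "?T \<inter> P \<subseteq> {x}"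
      proof
        fix k assume k: "k \<in> ?T \<inter> P"
        define y where "y = inv\<^bsub>PGL\<^esub> x \<cdot> k"
        have y: "y \<in> P" "pgl_act y p \<in> ?W" "y \<in> O1" using k x P_mult P_inv by (auto simp: y_def)
        obtain L g where L: "fst ` set L \<subseteq> \<Gamma>" "g \<in> \<Gamma>" "is_reduced L" "y = syl_prod t L \<cdot> g"
          using P_normal_form[OF y(1)] .
        have "L = []" using fixes_overlap[OF L(1-3)] y(2) L(4) by blast
        then have "y \<in> \<Gamma>" using L by simp
        then have "y = \<one>\<^bsub>PGL\<^esub>" using y(3) O1(2) by blast
        then have "x \<cdot> y = x" by simp
        then show "k \<in> {x}" by (simp add: y_def)
      qed
    qed
    ultimately show "x isolated_in P" using x unfolding isolated_in_def by blast
  qed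
qed

end

section \<open>Convexity of the union\<close>

text \<open>A segment between two multiples of one vector contains only multiples of it, so the
  occulting cone contains such a multiple.\<close>

lemma cone_occultation_between:
  assumes occ: "cone_occultation a b c" and x: "x \<noteq> 0"
    and a: "x \<in> closure a \<or> - x \<in> closure a" and c: "x \<in> closure c \<or> - x \<in> closure c"
  shows "x \<in> b \<or> - x \<in> b"
proof -
  note D = cone_occultationD[OF occ]
  obtain i :: real where i: "i = 1 \<or> i = -1" "i *\<^sub>R x \<in> closure a - {0}"
    using a x by (metis DiffI neg_equal_0_iff_equal scaleR_minus1_left scaleR_one singletonD)
  obtain j :: real where j: "j = 1 \<or> j = -1" "j *\<^sub>R x \<in> closure c - {0}"
    using c x by (metis DiffI neg_equal_0_iff_equal scaleR_minus1_left scaleR_one singletonD)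
  obtain s r where "s *\<^sub>R (i *\<^sub>R x) + r *\<^sub>R (j *\<^sub>R x) \<in> b"
    using occults_segment[OF D(2,10) i(2) j(2)] by blast
  then have "(s * i + r * j) *\<^sub>R x \<in> b" by (simp add: scaleR_add_left)
  then obtain k where k: "k *\<^sub>R x \<in> b" by blast
  then have "k \<noteq> 0" using zero_notin_open_cone[OF D(2)] by auto
  then have "(1 / \<bar>k\<bar>) *\<^sub>R (k *\<^sub>R x) \<in> b" by (intro open_coneD(4)[OF D(2)] k) auto
  moreover have "(1 / \<bar>k\<bar>) *\<^sub>R (k *\<^sub>R x) = (if k > 0 then x else - x)"
    using \<open>k \<noteq> 0\<close> by simp
  ultimately show ?thesis by (simp split: if_splits)
qed

text \<open>Large multiples of points of \<open>b\<close> force the separating functional to be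
  nonnegative on \<open>b\<close>; small ones force the separating constant to be at most 0.\<close>

lemma strict_separation_cone:
  fixes b :: "'a::euclidean_space set"
  assumes b: "open_cone b" and x: "x \<notin> closure b"
  shows "\<exists>f. (\<forall>z\<in>b. 0 \<le> f \<bullet> z) \<and> f \<bullet> x < 0"
proof -
  note bD = open_coneD[OF b]
  have "convex (closure b)" by (rule convex_closure[OF bD(3)])
  then obtain f c where f: "f \<bullet> x < c" "\<forall>z\<in>closure b. c < f \<bullet> z"
    using separating_hyperplane_closed_point[OF _ closed_closure x] by blast
  obtain w where w: "w \<in> b" using bD(2) by blast
  have fz: "0 \<le> f \<bullet> z" if z: "z \<in> b" for z
  proof (rule ccontr)
    assume "\<not> 0 \<le> f \<bullet> z"
    then have neg: "f \<bullet> z < 0" by simp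
    define r where "r = (\<bar>c\<bar> + 1) / - (f \<bullet> z)"
    have r: "r > 0" unfolding r_def using neg by (intro divide_pos_pos) linarith+
    have "r *\<^sub>R z \<in> closure b" using bD(4)[OF r z] closure_subset[of b] by blast
    then have "c < f \<bullet> (r *\<^sub>R z)" using f by blast
    also have "f \<bullet> (r *\<^sub>R z) = - (\<bar>c\<bar> + 1)" using neg by (simp add: r_def field_simps)
    finally show False by linarith
  qed
  have "c \<le> 0"
  proof (rule ccontr)
    assume "\<not> c \<le> 0"
    then have c: "c > 0" by simp
    have fw: "0 \<le> f \<bullet> w" by (rule fz[OF w])
    define r where "r = c / (2 * (f \<bullet> w + 1))"
    have r: "r > 0" using c fw by (simp add: r_def)
    have "r *\<^sub>R w \<in> closure b" using bD(4)[OF r w] closure_subset[of b] by blast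
    then have "c < f \<bullet> (r *\<^sub>R w)" using f by blast
    also have "f \<bullet> (r *\<^sub>R w) \<le> c / 2" using c fw by (simp add: r_def field_simps)
    finally show False using c by linarith
  qed
  then show ?thesis using f fz by (intro exI[of _ f]) auto
qed

text \<open>Start from a functional positive on the closed cone and cancel its value at
  \<open>x\<close> by a nonnegative functional of the right sign there. Both signs are available
  because neither \<open>x\<close> nor \<open>-x\<close> lies in the closure.\<close>

lemma positive_functional_vanishing:
  fixes b :: "'a::euclidean_space set"
  assumes b: "open_cone b" and x: "x \<notin> closure b" "- x \<notin> closure b"
  shows "\<exists>h. (\<forall>z\<in>closure b - {0}. 0 < h \<bullet> z) \<and> h \<bullet> x = 0"
proof -
  obtain g where g: "\<forall>z\<in>closure b - {0}. 0 < g \<bullet> z" using open_coneD(5)[OF b] by blast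
  obtain f1 where f1: "\<forall>z\<in>b. 0 \<le> f1 \<bullet> z" "f1 \<bullet> x < 0" using strict_separation_cone[OF b x(1)] by blast
  obtain f2 where f2: "\<forall>z\<in>b. 0 \<le> f2 \<bullet> z" "f2 \<bullet> x > 0" using strict_separation_cone[OF b x(2)] by auto
  have pos: "0 < (g + k *\<^sub>R f) \<bullet> z" if "0 \<le> k" "\<forall>z\<in>b. 0 \<le> f \<bullet> z" "z \<in> closure b - {0}" for k f z
  proof -
    have "0 \<le> f \<bullet> z" by (rule inner_nonneg_closure[of b]) (use that in auto)
    then have "0 \<le> k * (f \<bullet> z)" using that(1) by simp
    moreover have "0 < g \<bullet> z" using g that(3) by blast
    ultimately show ?thesis by (simp add: inner_add_left)
  qed
  show ?thesis
  proof (cases "0 \<le> g \<bullet> x")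
    case True
    then have "0 \<le> (g \<bullet> x) / - (f1 \<bullet> x)" using f1 by (simp add: divide_nonneg_neg)
    from pos[OF this f1(1)] have "\<forall>z\<in>closure b - {0}. 0 < (g + ((g \<bullet> x) / - (f1 \<bullet> x)) *\<^sub>R f1) \<bullet> z" by blast
    moreover have "(g + ((g \<bullet> x) / - (f1 \<bullet> x)) *\<^sub>R f1) \<bullet> x = 0"
      using f1(2) by (simp add: inner_diff_left)
    ultimately show ?thesis by blast
  next
    case False
    then have "0 \<le> - (g \<bullet> x) / (f2 \<bullet> x)" using f2(2) by (intro divide_nonneg_pos) linarith+
    from pos[OF this f2(1)] have "\<forall>z\<in>closure b - {0}. 0 < (g + (- (g \<bullet> x) / (f2 \<bullet> x)) *\<^sub>R f2) \<bullet> z" by blast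
    moreover have "(g + (- (g \<bullet> x) / (f2 \<bullet> x)) *\<^sub>R f2) \<bullet> x = 0"
      using f2(2) by (simp add: inner_diff_left)
    ultimately show ?thesis by blast
  qed
qed

lemma gen_linear_image:
  assumes "linear F"
  shows "F ` gen S = gen (F ` S)"
proof
  show "F ` gen S \<subseteq> gen (F ` S)"
  proof
    fix y assume "y \<in> F ` gen S"
    then obtain x where x: "x \<in> gen S" "y = F x" by blast
    from x(1) have "F x \<in> gen (F ` S)"
      by induction (auto intro: gen.intros simp: linear_add[OF assms])
    then show "y \<in> gen (F ` S)" using x(2) by simp
  qed
  show "gen (F ` S) \<subseteq> F ` gen S"
  proof
    fix y assume "y \<in> gen (F ` S)"
    then show "y \<in> F ` gen S"
    proof induction
      case (gen_base x)
      then show ?case by (auto intro: gen.gen_base)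
    next
      case (gen_add x y)
      then obtain u v where "u \<in> S" "x = F u" "v \<in> gen S" "y = F v" by blast
      then show ?case using gen.gen_add[of u S v] linear_add[OF assms, of u v] by (metis image_eqI)
    qed
  qed
qed

text \<open>The sum of a maximal independent set of nonnegative functionals works: if all of them
  vanished at \<open>z\<close>, so would their span, which contains every functional nonnegative on
  \<open>U\<close>.\<close>

lemma spanning_functionals_positive:
  fixes U :: "'a::euclidean_space set"
  assumes "\<And>x. x \<noteq> 0 \<Longrightarrow> \<exists>f. f \<bullet> x \<noteq> 0 \<and> (\<forall>z\<in>U. 0 \<le> f \<bullet> z)"
  shows "\<exists>f. \<forall>z\<in>closure U - {0}. 0 < f \<bullet> z"
proof -
  define D where "D = {f. \<forall>z\<in>U. 0 \<le> f \<bullet> z}"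
  obtain B where B: "B \<subseteq> D" "independent B" "D \<subseteq> span B" using maximal_independent_subset[of D] by metis
  have fin: "finite B" by (rule independent_imp_finite[OF B(2)])
  have "0 < (\<Sum>f\<in>B. f) \<bullet> z" if z: "z \<in> closure U - {0}" for z
  proof -
    have nn: "0 \<le> f \<bullet> z" if "f \<in> B" for f
      by (rule inner_nonneg_closure[of U]) (use z B(1) that in \<open>auto simp: D_def\<close>)
    have "\<exists>f\<in>B. f \<bullet> z \<noteq> 0"
    proof (rule ccontr)
      assume neg: "\<not> ?thesis"
      have "orthogonal z f" if "f \<in> span B" for f
        by (rule orthogonal_to_span[OF that]) (use neg in \<open>auto simp: orthogonal_def inner_commute\<close>)
      moreover obtain f where "f \<bullet> z \<noteq> 0" "f \<in> D" using assms[of z] z by (auto simp: D_def)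
      ultimately show False using B(3) by (auto simp: orthogonal_def inner_commute)
    qed
    then obtain f where "f \<in> B" "0 < f \<bullet> z" using nn by force
    then have "0 < (\<Sum>f\<in>B. f \<bullet> z)" using nn by (intro sum_pos2[OF fin]) auto
    then show ?thesis by (simp add: inner_sum_left)
  qed
  then show ?thesis by blast
qed

lemma proj_occultation_neq_ends:
  assumes "proj_occultation A B C"
  shows "A \<noteq> C"
proof
  assume "A = C"
  obtain a b c where *: "cone_over a A" "cone_over b B" "cone_over c C" "cone_occultation a b c"
    using assms unfolding proj_occultation_def by blast
  have "c = a \<or> c = uminus ` a" using cone_over_unique[OF *(1)] *(3) \<open>A = C\<close> by blast
  moreover have "uminus ` uminus ` a = a" by (simp add: image_image)
  ultimately show False
    using cone_occultationD(8,9)[OF *(4)] open_coneD(2)[OF cone_over_open_cone[OF *(1)]] by auto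
qed

text \<open>Here the signs of two cones are prescribed at once; that they meet makes the choices
  compatible.\<close>

lemma proj_occultation_neighbour:
  assumes b: "cone_over b B" and c: "cone_over c C" "b \<inter> c \<noteq> {}" and occ: "proj_occultation C B D"
  shows "\<exists>d. cone_over d D \<and> cone_occultation c b d"
proof -
  obtain b' d where d: "cone_over b' B" "cone_over d D" "cone_occultation c b' d"
    using proj_occultation_cones[OF occ c(1)] by blast
  have "b = b'"
    by (rule cone_over_unique_meet[OF d(1) b, of c]) (use c(2) cone_occultation_not_opposite[OF d(3)] in auto)
  then show ?thesis using d by blast
qed

section \<open>The tree of translates and its non-backtracking paths\<close>

context occulting_hnn
begin

definition adj :: "'a proj set \<Rightarrow> 'a proj set \<Rightarrow> bool"
  where "adj X Y \<longleftrightarrow> (\<exists>x\<in>P. \<exists>e. X = pgl_act x ` \<Omega> \<and> Y = pgl_act (x \<cdot> S e) ` \<Omega>)"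

lemma S_inverse: "S e \<cdot> S (\<not> e) = \<one>\<^bsub>PGL\<^esub>"
  unfolding inv_stable_power[symmetric] by simp

lemma adj_commute: "adj X Y \<Longrightarrow> adj Y X"
proof -
  assume "adj X Y"
  then obtain x e where x: "x \<in> P" "X = pgl_act x ` \<Omega>" "Y = pgl_act (x \<cdot> S e) ` \<Omega>"
    unfolding adj_def by blast
  have "x \<cdot> S e \<cdot> S (\<not> e) = x" by (simp add: PGL.m_assoc S_inverse)
  then show "adj Y X" unfolding adj_def using x P_mult[OF x(1) S_in_P] by metis
qed

text \<open>Two representatives of the vertex \<open>B\<close> differ by an element of
  \<open>\<Gamma>\<close>, by \<open>stabilizer\<close>. With equal exponents and this element in
  the excluded conjugate, the two neighbours would coincide.\<close>

lemma adj_occ: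
  assumes "adj B A" "adj B C" "A \<noteq> C"
  shows "proj_occultation A B C"
proof -
  obtain x e where x: "x \<in> P" "B = pgl_act x ` \<Omega>" "A = pgl_act (x \<cdot> S e) ` \<Omega>"
    using assms(1) unfolding adj_def by blast
  obtain y e' where y: "y \<in> P" "B = pgl_act y ` \<Omega>" "C = pgl_act (y \<cdot> S e') ` \<Omega>"
    using assms(2) unfolding adj_def by blast
  define \<gamma> where "\<gamma> = inv\<^bsub>PGL\<^esub> x \<cdot> y"
  have \<gamma>: "\<gamma> \<in> \<Gamma>"
  proof (rule stabilizer)
    show "\<gamma> \<in> P" unfolding \<gamma>_def by (intro P_mult P_inv x y)
    show "pgl_act \<gamma> ` \<Omega> = \<Omega>" unfolding \<gamma>_def act_mult y(2)[symmetric] x(2) by (rule act_inv)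
  qed
  have yx: "y = x \<cdot> \<gamma>" by (simp add: \<gamma>_def)
  have "e \<noteq> e' \<or> \<gamma> \<notin> conj_by (S e) ` \<Gamma>"
  proof (rule ccontr)
    assume "\<not> ?thesis"
    then obtain \<delta> where \<delta>: "e' = e" "\<delta> \<in> \<Gamma>" "\<gamma> = conj_by (S e) \<delta>" by blast
    then have "\<gamma> \<cdot> S e = S e \<cdot> \<delta>" by (simp add: conj_by_def PGL.m_assoc)
    then have "C = A" unfolding y(3) x(3) yx \<delta>(1)
      by (simp add: PGL.m_assoc) (simp add: act_mult invariant[OF \<delta>(2)])
    then show False using assms(3) by simp
  qed
  from proj_occultation_act[OF occ[OF \<gamma> this], of x]
  show ?thesis unfolding x y(3) yx by (simp add: act_mult)
qed

lemma adj_other: "adj B A \<Longrightarrow> \<exists>C. adj B C \<and> A \<noteq> C"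
proof -
  assume "adj B A"
  then obtain x e where x: "x \<in> P" "B = pgl_act x ` \<Omega>" "A = pgl_act (x \<cdot> S e) ` \<Omega>"
    unfolding adj_def by blast
  have "proj_occultation A B (pgl_act (x \<cdot> S (\<not> e)) ` \<Omega>)"
    using proj_occultation_act[OF occ[OF one_in, of e "\<not> e"], of x] by (simp add: x act_mult act_one)
  moreover have "adj B (pgl_act (x \<cdot> S (\<not> e)) ` \<Omega>)"
    unfolding adj_def using x(1,2) by (intro bexI[of _ x] exI[of _ "\<not> e"]) simp_all
  ultimately show "\<exists>C. adj B C \<and> A \<noteq> C" using proj_occultation_neq_ends by blast
qed

lemma adj_pair:
  assumes "adj A B"
  shows "proj_path [A, B]"
proof -
  have BA: "adj B A" by (rule adj_commute[OF assms])
  obtain C where "adj B C" "A \<noteq> C" using adj_other[OF BA] by blast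
  then show ?thesis by (intro proj_occultation_pair adj_occ BA)
qed

fun nb_path :: "'a proj set list \<Rightarrow> bool"
  where
    "nb_path (X # Y # Z # p) \<longleftrightarrow> adj X Y \<and> X \<noteq> Z \<and> nb_path (Y # Z # p)"
  | "nb_path [X, Y] \<longleftrightarrow> adj X Y"
  | "nb_path _ \<longleftrightarrow> False"

lemma nb_path_hd: "nb_path (X # Y # p) \<Longrightarrow> adj X Y"
  by (cases p) auto

lemma nb_path_snoc: "nb_path (p @ [X, Y]) \<Longrightarrow> adj Y Z \<Longrightarrow> X \<noteq> Z \<Longrightarrow> nb_path (p @ [X, Y, Z])"
proof (induction p rule: induct_list012)
  case (3 W V p)
  then show ?case by (cases p) auto
qed auto

lemma nb_path_nth: "nb_path p \<Longrightarrow> Suc i < length p \<Longrightarrow> adj (p ! i) (p ! Suc i)"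
proof (induction p arbitrary: i rule: nb_path.induct)
  case (1 X Y Z p)
  then show ?case by (cases i) auto
qed auto

lemma domain_path_nb_path:
  assumes "fst ` set L \<subseteq> \<Gamma>" "is_reduced L" "L \<noteq> []" "g \<in> P"
  shows "nb_path (dpath g L)"
  using assms
proof (induction L arbitrary: g)
  case (Cons x L)
  obtain h e where x: "x = (h, e)" by (cases x)
  let ?k = "g \<cdot> (h \<cdot> S e)"
  have h: "h \<in> \<Gamma>" using Cons.prems x by auto
  have k: "?k \<in> P" using \<Gamma>_in_P[OF h] S_in_P Cons.prems(4) by (intro P_mult)
  have "pgl_act (g \<cdot> h) ` \<Omega> = pgl_act g ` \<Omega>" by (simp add: act_mult invariant[OF h])
  moreover have "g \<cdot> h \<in> P" by (intro P_mult Cons.prems \<Gamma>_in_P h)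
  ultimately have adj: "adj (pgl_act g ` \<Omega>) (pgl_act ?k ` \<Omega>)"
    unfolding adj_def by (metis PGL.m_assoc carrier_PGL)
  show ?case
  proof (cases L)
    case Nil
    then show ?thesis using adj by (simp add: x)
  next
    case (Cons y L2)
    obtain h2 e2 where y: "y = (h2, e2)" by (cases y)
    have h2: "h2 \<in> \<Gamma>" using Cons.prems Cons y by auto
    have red: "is_reduced [(h, e), (h2, e2)]" using Cons.prems(2) unfolding x y Cons by simp
    have IH: "nb_path (dpath ?k L)"
      using Cons.IH[of ?k] Cons.prems hnn_reduced_tl[of A\<^sub>t "conj_by t" x L] Cons k by auto
    obtain p where p: "dpath (?k \<cdot> (h2 \<cdot> S e2)) L2 =
        pgl_act (?k \<cdot> (h2 \<cdot> S e2)) ` \<Omega> # p" using domain_path_hd by blast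
    show ?thesis
      using IH adj proj_occultation_neq_ends[OF occ_reduced[OF h2 h red, of g]] unfolding x y Cons by (simp add: p)
  qed
qed simp

text \<open>Two edges of a tree lie on a common geodesic: join one end of each, and prolong the path
  at either side where it does not already traverse the edge.\<close>

lemma edges_on_path:
  assumes "x \<in> P" "y \<in> P"
  shows "\<exists>p. nb_path p \<and> pgl_act x ` \<Omega> \<in> set p \<and> pgl_act (x \<cdot> t) ` \<Omega> \<in> set p \<and>
    pgl_act y ` \<Omega> \<in> set p \<and> pgl_act (y \<cdot> t) ` \<Omega> \<in> set p"
proof -
  let ?X = "pgl_act x ` \<Omega>" and ?X' = "pgl_act (x \<cdot> t) ` \<Omega>"
  let ?Y = "pgl_act y ` \<Omega>" and ?Y' = "pgl_act (y \<cdot> t) ` \<Omega>"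
  have St: "S True = t" by (simp add: stable_power_def)
  have adjX: "adj ?X ?X'" and adjY: "adj ?Y ?Y'" unfolding adj_def using assms St by metis+
  have "inv\<^bsub>PGL\<^esub> x \<cdot> y \<in> P" using assms by (intro P_mult P_inv)
  then obtain L g where L: "fst ` set L \<subseteq> \<Gamma>" "g \<in> \<Gamma>" "is_reduced L"
    "inv\<^bsub>PGL\<^esub> x \<cdot> y = syl_prod t L \<cdot> g" using P_normal_form by blast
  have y: "y = x \<cdot> syl_prod t L \<cdot> g"
    by (simp only: PGL.m_assoc[OF carrier_PGL carrier_PGL carrier_PGL] L(4)[symmetric]) simp
  have Y: "?Y = pgl_act (x \<cdot> syl_prod t L) ` \<Omega>"
    unfolding y by (simp only: act_mult invariant[OF L(2)])
  \<comment> \<open>The second alternative covers \<open>?X = ?Y\<close>: the empty word gives no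
    path, so the edge itself is taken, listed from their common end.\<close>
  have "\<exists>p. nb_path p \<and> ?X \<in> set p \<and> ?X' \<in> set p \<and> last p = ?Y \<or> (nb_path p \<and> ?X \<in> set p \<and> ?X' \<in> set p \<and> ?X = ?Y \<and> p = [?X, ?X'])"
  proof (cases "L = []")
    case True
    then have "?X = ?Y" using Y by simp
    then show ?thesis using adjX by (intro exI[of _ "[?X, ?X']"]) simp
  next
    case False
    let ?p = "dpath x L"
    have nb: "nb_path ?p" by (rule domain_path_nb_path[OF L(1,3) False assms(1)])
    obtain q where q: "?p = ?X # q" using domain_path_hd by blast
    then obtain Z r where r: "q = Z # r" using nb by (cases q) auto
    have last: "last ?p = ?Y" using last_domain_path Y by metis
    show ?thesis
    proof (cases "Z = ?X'")
      case True
      then show ?thesis using nb last q r by (intro exI[of _ ?p]) simp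
    next
      case False
      then have "nb_path (?X' # ?p)" using nb adj_commute[OF adjX] unfolding q r by simp
      moreover have "last (?X' # ?p) = ?Y" using last q by simp
      ultimately show ?thesis using q by (intro exI[of _ "?X' # ?p"]) simp
    qed
  qed
  then obtain p where p: "nb_path p" "?X \<in> set p" "?X' \<in> set p" "last p = ?Y \<or> (?X = ?Y \<and> p = [?X, ?X'])" by blast
  show ?thesis
  proof (cases "last p = ?Y")
    case True
    obtain q Z where q: "p = q @ [Z, ?Y]"
    proof -
      have "2 \<le> length p" using p(1) by (cases p rule: nb_path.cases) auto
      then have "butlast p \<noteq> []" "p \<noteq> []" by (cases p; cases "tl p"; auto)+
      then have "p = butlast (butlast p) @ [last (butlast p), last p]"
        by (metis append.assoc append_Cons append_Nil append_butlast_last_id)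
      then show ?thesis using that True by metis
    qed
    show ?thesis
    proof (cases "Z = ?Y'")
      case True
      then show ?thesis using p(1-3) q by (intro exI[of _ p]) simp
    next
      case False
      have "nb_path (q @ [Z, ?Y, ?Y'])" using nb_path_snoc p(1) adjY False unfolding q by blast
      then show ?thesis using p(2,3) unfolding q by (intro exI[of _ "q @ [Z, ?Y, ?Y']"]) auto
    qed
  next
    case False
    then have p': "?X = ?Y" "p = [?X, ?X']" using p(4) by auto
    show ?thesis
    proof (cases "?X' = ?Y'")
      case True
      then show ?thesis using p p' by (intro exI[of _ p]) simp
    next
      case False
      then have "nb_path [?X', ?X, ?Y']" using adj_commute[OF adjX] adjY p'(1) by simp
      then show ?thesis using p'(1) by (intro exI[of _ "[?X', ?X, ?Y']"]) simp
    qed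
  qed
qed

lemma nb_path_proj_path: "nb_path p \<Longrightarrow> proj_path p"
proof (induction p rule: nb_path.induct)
  case (1 X Y Z p)
  then have "adj Y X" "adj Y Z" using adj_commute nb_path_hd[of Y Z p] by auto
  then have "proj_occultation X Y Z" using 1(2) by (intro adj_occ) auto
  then show ?case using 1 by simp
next
  case (2 X Y)
  then show ?case using adj_pair by (simp del: proj_path.simps)
qed auto

lemma domain_path_vertices:
  assumes "fst ` set L \<subseteq> \<Gamma>" "g \<in> P" "X \<in> set (dpath g L)"
  shows "\<exists>y\<in>P. X = pgl_act y ` \<Omega>"
  using assms
proof (induction L arbitrary: g)
  case (Cons x L)
  obtain h e where x: "x = (h, e)" by (cases x)
  have h: "h \<in> \<Gamma>" using Cons.prems x by auto
  have "g \<cdot> (h \<cdot> S e) \<in> P" by (intro P_mult Cons.prems \<Gamma>_in_P S_in_P h)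
  then show ?case using Cons.IH Cons.prems by (auto simp: x)
qed auto

text \<open>Five consecutive vertices suffice. If \<open>x\<close>, up to sign, were in the closures
  of \<open>a0\<close> to \<open>a4\<close>, it would lie in \<open>a1\<close>, between
  \<open>a0\<close> and \<open>a2\<close>, and in \<open>a3\<close>, between \<open>a2\<close> and
  \<open>a4\<close>; but \<open>a1\<close> and \<open>a3\<close> are the ends of an occultation
  triple.\<close>

lemma vertex_avoiding:
  assumes x: "x \<noteq> 0"
  shows "\<exists>y\<in>P. \<exists>b. cone_over b (pgl_act y ` \<Omega>) \<and> x \<notin> closure b \<and> - x \<notin> closure b"
proof -
  let ?L = "replicate 4 (\<one>\<^bsub>PGL\<^esub>, True)"
  have L4: "?L = [(\<one>\<^bsub>PGL\<^esub>, True), (\<one>\<^bsub>PGL\<^esub>, True), (\<one>\<^bsub>PGL\<^esub>, True), (\<one>\<^bsub>PGL\<^esub>, True)]"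
    by (simp add: numeral_eq_Suc)
  have red: "is_reduced ?L" unfolding L4 by simp
  have fst: "fst ` set ?L \<subseteq> \<Gamma>" using one_in by auto
  let ?p = "dpath \<one>\<^bsub>PGL\<^esub> ?L"
  have path: "proj_path ?p" by (rule domain_path_proj_path[OF fst red]) (simp add: L4)
  obtain a0 where a0: "cone_over a0 \<Omega>" using cone by blast
  obtain r where r: "?p = \<Omega> # r" using domain_path_hd[of t \<Omega> "\<one>\<^bsub>PGL\<^esub>" ?L] by (auto simp: act_one)
  have len: "length r = 4" using r unfolding L4 by auto
  obtain q where q: "cone_path (a0 # q)" "list_all2 cone_over q r"
    using proj_path_lift[OF path[unfolded r] a0] by blast
  have "length q = 4" using q(2) len by (simp add: list_all2_lengthD)
  then obtain a1 a2 a3 a4 where q4: "q = [a1, a2, a3, a4]" by (auto simp: length_Suc_conv numeral_eq_Suc)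
  have occs: "cone_occultation a0 a1 a2" "cone_occultation a1 a2 a3" "cone_occultation a2 a3 a4"
    using q(1) unfolding q4 by simp_all
  have "\<exists>a\<in>set (a0 # q). x \<notin> closure a \<and> - x \<notin> closure a"
  proof (rule ccontr)
    assume "\<not> ?thesis"
    then have all: "\<And>a. a \<in> {a0, a1, a2, a3, a4} \<Longrightarrow> x \<in> closure a \<or> - x \<in> closure a" unfolding q4 by auto
    have "x \<in> a1 \<or> - x \<in> a1" using cone_occultation_between[OF occs(1) x] all by simp
    moreover have "x \<in> a3 \<or> - x \<in> a3" using cone_occultation_between[OF occs(3) x] all by simp
    ultimately show False
      using cone_occultationD(8,9)[OF occs(2)] by (auto simp: disjoint_iff in_uminus_image_iff)
  qed
  then obtain a where a: "a \<in> set (a0 # q)" "x \<notin> closure a" "- x \<notin> closure a" by blast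
  have "\<exists>X\<in>set ?p. cone_over a X"
  proof (cases "a = a0")
    case True
    then show ?thesis using a0 r by auto
  next
    case False
    then have "a \<in> set q" using a by simp
    then obtain X where "X \<in> set r" "cone_over a X" using q(2) by (metis in_set_conv_nth list_all2_conv_all_nth)
    then show ?thesis using r by auto
  qed
  then show ?thesis using domain_path_vertices[OF fst P_one] a(2,3) by blast
qed

section \<open>Functionals that vanish on no translate\<close>

definition good :: "'a \<Rightarrow> bool"
  where "good f \<longleftrightarrow> (\<forall>x\<in>P. \<forall>z. z \<noteq> 0 \<longrightarrow> proj_pt z \<in> pgl_act x ` \<Omega> \<longrightarrow> f \<bullet> z \<noteq> 0)"

text \<open>A vertex whose closed cones avoid \<open>x\<close> admits the functional
  \<open>h\<close> with \<open>h \<bullet> x = 0\<close> that the retraction onto the dual boundary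
  uses. The resulting \<open>f\<close> vanishes at a point \<open>p\<close> of
  \<open>closure b\<close>, which rules out one alternative of occultation at each neighbour
  \<open>c\<close>; so \<open>f\<close> is positive on everything beyond \<open>c\<close>.\<close>

lemma good_exists:
  assumes x: "x \<noteq> 0"
  shows "\<exists>f. good f \<and> f \<bullet> x \<noteq> 0"
proof -
  obtain y b where y: "y \<in> P" and b: "cone_over b (pgl_act y ` \<Omega>)" and xb: "x \<notin> closure b" "- x \<notin> closure b"
    using vertex_avoiding[OF x] by blast
  let ?B = "pgl_act y ` \<Omega>"
  have ob: "open_cone b" by (rule cone_over_open_cone[OF b])
  obtain h where h: "\<forall>z\<in>closure b - {0}. 0 < h \<bullet> z" "h \<bullet> x = 0"
    using positive_functional_vanishing[OF ob xb] by blast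
  \<comment> \<open>All lifts of neighbours with the sign for which they meet \<open>b\<close>; the
    family may be infinite.\<close>
  define N where "N = {c. \<exists>C. cone_over c C \<and> adj ?B C \<and> b \<inter> c \<noteq> {}}"
  have nbr: "\<exists>d. cone_over d D \<and> cone_occultation c b d"
    if "cone_over c C" "adj ?B C" "b \<inter> c \<noteq> {}" "adj ?B D" "C \<noteq> D" for c C D
    by (rule proj_occultation_neighbour[OF b that(1,3) adj_occ[OF that(2,4,5)]])
  have N1: "open_cone c \<and> c \<inter> b \<noteq> {} \<and> \<not> c \<subseteq> b \<and> c \<inter> uminus ` b = {}" if cN: "c \<in> N" for c
  proof -
    obtain C where C: "cone_over c C" "adj ?B C" "b \<inter> c \<noteq> {}" using cN by (auto simp: N_def)
    obtain D where D: "adj ?B D" "C \<noteq> D" using adj_other[OF C(2)] by blast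
    obtain d where d: "cone_occultation c b d" using nbr[OF C D] by blast
    show ?thesis
      using cone_occultationD(1,4,6)[OF d] cone_occultation_not_opposite[OF d] by simp
  qed
  have N2: "occults (closure c - {0}) b (closure c' - {0})" if cc: "c \<in> N" "c' \<in> N" "c \<noteq> c'" for c c'
  proof -
    obtain C where C: "cone_over c C" "adj ?B C" "b \<inter> c \<noteq> {}" using cc(1) by (auto simp: N_def)
    obtain C' where C': "cone_over c' C'" "adj ?B C'" "b \<inter> c' \<noteq> {}" using cc(2) by (auto simp: N_def)
    have opp: "b \<inter> uminus ` c = {}" using N1[OF cc(1)] Int_uminus_empty_commute[of c b] by simp
    have "C \<noteq> C'"
    proof
      assume "C = C'"
      then have "c' = c" using cone_over_unique_meet[OF C(1) _ C'(3) opp] C'(1) by simp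
      then show False using cc(3) by simp
    qed
    then obtain d where d: "cone_over d C'" "cone_occultation c b d" using nbr[OF C C'(2)] by blast
    have "b \<inter> uminus ` d = {}"
      using cone_occultation_not_opposite[OF cone_occultation_commute[OF d(2)]] Int_uminus_empty_commute[of d b] by simp
    then have "c' = d" by (rule cone_over_unique_meet[OF d(1) C'(1,3)])
    then show ?thesis using cone_occultationD(10)[OF d(2)] by simp
  qed
  have N_ex: "\<exists>c\<in>N. cone_over c C" if C: "adj ?B C" for C
  proof -
    obtain b' c' where *: "cone_over b' ?B" "cone_over c' C" "b' \<inter> c' \<noteq> {}" using adj_pair[OF C] by auto
    have "?B \<inter> C \<noteq> {}" using * by (auto simp: cone_over_def)
    then obtain c where "cone_over c C" "b \<inter> c \<noteq> {}" using cone_over_meeting[OF b *(2)] by blast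
    then show ?thesis using C by (auto simp: N_def)
  qed
  have adj1: "adj ?B (pgl_act (y \<cdot> S True) ` \<Omega>)" unfolding adj_def using y by blast
  obtain D where D: "adj ?B D" "pgl_act (y \<cdot> S True) ` \<Omega> \<noteq> D" using adj_other[OF adj1] by blast
  obtain c1 where c1: "c1 \<in> N" "cone_over c1 (pgl_act (y \<cdot> S True) ` \<Omega>)" using N_ex[OF adj1] by blast
  obtain c2 where c2: "c2 \<in> N" "cone_over c2 D" using N_ex[OF D(1)] by blast
  have c12: "c1 \<noteq> c2" using c1 c2 D(2) by (auto simp: cone_over_def)
  obtain f p where f: "f \<bullet> x \<noteq> 0" "\<forall>z\<in>b. 0 \<le> f \<bullet> z" "p \<in> closure b - {0}" "f \<bullet> p = 0" "\<forall>c\<in>N. \<forall>z\<in>c. 0 \<le> f \<bullet> z"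
    using exists_unobstructed_functional[OF dim ob _ N2 c1(1) c2(1) c12 _ h(2) x] N1 h(1) by blast
  have f0: "f \<noteq> 0" using f(1) by auto
  have pos: "f \<bullet> z \<noteq> 0" if c: "cone_over c C" "\<forall>z\<in>c. 0 \<le> f \<bullet> z" and z: "z \<noteq> 0" "proj_pt z \<in> C" for c C z
  proof -
    have p: "0 < f \<bullet> w" if "w \<in> c" for w
      using inner_pos_on_open[OF open_coneD(1)[OF cone_over_open_cone[OF c(1)]] f0] c(2) that by blast
    have "z \<in> c \<or> - z \<in> c" using cone_over_mem_iff[OF c(1) z(1)] z(2) by simp
    then show ?thesis using p[of z] p[of "- z"] by auto
  qed
  have "good f"
    unfolding good_def
  proof (intro ballI allI impI)
    fix v z assume v: "v \<in> P" and z: "z \<noteq> 0" "proj_pt z \<in> pgl_act v ` \<Omega>"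
    have "inv\<^bsub>PGL\<^esub> y \<cdot> v \<in> P" using y v by (intro P_mult P_inv)
    then obtain L g where L: "fst ` set L \<subseteq> \<Gamma>" "g \<in> \<Gamma>" "is_reduced L"
      "inv\<^bsub>PGL\<^esub> y \<cdot> v = syl_prod t L \<cdot> g" using P_normal_form by blast
    have "v = y \<cdot> syl_prod t L \<cdot> g"
      by (simp only: PGL.m_assoc[OF carrier_PGL carrier_PGL carrier_PGL] L(4)[symmetric]) simp
    then have V: "pgl_act v ` \<Omega> = pgl_act (y \<cdot> syl_prod t L) ` \<Omega>"
      by (simp only: act_mult invariant[OF L(2)])
    show "f \<bullet> z \<noteq> 0"
    proof (cases "L = []")
      case True
      then show ?thesis using pos[OF b f(2) z(1)] z(2) V by simp
    next
      case False
      let ?p = "dpath y L"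
      have nb: "nb_path ?p" by (rule domain_path_nb_path[OF L(1,3) False y])
      obtain r where r: "?p = ?B # r" using domain_path_hd by blast
      then obtain C r' where r': "r = C # r'" using nb by (cases r) auto
      have adjC: "adj ?B C" using nb nb_path_hd unfolding r r' by blast
      obtain q where q: "cone_path (b # q)" "list_all2 cone_over q r"
        using proj_path_lift[of ?B r b] nb_path_proj_path[OF nb] b unfolding r by blast
      then obtain c q' where q': "q = c # q'" "cone_over c C" "list_all2 cone_over q' r'"
        unfolding r' by (auto simp: list_all2_Cons2)
      have "b \<inter> c \<noteq> {}" using q(1) unfolding q'(1) by (cases q') (auto dest: cone_occultationD(6))
      then have "c \<in> N" using q'(2) adjC by (auto simp: N_def)
      then have fc: "\<forall>z\<in>c. 0 \<le> f \<bullet> z" using f(5) by blast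
      have "occults (closure b - {0}) c (\<Union>d\<in>set q'. closure d - {0})"
        by (rule cone_path_occults[OF dim]) (use q(1) q'(1) in simp)
      then have rest: "\<forall>z\<in>\<Union>d\<in>set q'. closure d - {0}. 0 < f \<bullet> z"
        using f0 fc f(3,4) unfolding occults_def by (metis less_irrefl)
      have "last ?p = pgl_act v ` \<Omega>" using last_domain_path V by metis
      then have lr: "last r = pgl_act v ` \<Omega>" using r r' by simp
      have "length q = length r" "q \<noteq> []" "r \<noteq> []" using q(2) r' q'(1) by (auto simp: list_all2_lengthD)
      then have lq: "cone_over (last q) (pgl_act v ` \<Omega>)"
        using q(2) unfolding lr[symmetric] by (simp add: last_conv_nth list_all2_conv_all_nth)
      have "0 \<le> f \<bullet> w" if w: "w \<in> last q" for w
      proof (cases "last q = c")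
        case True
        then show ?thesis using fc w by simp
      next
        case False
        then have "last q \<in> set q'" using q'(1) by (metis last.simps last_in_set)
        moreover have "w \<in> closure (last q) - {0}" by (rule open_cone_closure[OF cone_over_open_cone[OF lq] w])
        ultimately show ?thesis using rest by (auto intro: less_imp_le)
      qed
      then show ?thesis using pos[OF lq _ z] by blast
    qed
  qed
  then show ?thesis using f(1) by blast
qed

section \<open>The convex cone over the union of the hulls\<close>

definition positive_cone :: "'a \<Rightarrow> 'a proj set \<Rightarrow> 'a set"
  where "positive_cone f X = {z. 0 < f \<bullet> z \<and> proj_pt z \<in> X}"

text \<open>A good functional has constant sign on either lift, so asking for positive values
  selects one lift of every translate coherently.\<close>

lemma positive_cone_over:
  assumes f: "good f" and x: "x \<in> P"
  shows "cone_over (positive_cone f (pgl_act x ` \<Omega>)) (pgl_act x ` \<Omega>)"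
proof -
  let ?X = "pgl_act x ` \<Omega>"
  obtain F where F: "bij (blinfun_apply F)" "x = pgl_class F" by (rule pgl_class_cases)
  obtain a0 where "cone_over a0 \<Omega>" using cone by blast
  then have a: "cone_over (blinfun_apply F ` a0) ?X" unfolding F(2) by (rule cone_over_linear_image[OF _ F(1)])
  define a where "a = blinfun_apply F ` a0"
  have a: "cone_over a ?X" using a by (simp add: a_def)
  have oc: "open_cone a" by (rule cone_over_open_cone[OF a])
  have nz: "f \<bullet> z \<noteq> 0" if z: "z \<in> a" for z
  proof -
    have "z \<noteq> 0" using z zero_notin_open_cone[OF oc] by auto
    moreover have "proj_pt z \<in> ?X" using z a by (auto simp: cone_over_def)
    ultimately show ?thesis using f x by (simp add: good_def)
  qed
  have "(\<forall>z\<in>a. 0 < f \<bullet> z) \<or> (\<forall>z\<in>a. f \<bullet> z < 0)"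
    by (rule nonvanishing_on_connected[OF convex_connected[OF open_coneD(3)[OF oc]] nz])
  moreover have "\<forall>z\<in>uminus ` a. 0 < f \<bullet> z" if "\<forall>z\<in>a. f \<bullet> z < 0" using that by simp
  ultimately have "\<exists>c. cone_over c ?X \<and> (\<forall>z\<in>c. 0 < f \<bullet> z)"
    using a cone_over_uminus[OF a] by blast
  then obtain c where c: "cone_over c ?X" "\<forall>z\<in>c. 0 < f \<bullet> z" by blast
  have "positive_cone f ?X = c"
  proof (rule Set.set_eqI)
    fix z
    show "z \<in> positive_cone f ?X \<longleftrightarrow> z \<in> c"
    proof
      assume z: "z \<in> positive_cone f ?X"
      then have "z \<noteq> 0" "f \<bullet> z > 0" "proj_pt z \<in> ?X" by (auto simp: positive_cone_def)
      moreover from this have "- z \<notin> c" using c(2) by force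
      ultimately show "z \<in> c" using cone_over_mem_iff[OF c(1)] by blast
    next
      assume "z \<in> c"
      then show "z \<in> positive_cone f ?X" using c by (auto simp: positive_cone_def cone_over_def)
    qed
  qed
  then show ?thesis using c(1) by simp
qed

lemma positive_cone_meet:
  assumes "X \<inter> Y \<noteq> {}" "good f" "x \<in> P" "X = pgl_act x ` \<Omega>"
  shows "positive_cone f X \<inter> positive_cone f Y \<noteq> {}"
proof -
  have c: "cone_over (positive_cone f X) X" using positive_cone_over[OF assms(2,3)] assms(4) by simp
  obtain p where p: "p \<in> X" "p \<in> Y" using assms(1) by blast
  have "p \<in> proj_pt ` positive_cone f X" using p(1) c by (simp add: cone_over_def)
  then obtain z where z: "z \<in> positive_cone f X" "p = proj_pt z" by blast
  then have "z \<in> positive_cone f Y" using p(2) by (simp add: positive_cone_def)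
  then show ?thesis using z(1) by blast
qed

lemma positive_cone_not_opposite: "positive_cone f X \<inter> uminus ` positive_cone f Y = {}"
  by (auto simp: positive_cone_def)

lemma adj_meet: "adj X Y \<Longrightarrow> X \<inter> Y \<noteq> {}"
proof -
  assume "adj X Y"
  then obtain a b where "cone_over a X" "cone_over b Y" "a \<inter> b \<noteq> {}" using adj_pair[of X Y] by auto
  then show "X \<inter> Y \<noteq> {}" unfolding cone_over_def by blast
qed

lemma adj_vertex: "adj X Y \<Longrightarrow> \<exists>x\<in>P. X = pgl_act x ` \<Omega>"
  unfolding adj_def by blast

text \<open>Lift a triple starting from its first positive cone. The next positive cone meets the
  previous one, and the opposite lift does not, so uniqueness identifies the lifted cones with the
  positive ones.\<close>

lemma positive_cone_path:
  assumes f: "good f" and "nb_path p"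
  shows "cone_path (map (positive_cone f) p)"
  using assms(2)
proof (induction p rule: nb_path.induct)
  case (1 X Y Z p)
  let ?c = "positive_cone f"
  have XY: "adj X Y" and YZ: "adj Y Z" using 1(2) nb_path_hd[of Y Z p] by auto
  have occ: "proj_occultation X Y Z" using adj_occ[OF adj_commute[OF XY] YZ] 1(2) by simp
  obtain x y z where x: "x \<in> P" "X = pgl_act x ` \<Omega>" and y: "y \<in> P" "Y = pgl_act y ` \<Omega>"
    and z: "z \<in> P" "Z = pgl_act z ` \<Omega>"
    using adj_vertex[OF XY] adj_vertex[OF YZ] adj_vertex[OF adj_commute[OF YZ]] by blast
  have c: "cone_over (?c X) X" "cone_over (?c Y) Y" "cone_over (?c Z) Z"
    using positive_cone_over[OF f x(1)] positive_cone_over[OF f y(1)] positive_cone_over[OF f z(1)] x(2) y(2) z(2) by simp_all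
  obtain b d where b: "cone_over b Y" "cone_over d Z" "cone_occultation (?c X) b d"
    using proj_occultation_cones[OF occ c(1)] by blast
  have "?c Y = b"
    by (rule cone_over_unique_meet[OF b(1) c(2) positive_cone_meet[OF adj_meet[OF XY] f x]
          cone_occultation_not_opposite[OF b(3)]])
  moreover have "?c Z = d"
  proof (rule cone_over_unique_meet[OF b(2) c(3) positive_cone_meet[OF adj_meet[OF YZ] f y]])
    show "?c Y \<inter> uminus ` d = {}"
      using cone_occultation_not_opposite[OF cone_occultation_commute[OF b(3)]] Int_uminus_empty_commute[of d b]
        \<open>?c Y = b\<close> by simp
  qed
  ultimately have "cone_occultation (?c X) (?c Y) (?c Z)" using b(3) by simp
  then show ?case using 1 by simp
next
  case (2 X Y)
  then have XY: "adj X Y" by simp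
  obtain x y where x: "x \<in> P" "X = pgl_act x ` \<Omega>" and y: "y \<in> P" "Y = pgl_act y ` \<Omega>"
    using adj_vertex[OF XY] adj_vertex[OF adj_commute[OF XY]] by blast
  have "open_cone (positive_cone f X)" "open_cone (positive_cone f Y)"
    using positive_cone_over[OF f x(1)] positive_cone_over[OF f y(1)] x(2) y(2) cone_over_open_cone by blast+
  then show ?case
    using positive_cone_meet[OF adj_meet[OF XY] f x] positive_cone_not_opposite by simp
qed auto

definition edge_cone :: "'a \<Rightarrow> 'a pgl \<Rightarrow> 'a set"
  where "edge_cone f x = gen (positive_cone f (pgl_act x ` \<Omega>) \<union> positive_cone f (pgl_act (x \<cdot> t) ` \<Omega>))"

definition total_cone :: "'a \<Rightarrow> 'a set"
  where "total_cone f = (\<Union>x\<in>P. edge_cone f x)"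

lemma adj_edge: "x \<in> P \<Longrightarrow> adj (pgl_act x ` \<Omega>) (pgl_act (x \<cdot> t) ` \<Omega>)"
  unfolding adj_def by (intro bexI[of _ x] exI[of _ True]) (simp_all add: stable_power_def)

lemma x_t_in_P: "x \<in> P \<Longrightarrow> x \<cdot> t \<in> P"
  using P_mult[of x "S True"] S_in_P[of True] by (simp add: stable_power_def)

text \<open>An edge leaving \<open>x\<close> along the inverse of \<open>t\<close> is the
  \<open>t\<close>-edge of its other end, so indexing edges by \<open>x\<close> in \<open>P\<close>
  covers both orientations.\<close>

lemma adj_edge_cone:
  assumes "adj X Y"
  shows "gen (positive_cone f X \<union> positive_cone f Y) \<subseteq> total_cone f"
proof -
  obtain x e where x: "x \<in> P" "X = pgl_act x ` \<Omega>" "Y = pgl_act (x \<cdot> S e) ` \<Omega>"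
    using assms unfolding adj_def by blast
  show ?thesis
  proof (cases e)
    case True
    then have "gen (positive_cone f X \<union> positive_cone f Y) = edge_cone f x"
      by (simp add: edge_cone_def x stable_power_def)
    then show ?thesis using x(1) unfolding total_cone_def by blast
  next
    case False
    let ?y = "x \<cdot> S e"
    have "?y \<cdot> t = x" using False by (simp add: stable_power_def PGL.m_assoc)
    then have "gen (positive_cone f X \<union> positive_cone f Y) = edge_cone f ?y"
      by (simp add: edge_cone_def x Un_commute)
    then show ?thesis using P_mult[OF x(1) S_in_P[of e]] unfolding total_cone_def by blast
  qed
qed

lemma positive_cone_scale: "0 < r \<Longrightarrow> z \<in> positive_cone f X \<Longrightarrow> r *\<^sub>R z \<in> positive_cone f X"
  unfolding positive_cone_def by (cases "z = 0") (auto simp: proj_pt_scale)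

lemma edge_cone_scale: "0 < r \<Longrightarrow> z \<in> edge_cone f x \<Longrightarrow> r *\<^sub>R z \<in> edge_cone f x"
  unfolding edge_cone_def by (rule gen_scale) (auto intro: positive_cone_scale)

lemma total_cone_add:
  assumes f: "good f" and "z \<in> total_cone f" "w \<in> total_cone f"
  shows "z + w \<in> total_cone f"
proof -
  let ?c = "positive_cone f"
  obtain x y where x: "x \<in> P" "z \<in> edge_cone f x" and y: "y \<in> P" "w \<in> edge_cone f y"
    using assms unfolding total_cone_def by blast
  obtain p where p: "nb_path p" "pgl_act x ` \<Omega> \<in> set p" "pgl_act (x \<cdot> t) ` \<Omega> \<in> set p"
    "pgl_act y ` \<Omega> \<in> set p" "pgl_act (y \<cdot> t) ` \<Omega> \<in> set p"
    using edges_on_path[OF x(1) y(1)] by blast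
  have "edge_cone f x \<subseteq> gen (\<Union>(set (map ?c p)))" "edge_cone f y \<subseteq> gen (\<Union>(set (map ?c p)))"
    unfolding edge_cone_def using p(2-) by (intro gen_mono; auto)+
  then have "z + w \<in> gen (\<Union>(set (map ?c p)))" using x(2) y(2) by (intro gen_closed_add) blast+
  then obtain i where "Suc i < length (map ?c p)" "z + w \<in> gen (map ?c p ! i \<union> map ?c p ! Suc i)"
    using cone_path_gen[OF dim positive_cone_path[OF f p(1)]] by metis
  then have i: "Suc i < length p" "z + w \<in> gen (?c (p ! i) \<union> ?c (p ! Suc i))" by simp_all
  then show ?thesis using adj_edge_cone[OF nb_path_nth[OF p(1) i(1)]] by blast
qed

text \<open>The cone is built from \<open>f\<close>, yet any other good functional has constant sign
  on the union of two adjacent cones, hence no zero among their sums. This makes every good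
  functional available for proving sharpness.\<close>

lemma total_cone_nonvanishing:
  assumes f: "good f" and g: "good g" and z: "z \<in> total_cone f"
  shows "g \<bullet> z \<noteq> 0"
proof -
  let ?c = "positive_cone f"
  obtain x where x: "x \<in> P" "z \<in> edge_cone f x" using z unfolding total_cone_def by blast
  let ?X = "pgl_act x ` \<Omega>" and ?Y = "pgl_act (x \<cdot> t) ` \<Omega>"
  have c: "cone_over (?c ?X) ?X" "cone_over (?c ?Y) ?Y"
    using positive_cone_over[OF f] x(1) x_t_in_P by blast+
  have nz: "g \<bullet> w \<noteq> 0" if w: "w \<in> ?c ?X \<union> ?c ?Y" for w
  proof -
    have "w \<noteq> 0" "proj_pt w \<in> ?X \<or> proj_pt w \<in> ?Y" using w by (auto simp only: positive_cone_def mem_Collect_eq Un_iff inner_zero_right less_irrefl)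
    then show ?thesis using g x(1) x_t_in_P[OF x(1)] unfolding good_def by blast
  qed
  have "connected (?c ?X \<union> ?c ?Y)"
    using c positive_cone_meet[OF adj_meet[OF adj_edge[OF x(1)]] f x(1)]
    by (intro connected_Un convex_connected open_coneD(3) cone_over_open_cone[OF c(1)] cone_over_open_cone[OF c(2)]) auto
  from nonvanishing_on_connected[OF this nz]
  consider "\<And>w. w \<in> ?c ?X \<union> ?c ?Y \<Longrightarrow> 0 < g \<bullet> w" | "\<And>w. w \<in> ?c ?X \<union> ?c ?Y \<Longrightarrow> 0 < (- g) \<bullet> w"
    unfolding inner_minus_left neg_0_less_iff_less by blast
  then show ?thesis
    using inner_pos_gen[of "?c ?X \<union> ?c ?Y" g z] inner_pos_gen[of "?c ?X \<union> ?c ?Y" "- g" z] x(2)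
    unfolding edge_cone_def by cases auto
qed

lemma open_cone_total_cone:
  assumes f: "good f"
  shows "open_cone (total_cone f)"
proof -
  have scale: "r *\<^sub>R z \<in> total_cone f" if "0 < r" "z \<in> total_cone f" for r z
    using that edge_cone_scale unfolding total_cone_def by blast
  have op: "open (total_cone f)"
    unfolding total_cone_def edge_cone_def
    using positive_cone_over[OF f] x_t_in_P open_coneD(1) cone_over_open_cone
    by (intro open_UN ballI open_gen open_Un) blast+
  have "positive_cone f (pgl_act \<one>\<^bsub>PGL\<^esub> ` \<Omega>) \<noteq> {}"
    using open_coneD(2)[OF cone_over_open_cone[OF positive_cone_over[OF f P_one]]] .
  then obtain z where "z \<in> positive_cone f (pgl_act \<one>\<^bsub>PGL\<^esub> ` \<Omega>)" by blast
  then have "z \<in> edge_cone f \<one>\<^bsub>PGL\<^esub>" unfolding edge_cone_def by (intro gen.gen_base UnI1)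
  then have ne: "total_cone f \<noteq> {}" unfolding total_cone_def using P_one by blast
  have conv: "convex (total_cone f)"
  proof (rule convexI)
    fix x y and u v :: real
    assume x: "x \<in> total_cone f" "y \<in> total_cone f" and uv: "0 \<le> u" "0 \<le> v" "u + v = 1"
    show "u *\<^sub>R x + v *\<^sub>R y \<in> total_cone f"
    proof (cases "u = 0 \<or> v = 0")
      case True
      then show ?thesis using x uv by auto
    next
      case False
      then show ?thesis using x uv scale by (intro total_cone_add f) auto
    qed
  qed
  \<comment> \<open>Convexity, already established, makes the total cone connected, so each good
    functional has constant sign on it and becomes nonnegative after a change of sign.\<close>
  have "\<exists>g. g \<bullet> x \<noteq> 0 \<and> (\<forall>z\<in>total_cone f. 0 \<le> g \<bullet> z)" if x: "x \<noteq> 0" for x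
  proof -
    obtain g where g: "good g" "g \<bullet> x \<noteq> 0" using good_exists[OF x] by blast
    have nz: "g \<bullet> z \<noteq> 0" if "z \<in> total_cone f" for z by (rule total_cone_nonvanishing[OF f g(1) that])
    have "(\<forall>z\<in>total_cone f. 0 < g \<bullet> z) \<or> (\<forall>z\<in>total_cone f. g \<bullet> z < 0)"
      by (rule nonvanishing_on_connected[OF convex_connected[OF conv] nz])
    then show ?thesis
    proof
      assume "\<forall>z\<in>total_cone f. 0 < g \<bullet> z"
      then show ?thesis using g(2) by (intro exI[of _ g]) (auto intro: less_imp_le)
    next
      assume "\<forall>z\<in>total_cone f. g \<bullet> z < 0"
      then show ?thesis using g(2) by (intro exI[of _ "- g"]) (auto intro: less_imp_le)
    qed
  qed
  then have "\<exists>g. \<forall>z\<in>closure (total_cone f) - {0}. 0 < g \<bullet> z" by (rule spanning_functionals_positive)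
  then show ?thesis using op ne conv scale unfolding open_cone_def by blast
qed

lemma good_chart:
  assumes f: "good f" and x: "x \<in> P"
  shows "blinfun_inner_right f \<noteq> 0"
    and "pgl_act x ` \<Omega> \<union> pgl_act (x \<cdot> t) ` \<Omega> \<subseteq> affine_chart (blinfun_inner_right f)"
proof -
  obtain z where "z \<in> positive_cone f (pgl_act x ` \<Omega>)"
    using open_coneD(2)[OF cone_over_open_cone[OF positive_cone_over[OF f x]]] by blast
  then have "f \<noteq> 0" by (auto simp: positive_cone_def)
  then show nz: "blinfun_inner_right f \<noteq> 0" by (rule blinfun_inner_right_nonzero)
  show "pgl_act x ` \<Omega> \<union> pgl_act (x \<cdot> t) ` \<Omega> \<subseteq> affine_chart (blinfun_inner_right f)"
    using f x x_t_in_P[OF x] unfolding subset_affine_chart_iff[OF nz] good_def blinfun_inner_right.rep_eq by blast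
qed

text \<open>A linear map representing \<open>x\<close> may carry positive cones to negative ones.
  This does no harm: the translated hull and the image of \<open>edge_cone f x\<close> are both the
  chart hull of the two translates in the chart of \<open>f\<close>.\<close>

lemma base_hull:
  assumes f: "good f"
  shows "proj_hull_well_defined (\<Omega> \<union> pgl_act t ` \<Omega>)"
    and "x \<in> P \<Longrightarrow> pgl_act x ` proj_hull (\<Omega> \<union> pgl_act t ` \<Omega>) = proj_pt ` edge_cone f x"
proof -
  let ?c = "positive_cone f"
  let ?\<phi> = "blinfun_inner_right f"
  have meet: "?c (pgl_act x ` \<Omega>) \<inter> ?c (pgl_act (x \<cdot> t) ` \<Omega>) \<noteq> {}" if "x \<in> P" for x
    by (rule positive_cone_meet[OF adj_meet[OF adj_edge[OF that]] f that HOL.refl])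
  have c: "cone_over (?c (pgl_act x ` \<Omega>)) (pgl_act x ` \<Omega>)"
    "cone_over (?c (pgl_act (x \<cdot> t) ` \<Omega>)) (pgl_act (x \<cdot> t) ` \<Omega>)" if "x \<in> P" for x
    using positive_cone_over[OF f] that x_t_in_P by blast+
  let ?a = "?c \<Omega>" and ?b = "?c (pgl_act t ` \<Omega>)"
  have ab: "cone_over ?a \<Omega>" "cone_over ?b (pgl_act t ` \<Omega>)" "?a \<inter> ?b \<noteq> {}"
    using c[OF P_one] meet[OF P_one] by (simp_all add: act_one)
  have chart: "?\<phi> \<noteq> 0" "\<Omega> \<union> pgl_act t ` \<Omega> \<subseteq> affine_chart ?\<phi>"
    using good_chart[OF f P_one] by (simp_all add: act_one)
  have hull: "proj_hull_well_defined (\<Omega> \<union> pgl_act t ` \<Omega>)"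
    "proj_hull (\<Omega> \<union> pgl_act t ` \<Omega>) = proj_pt ` gen (?a \<union> ?b)"
    using proj_hull_cones[OF ab chart] by blast+
  show "proj_hull_well_defined (\<Omega> \<union> pgl_act t ` \<Omega>)" by (rule hull(1))
  assume x: "x \<in> P"
  obtain F where F: "bij (blinfun_apply F)" "x = pgl_class F" by (rule pgl_class_cases)
  have lin: "linear (blinfun_apply F)" by (intro bounded_linear.linear blinfun.bounded_linear_right)
  have g0: "z \<noteq> 0" if z: "z \<in> gen (?a \<union> ?b)" for z
  proof -
    have "0 < f \<bullet> z" by (rule inner_pos_gen[OF _ z]) (auto simp: positive_cone_def)
    then show ?thesis by auto
  qed
  have "pgl_act x ` proj_pt ` gen (?a \<union> ?b) = proj_pt ` blinfun_apply F ` gen (?a \<union> ?b)"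
    unfolding image_image F(2) using g0 by (intro image_cong HOL.refl pgl_act_class F(1)) auto
  also have "\<dots> = proj_pt ` gen (blinfun_apply F ` ?a \<union> blinfun_apply F ` ?b)"
    unfolding gen_linear_image[OF lin] image_Un ..
  also have "\<dots> = chart_hull ?\<phi> (pgl_act x ` \<Omega> \<union> pgl_act (x \<cdot> t) ` \<Omega>)"
  proof (rule chart_hull_eq[symmetric])
    show "cone_over (blinfun_apply F ` ?a) (pgl_act x ` \<Omega>)"
      unfolding F(2) by (rule cone_over_linear_image[OF ab(1) F(1)])
    show "cone_over (blinfun_apply F ` ?b) (pgl_act (x \<cdot> t) ` \<Omega>)"
      unfolding act_mult F(2) by (rule cone_over_linear_image[OF ab(2) F(1)])
    show "blinfun_apply F ` ?a \<inter> blinfun_apply F ` ?b \<noteq> {}" using ab(3) by blast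
  qed (rule good_chart[OF f x])+
  also have "\<dots> = proj_pt ` edge_cone f x"
    unfolding edge_cone_def by (rule chart_hull_eq[OF c[OF x] meet[OF x] good_chart[OF f x]])
  finally show "pgl_act x ` proj_hull (\<Omega> \<union> pgl_act t ` \<Omega>) = proj_pt ` edge_cone f x" unfolding hull(2) .
qed

lemma ex_good: "\<exists>f. good f"
proof -
  obtain b :: 'a where "b \<in> Basis" using nonempty_Basis by blast
  then have "b \<noteq> 0" by (rule nonzero_Basis)
  then show ?thesis using good_exists by blast
qed

lemma hnn_domain_eq: "hnn_domain \<Gamma> t \<Omega> = (\<Union>x\<in>P. pgl_act x ` proj_hull (\<Omega> \<union> pgl_act t ` \<Omega>))"
  unfolding hnn_domain_def P_def by simp

lemma hnn_domain_properly_convex: "properly_convex (hnn_domain \<Gamma> t \<Omega>)"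
proof -
  obtain f where f: "good f" using ex_good by blast
  have "hnn_domain \<Gamma> t \<Omega> = proj_pt ` total_cone f"
    unfolding hnn_domain_eq total_cone_def image_UN using base_hull(2)[OF f] by (intro SUP_cong) auto
  then have "cone_over (total_cone f) (hnn_domain \<Gamma> t \<Omega>)"
    using open_cone_total_cone[OF f] by (simp add: cone_over_def)
  then show ?thesis by (rule cone_over_imp_properly_convex)
qed

lemma hnn_domain_invariant:
  assumes "x \<in> P"
  shows "pgl_act x ` hnn_domain \<Gamma> t \<Omega> = hnn_domain \<Gamma> t \<Omega>"
proof -
  have sub: "pgl_act x ` hnn_domain \<Gamma> t \<Omega> \<subseteq> hnn_domain \<Gamma> t \<Omega>" if x: "x \<in> P" for x
    unfolding hnn_domain_eq image_UN act_mult[symmetric] using P_mult[OF x] by blast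
  have "hnn_domain \<Gamma> t \<Omega> = pgl_act x ` pgl_act (inv\<^bsub>PGL\<^esub> x) ` hnn_domain \<Gamma> t \<Omega>" by (simp add: act_inv)
  also have "\<dots> \<subseteq> pgl_act x ` hnn_domain \<Gamma> t \<Omega>" using sub[OF P_inv[OF assms]] by (rule image_mono)
  finally show ?thesis using sub[OF assms] by blast
qed

end

theorem theorem1p4:
  fixes \<Gamma>\<^sub>0 :: "'a::euclidean_space pgl set"
    and \<Omega>\<^sub>0 :: "'a proj set"
    and t :: "'a pgl"
  assumes "DIM('a) \<ge> 3"
    and "subgroup \<Gamma>\<^sub>0 PGL" and "\<Gamma>\<^sub>0 \<noteq> {\<one>\<^bsub>PGL\<^esub>}" and "discrete \<Gamma>\<^sub>0"
    and "properly_convex \<Omega>\<^sub>0"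
    and "\<And>\<gamma>. \<gamma> \<in> \<Gamma>\<^sub>0 \<Longrightarrow> pgl_act \<gamma> ` \<Omega>\<^sub>0 = \<Omega>\<^sub>0"
    and "\<And>\<gamma>. \<gamma> \<in> \<Gamma>\<^sub>0 \<Longrightarrow>
      occultation_position (pgl_act t ` \<Omega>\<^sub>0) \<Omega>\<^sub>0 (pgl_act (\<gamma> \<otimes>\<^bsub>PGL\<^esub> inv\<^bsub>PGL\<^esub> t) ` \<Omega>\<^sub>0)"
    and "\<And>(\<epsilon>::int) \<gamma>'. \<epsilon> \<in> {1, -1} \<Longrightarrow> \<gamma>' \<in> \<Gamma>\<^sub>0 - conj_by (t [^]\<^bsub>PGL\<^esub> \<epsilon>) ` \<Gamma>\<^sub>0 \<Longrightarrow>
      occultation_position (pgl_act (t [^]\<^bsub>PGL\<^esub> \<epsilon>) ` \<Omega>\<^sub>0) \<Omega>\<^sub>0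
        (pgl_act (\<gamma>' \<otimes>\<^bsub>PGL\<^esub> (t [^]\<^bsub>PGL\<^esub> \<epsilon>)) ` \<Omega>\<^sub>0)"
  shows "discrete_faithful (pgl_hnn \<Gamma>\<^sub>0 t) (pgl_hnn_rep t)
    \<and> proj_hull_well_defined (\<Omega>\<^sub>0 \<union> pgl_act t ` \<Omega>\<^sub>0)
    \<and> (\<forall>\<gamma>\<in>carrier (pgl_hnn \<Gamma>\<^sub>0 t). pgl_act (pgl_hnn_rep t \<gamma>) ` hnn_domain \<Gamma>\<^sub>0 t \<Omega>\<^sub>0 = hnn_domain \<Gamma>\<^sub>0 t \<Omega>\<^sub>0)
    \<and> properly_convex (hnn_domain \<Gamma>\<^sub>0 t \<Omega>\<^sub>0)"
proof -
  have one: "\<one>\<^bsub>PGL\<^esub> \<in> \<Gamma>\<^sub>0" by (rule subgroup.one_closed[OF assms(2)])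
  \<comment> \<open>\<open>properly_convex\<close> admits the empty set; an occultation triple
    excludes it.\<close>
  have ne: "\<Omega>\<^sub>0 \<noteq> {}" using assms(7)[OF one] by (auto simp: occultation_position_def)
  obtain a where a: "cone_over a \<Omega>\<^sub>0" using properly_convex_imp_cone_over[OF assms(5) ne] by blast
  have act: "\<exists>b. cone_over b (pgl_act g ` \<Omega>\<^sub>0)" for g
  proof -
    obtain F where F: "bij (blinfun_apply F)" "g = pgl_class F" by (rule pgl_class_cases)
    show ?thesis using cone_over_linear_image[OF a F(1)] F(2) by blast
  qed
  have po: "proj_occultation (pgl_act g ` \<Omega>\<^sub>0) \<Omega>\<^sub>0 (pgl_act h ` \<Omega>\<^sub>0)"
    if o: "occultation_position (pgl_act g ` \<Omega>\<^sub>0) \<Omega>\<^sub>0 (pgl_act h ` \<Omega>\<^sub>0)" for g h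
  proof -
    obtain b c where "cone_over b (pgl_act g ` \<Omega>\<^sub>0)" "cone_over c (pgl_act h ` \<Omega>\<^sub>0)" using act by metis
    then show ?thesis by (rule occultation_imp_proj_occultation[OF _ a _ o])
  qed
  have pow: "stable_power t e = t [^]\<^bsub>PGL\<^esub> (if e then 1 else -1 :: int)" for e
    by (simp add: stable_power_def PGL.int_pow_neg)
  interpret occulting_hnn \<Gamma>\<^sub>0 t \<Omega>\<^sub>0
  proof (rule occulting_hnn.intro)
    show "3 \<le> DIM('a)" by (rule assms(1))
    show "subgroup \<Gamma>\<^sub>0 PGL" by (rule assms(2))
    show "\<exists>a. cone_over a \<Omega>\<^sub>0" using a by blast
    show "pgl_act \<gamma> ` \<Omega>\<^sub>0 = \<Omega>\<^sub>0" if "\<gamma> \<in> \<Gamma>\<^sub>0" for \<gamma> by (rule assms(6)[OF that])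
    fix \<gamma> e e' assume \<gamma>: "\<gamma> \<in> \<Gamma>\<^sub>0" and c: "e \<noteq> e' \<or> \<gamma> \<notin> conj_by (stable_power t e) ` \<Gamma>\<^sub>0"
    show "proj_occultation (pgl_act (stable_power t e) ` \<Omega>\<^sub>0) \<Omega>\<^sub>0 (pgl_act (\<gamma> \<otimes>\<^bsub>PGL\<^esub> stable_power t e') ` \<Omega>\<^sub>0)"
    proof (cases "e = e'")
      case True
      then have "\<gamma> \<in> \<Gamma>\<^sub>0 - conj_by (t [^]\<^bsub>PGL\<^esub> (if e then 1 else -1 :: int)) ` \<Gamma>\<^sub>0"
        using c \<gamma> unfolding pow by blast
      then show ?thesis unfolding True[symmetric] pow by (intro po assms(8)) auto
    next
      case False
      show ?thesis
      proof (cases e)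
        case True
        then show ?thesis using po[OF assms(7)[OF \<gamma>]] False by (simp add: stable_power_def)
      next
        case e: False
        have i: "inv\<^bsub>PGL\<^esub> \<gamma> \<in> \<Gamma>\<^sub>0" using subgroup.m_inv_closed[OF assms(2) \<gamma>] by simp
        \<comment> \<open>The first occultation hypothesis for the inverse of
          \<open>\<gamma>\<close>, translated by \<open>\<gamma>\<close> and read backwards, settles
          the exponents -1 and 1.\<close>
        from proj_occultation_act[OF po[OF assms(7)[OF i]], of \<gamma>]
        have "proj_occultation (pgl_act (\<gamma> \<otimes>\<^bsub>PGL\<^esub> t) ` \<Omega>\<^sub>0) \<Omega>\<^sub>0 (pgl_act (inv\<^bsub>PGL\<^esub> t) ` \<Omega>\<^sub>0)"
          unfolding act_mult[symmetric] assms(6)[OF \<gamma>] by simp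
        then show ?thesis using e False by (simp add: stable_power_def proj_occultation_commute)
      qed
    qed
  qed
  obtain f where f: "good f" using ex_good by blast
  have "\<forall>\<gamma>\<in>carrier E. pgl_act (\<rho> \<gamma>) ` hnn_domain \<Gamma>\<^sub>0 t \<Omega>\<^sub>0 = hnn_domain \<Gamma>\<^sub>0 t \<Omega>\<^sub>0"
    using hnn_domain_invariant unfolding P_def by blast
  then show ?thesis
    using discrete_faithful_\<rho>[OF assms(4)] base_hull(1)[OF f] hnn_domain_properly_convex by blast
qed

end
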